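(* Let $p$ be a prime and $q$ a power of $p$. (i) For any positive integer $n$ and any $\xi\in\mathbb{F}_q((T^{-1}))$ that is not algebraic of degree at most $n$, if $w_n(\xi)=n$ then $w_n^*(\xi)=n$. (ii) For almost all $\xi\in\mathbb{F}_q((T^{-1}))$ (with respect to Haar measure), $w_n^*(\xi)=n$ for every integer $n\ge1$.
   Context: $\mathbb{F}_q$ is the field with $q$ elements. For a nonzero $\xi=\sum_{k\ge N} a_k T^{-k}\in\mathbb{F}_q((T^{-1}))$ with $a_N\neq 0$, set $|\xi|=q^{-N}$, and $|0|=0$. The height $H(P)$ of $P\in\mathbb{F}_q[T][X]$ is the maximum of the absolute values of its coefficients. An element $\alpha$ of $\mathbb{F}_q((T^{-1}))$ is algebraic if it is a root of a nonzero polynomial in $\mathbb{F}_q[T][X]$; its degree and height $H(\alpha)$ are those of its minimal defining polynomial over $\mathbb{F}_q[T]$. $w_n(\xi)$ is the supremum of the real $w$ such that $0<|P(\xi)|<H(P)^{-w}$ has infinitely many solutions $P\in\mathbb{F}_q[T][X]$ of degree at most $n$. $w_n^*(\xi)$ is the supremum of the real $w^*$ such that $0<|\xi-\alpha|<H(\alpha)^{-w^*-1}$ has infinitely many solutions in algebraic $\alpha\in\mathbb{F}_q((T^{-1}))$ of degree at most $n$. *)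

theory Defs
  imports
    "HOL-Analysis.Analysis"
    "HOL-Computational_Algebra.Computational_Algebra"
begin

text \<open>
  The finite field with \<open>q\<close> elements is a type \<open>'a::{finite,field}\<close> with \<open>q = CARD('a)\<close>.
  The field of Laurent series in \<open>1/T\<close> over it is \<open>'a fls\<close>, where the variable \<open>fls_X\<close> of the
  library stands for \<open>1/T\<close>; hence \<open>T\<close> itself is \<open>fls_X_inv\<close>, and the series
  \<open>a\<^sub>N T^(-N) + a\<^sub>N\<^sub>+\<^sub>1 T^(-N-1) + ...\<close> with nonzero \<open>a\<^sub>N\<close> has \<open>fls_subdegree\<close> equal to \<open>N\<close>.
  Polynomials in \<open>T\<close> are elements of \<open>'a poly\<close>, and polynomials in \<open>X\<close> over them are elements
  of \<open>'a poly poly\<close>.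
\<close>

definition laurent_abs :: "'a::{finite,field} fls \<Rightarrow> real" where
  "laurent_abs \<xi> = (if \<xi> = 0 then 0 else real CARD('a) powi (- fls_subdegree \<xi>))"

definition poly_T :: "'a::{finite,field} poly \<Rightarrow> 'a fls" where
  "poly_T a = poly (map_poly fls_const a) fls_X_inv"

definition eval_X :: "'a::{finite,field} poly poly \<Rightarrow> 'a fls \<Rightarrow> 'a fls" where
  "eval_X P \<xi> = poly (map_poly poly_T P) \<xi>"

definition height :: "'a::{finite,field} poly poly \<Rightarrow> real" where
  "height P = Max ((\<lambda>i. laurent_abs (poly_T (coeff P i))) ` {..degree P})"

definition alg_series :: "'a::{finite,field} fls \<Rightarrow> bool" where
  "alg_series \<alpha> \<longleftrightarrow> (\<exists>P. P \<noteq> 0 \<and> eval_X P \<alpha> = 0)"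

text \<open>
  The minimal defining polynomial is irreducible in the ring of polynomials in \<open>X\<close> over the
  polynomial ring in \<open>T\<close>; an irreducible polynomial that has a root is not constant in \<open>X\<close>, so
  it is automatically primitive. It is determined up to a nonzero constant of the
  finite field, and this constant is fixed by requiring the leading coefficient, itself a polynomial
  in \<open>T\<close>, to be monic. Degree and height do not depend on this normalisation.
  The three notions below are meaningful only for algebraic arguments.
\<close>

definition min_def_poly :: "'a::{finite,field} fls \<Rightarrow> 'a poly poly" where
  "min_def_poly \<alpha> = (THE P. irreducible P \<and> eval_X P \<alpha> = 0 \<and> lead_coeff (lead_coeff P) = 1)"

definition alg_degree :: "'a::{finite,field} fls \<Rightarrow> nat" where
  "alg_degree \<alpha> = degree (min_def_poly \<alpha>)"

definition alg_height :: "'a::{finite,field} fls \<Rightarrow> real" where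
  "alg_height \<alpha> = height (min_def_poly \<alpha>)"

text \<open>The exponents are extended reals since the suprema may be infinite.\<close>

definition w :: "nat \<Rightarrow> 'a::{finite,field} fls \<Rightarrow> ereal" where
  "w n \<xi> = (SUP r \<in> {r :: real. infinite {P :: 'a poly poly. degree P \<le> n \<and>
       0 < laurent_abs (eval_X P \<xi>) \<and> laurent_abs (eval_X P \<xi>) < height P powr (- r)}}. ereal r)"

definition w_star :: "nat \<Rightarrow> 'a::{finite,field} fls \<Rightarrow> ereal" where
  "w_star n \<xi> = (SUP r \<in> {r :: real. infinite {\<alpha> :: 'a fls. alg_series \<alpha> \<and> alg_degree \<alpha> \<le> n \<and>
       0 < laurent_abs (\<xi> - \<alpha>) \<and> laurent_abs (\<xi> - \<alpha>) < alg_height \<alpha> powr (- r - 1)}}. ereal r)"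

text \<open>
  The library metric on \<open>'a fls\<close> is \<open>2 powr (- k)\<close> for two series whose difference has
  subdegree \<open>k\<close>, so it induces the same topology, and \<open>borel\<close> the same Borel sets, as
  \<open>laurent_abs\<close>. Over a finite field this topology is
  locally compact and second countable, so a Borel measure that is finite on compact sets is
  regular, and regularity need not be required separately.
\<close>

definition haar_measure :: "'a::{finite,field} fls measure \<Rightarrow> bool" where
  "haar_measure M \<longleftrightarrow>
     sets M = sets borel \<and>
     (\<forall>a. \<forall>A \<in> sets M. emeasure M ((\<lambda>x. a + x) ` A) = emeasure M A) \<and>
     (\<forall>K. compact K \<longrightarrow> emeasure M K < \<infinity>) \<and>
     emeasure M UNIV \<noteq> 0"

end

theory Submission
  imports Defs "Jordan_Normal_Form.Determinant" "Berlekamp_Zassenhaus.Unique_Factorization_Poly"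
begin

text \<open>
  Call \<open>\<xi>\<close> (say with \<open>|\<xi>| \<le> 1\<close>) dually approximable at \<open>(N, h)\<close> if a nonzero \<open>Q \<in> F_q[T]\<close> of degree less than \<open>N\<close> has all of
  \<open>Q\<xi>, \<dots>, Q\<xi>^n\<close> within less than \<open>q^(-h)\<close> of \<open>F_q[T]\<close>. If it is not, then by linear duality over \<open>F_q\<close> some
  \<open>P = T^h X + \<dots>\<close> of degree at most \<open>n\<close> in \<open>X\<close>, whose other coefficients (apart from the constant
  one) are smaller, satisfies \<open>|P(\<xi>)| < q^(-N)\<close>; such a \<open>P\<close> is a similarity near \<open>\<xi>\<close>, so it has a root
  within \<open>q^(-N-h)\<close> of \<open>\<xi>\<close>. Taking \<open>N\<close> close to \<open>n h\<close> gives \<open>w_n^*(\<xi>) \<ge> n\<close> as soon as this happens for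
  infinitely many \<open>h\<close>.

  If \<open>\<xi>\<close> is dually approximable at \<open>(n (k-1) g, k g)\<close> for all large \<open>g\<close>, the pigeonhole principle
  turns the \<open>Q\<close>'s into polynomials with \<open>|P(\<xi>)| < H(P)^(-n-\<eta>)\<close>, whence \<open>w_n(\<xi>) > n\<close>; this gives (i),
  as \<open>w_n^* \<le> n\<close> when \<open>w_n = n\<close>. For (ii), dual approximability means that a lattice in
  dimension \<open>n + 1\<close> depending on \<open>\<xi>\<close> has a short vector. The covolumes of its sublattices are maxima of
  absolute values of polynomials in \<open>\<xi>\<close>, and the Kleinbock--Margulis nondivergence argument, which is
  particularly simple for ultrametric balls, bounds the measure of the set of these \<open>\<xi>\<close>. The bound
  \<open>w_n^* \<le> n\<close> almost everywhere, and the passage from measures to almost all \<open>\<xi>\<close>, are Borel--Cantelli.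
\<close>

section \<open>The absolute value and its balls\<close>

text \<open>The parameters N = n (k-1) g and h = k g satisfy n h - N = n g. For fixed k this margin
  grows with g and absorbs every bounded loss: powers of |\<xi>| when |\<xi>| > 1, and the constants
  of the pigeonhole and lattice arguments. Since (N + h) / h = 1 + n (k-1) / k, the exponent n is
  recovered only afterwards, by letting k grow. The obstacle in (ii) is that infinitely many
  sublattices may become small, so a union bound over them fails. Instead, most points receive a
  chain of rational subspaces of moderate covolume that no small one can extend. Adjoining a vector
  multiplies the covolume by at most its length, so such a chain rules out short vectors; chains
  have at most n + 1 members, which bounds the depth of the induction. Covolumes are expressed
  through minors: integrality bounds these from below, and their degree in \<xi> controls where they
  are small. Exceptional sets are enclosed in open sets of explicit measure, which settles
  measurability.\<close>

lemma card_field_gt_1: "1 < real CARD('a::{finite,field})"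
proof -
  have "card {0::'a, 1} \<le> CARD('a)" by (rule card_mono) auto
  thus ?thesis by simp
qed

lemma card_field_pos [simp]: "0 < real CARD('a::{finite,field})"
  using card_field_gt_1[where 'a='a] by linarith

lemma card_powi_le_iff [simp]:
  "real CARD('a::{finite,field}) powi i \<le> real CARD('a) powi j \<longleftrightarrow> i \<le> j"
  using card_field_gt_1[where 'a='a] power_int_increasing[of i j "real CARD('a)"]
    power_int_strict_increasing[of j i "real CARD('a)"] by (cases "i \<le> j") auto

lemma card_powi_less_iff [simp]:
  "real CARD('a::{finite,field}) powi i < real CARD('a) powi j \<longleftrightarrow> i < j"
  by (simp add: not_le [symmetric])

lemma card_powi_add:
  "real CARD('a::{finite,field}) powi (i + j) = real CARD('a) powi i * real CARD('a) powi j"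
  by (simp add: power_int_add)

lemma laurent_abs_0 [simp]: "laurent_abs 0 = 0"
  by (simp add: laurent_abs_def)

lemma laurent_abs_pos_iff [simp]: "0 < laurent_abs x \<longleftrightarrow> x \<noteq> 0"
  by (simp add: laurent_abs_def)

lemma laurent_abs_nonneg [simp]: "0 \<le> laurent_abs x"
  by (simp add: laurent_abs_def)

lemma laurent_abs_eq_0_iff [simp]: "laurent_abs x = 0 \<longleftrightarrow> x = 0"
  by (simp add: laurent_abs_def)

lemma laurent_abs_1 [simp]: "laurent_abs 1 = 1"
  by (simp add: laurent_abs_def)

lemma laurent_abs_mult: "laurent_abs (x * y) = laurent_abs x * laurent_abs y"
  by (auto simp: laurent_abs_def fls_subdegree_mult card_powi_add power_int_diff power_int_minus field_simps)

lemma laurent_abs_power: "laurent_abs (x ^ n) = laurent_abs x ^ n"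
  by (induction n) (auto simp: laurent_abs_mult)

text \<open>Translates sizes into digits; the ultrametric inequality, the limits of Cauchy sequences
  and the splitting of balls are read off from this.\<close>

lemma laurent_abs_le_powi_iff:
  fixes x :: "'a::{finite,field} fls"
  shows "laurent_abs x \<le> real CARD('a) powi (- k) \<longleftrightarrow> (\<forall>i<k. fls_nth x i = 0)"
proof (cases "x = 0")
  case False
  hence "laurent_abs x \<le> real CARD('a) powi (- k) \<longleftrightarrow> k \<le> fls_subdegree x"
    by (simp add: laurent_abs_def)
  also have "\<dots> \<longleftrightarrow> (\<forall>i<k. fls_nth x i = 0)"
    using False fls_subdegree_geI[of x k] by auto
  finally show ?thesis .
qed simp

text \<open>The value group is discrete, so a strict inequality is worth a factor
  \<open>q\<close>.\<close>

lemma laurent_abs_less_powi_iff: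
  fixes x :: "'a::{finite,field} fls"
  shows "laurent_abs x < real CARD('a) powi k \<longleftrightarrow> laurent_abs x \<le> real CARD('a) powi (k - 1)"
  by (auto simp: laurent_abs_def)

lemma laurent_abs_powi_E:
  fixes x :: "'a::{finite,field} fls"
  assumes "x \<noteq> 0" obtains k where "laurent_abs x = real CARD('a) powi k"
  using assms by (auto simp: laurent_abs_def)

lemma laurent_abs_uminus [simp]: "laurent_abs (- x) = laurent_abs x"
  by (simp add: laurent_abs_def)

lemma laurent_abs_diff_commute: "laurent_abs (x - y) = laurent_abs (y - x)"
  using laurent_abs_uminus[of "x - y"] by simp

lemma laurent_abs_add_powi:
  fixes x y :: "'a::{finite,field} fls"
  assumes "laurent_abs x \<le> real CARD('a) powi k" "laurent_abs y \<le> real CARD('a) powi k"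
  shows "laurent_abs (x + y) \<le> real CARD('a) powi k"
  using assms laurent_abs_le_powi_iff[of x "- k"] laurent_abs_le_powi_iff[of y "- k"]
    laurent_abs_le_powi_iff[of "x + y" "- k"] by auto

lemma laurent_abs_add: "laurent_abs (x + y) \<le> max (laurent_abs x) (laurent_abs y)"
proof (cases "x = 0 \<and> y = 0")
  case False
  then obtain k where k: "max (laurent_abs x) (laurent_abs y) = real CARD('a) powi k"
    by (metis laurent_abs_nonneg laurent_abs_powi_E laurent_abs_0 max_def max.commute)
  show ?thesis unfolding k by (rule laurent_abs_add_powi) (simp_all flip: k)
qed auto

lemma laurent_abs_diff: "laurent_abs (x - y) \<le> max (laurent_abs x) (laurent_abs y)"
  using laurent_abs_add[of x "- y"] by simp

lemma laurent_abs_add_le: "laurent_abs x \<le> c \<Longrightarrow> laurent_abs y \<le> c \<Longrightarrow> laurent_abs (x + y) \<le> c"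
  using laurent_abs_add[of x y] by auto

lemma laurent_abs_diff_le: "laurent_abs x \<le> c \<Longrightarrow> laurent_abs y \<le> c \<Longrightarrow> laurent_abs (x - y) \<le> c"
  using laurent_abs_diff[of x y] by auto

lemma laurent_abs_add_less: "laurent_abs x < c \<Longrightarrow> laurent_abs y < c \<Longrightarrow> laurent_abs (x + y) < c"
  using laurent_abs_add[of x y] by auto

lemma laurent_abs_diff_less: "laurent_abs x < c \<Longrightarrow> laurent_abs y < c \<Longrightarrow> laurent_abs (x - y) < c"
  using laurent_abs_diff[of x y] by auto

text \<open>The bound from below comes from \<open>x = (x + y) - y\<close>, where \<open>y\<close>
  is too small to account for the size of \<open>x\<close>.\<close>

lemma laurent_abs_add_eq: "laurent_abs y < laurent_abs x \<Longrightarrow> laurent_abs (x + y) = laurent_abs x"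
  using laurent_abs_add[of x y] laurent_abs_diff[of "x + y" y] by auto

lemma laurent_abs_sum_le:
  "0 \<le> c \<Longrightarrow> (\<And>i. i \<in> I \<Longrightarrow> laurent_abs (f i) \<le> c) \<Longrightarrow> laurent_abs (sum f I) \<le> c"
  by (induction I rule: infinite_finite_induct) (auto intro: laurent_abs_add_le)

lemma laurent_abs_sum_less:
  "0 < c \<Longrightarrow> (\<And>i. i \<in> I \<Longrightarrow> laurent_abs (f i) < c) \<Longrightarrow> laurent_abs (sum f I) < c"
  by (induction I rule: infinite_finite_induct) (auto intro: laurent_abs_add_less)

lemma laurent_abs_inverse: "laurent_abs (inverse x) = inverse (laurent_abs x)"
proof (cases "x = 0")
  case False
  have "laurent_abs x * laurent_abs (inverse x) = 1"
    using False by (simp flip: laurent_abs_mult)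
  thus ?thesis using inverse_unique by force
qed simp

lemma laurent_abs_divide: "laurent_abs (x / y) = laurent_abs x / laurent_abs y"
  by (simp add: divide_inverse laurent_abs_mult laurent_abs_inverse)

section \<open>The embedding of polynomials in T\<close>

lemma poly_T_0 [simp]: "poly_T 0 = 0"
  by (simp add: poly_T_def)

lemma poly_T_1 [simp]: "poly_T 1 = 1"
  by (simp add: poly_T_def)

lemma poly_T_pCons: "poly_T (pCons c a) = fls_const c + fls_X_inv * poly_T a"
  by (cases "c = 0 \<and> a = 0") (auto simp: poly_T_def map_poly_pCons)

lemma fls_nth_poly_T: "fls_nth (poly_T a) i = (if i \<le> 0 then coeff a (nat (- i)) else 0)"
proof (induction a arbitrary: i)
  case (pCons c a)
  have "fls_nth (fls_X_inv * poly_T a) i = fls_nth (poly_T a) (i + 1)"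
    by (simp add: fls_X_inv_times_conv_shift)
  moreover have "nat (- i) = Suc (nat (- i - 1))" if "i < 0" using that by simp
  ultimately show ?case by (auto simp: poly_T_pCons pCons.IH)
qed simp

lemma poly_T_eq_iff [simp]: "poly_T a = poly_T b \<longleftrightarrow> a = b"
proof
  assume *: "poly_T a = poly_T b"
  show "a = b"
  proof (rule poly_eqI)
    fix n
    show "coeff a n = coeff b n"
      using arg_cong[OF *, of "\<lambda>x. fls_nth x (- int n)"] by (simp add: fls_nth_poly_T)
  qed
qed simp

lemma poly_T_eq_0_iff [simp]: "poly_T a = 0 \<longleftrightarrow> a = 0"
  using poly_T_eq_iff[of a 0] by simp

lemma poly_T_add: "poly_T (a + b) = poly_T a + poly_T b"
  by (rule fls_eqI) (simp add: fls_nth_poly_T)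

lemma poly_T_diff: "poly_T (a - b) = poly_T a - poly_T b"
  by (rule fls_eqI) (simp add: fls_nth_poly_T)

lemma poly_T_smult: "poly_T (smult c a) = fls_const c * poly_T a"
  by (rule fls_eqI) (simp add: fls_nth_poly_T)

lemma poly_T_mult: "poly_T (a * b) = poly_T a * poly_T b"
proof (induction a)
  case (pCons c a)
  show ?case
    by (simp add: poly_T_add poly_T_pCons pCons.IH poly_T_smult algebra_simps)
qed simp

lemma poly_T_uminus: "poly_T (- a) = - poly_T a"
  using poly_T_diff[of 0 a] by simp

lemma poly_T_sum: "poly_T (sum f I) = (\<Sum>i\<in>I. poly_T (f i))"
  by (induction I rule: infinite_finite_induct) (auto simp: poly_T_add)

lemma poly_T_power: "poly_T (a ^ n) = poly_T a ^ n"
  by (induction n) (auto simp: poly_T_mult)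

lemma laurent_abs_poly_T:
  fixes a :: "'a::{finite,field} poly"
  assumes "a \<noteq> 0" shows "laurent_abs (poly_T a) = real CARD('a) ^ degree a"
proof -
  have "fls_subdegree (poly_T a) = - int (degree a)"
    by (rule fls_subdegree_eqI) (use assms in \<open>auto simp: fls_nth_poly_T coeff_eq_0\<close>)
  thus ?thesis using assms by (simp add: laurent_abs_def)
qed

lemma laurent_abs_poly_T_ge_1: "a \<noteq> 0 \<Longrightarrow> 1 \<le> laurent_abs (poly_T a)"
  using card_field_gt_1[where 'a='a] by (simp add: laurent_abs_poly_T)

lemma laurent_abs_poly_T_le_iff:
  fixes a :: "'a::{finite,field} poly"
  assumes "0 \<le> k"
  shows "laurent_abs (poly_T a) \<le> real CARD('a) powi k \<longleftrightarrow> int (degree a) \<le> k"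
  using assms by (cases "a = 0") (auto simp: laurent_abs_poly_T simp flip: power_int_of_nat)

text \<open>The polynomial collects the digits of index at most 0, of which only finitely many are
  nonzero.\<close>

lemma integer_part_ex:
  fixes x :: "'a::{finite,field} fls"
  shows "\<exists>a. laurent_abs (x - poly_T a) < 1"
proof -
  obtain N where N: "\<forall>n>N. fls_nth x (- int n) = 0" by (rule fls_nth_vanishes_below_natE)
  define a where "a = (\<Sum>i\<le>N. monom (fls_nth x (- int i)) i)"
  have c: "coeff a j = fls_nth x (- int j)" for j
    unfolding a_def coeff_sum using N by (cases "j \<le> N") (auto simp: if_distrib cong: if_cong)
  have "laurent_abs (x - poly_T a) \<le> real CARD('a) powi (- 1)"
    unfolding laurent_abs_le_powi_iff by (auto simp: fls_nth_poly_T c)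
  also have "\<dots> < real CARD('a) powi 0" unfolding card_powi_less_iff by simp
  finally show ?thesis by auto
qed

section \<open>Ultrametric balls: completeness and compactness\<close>

lemma dist_fls_powi: "dist x y = (if x = y then 0 else 2 powi (- fls_subdegree (x - y)))"
  by (auto simp: dist_fls_def power_int_def power_one_over inverse_eq_divide)

text \<open>The library metric has base 2 and \<open>laurent_abs\<close> has base \<open>q\<close>,
  but both describe the same balls, so the library results on complete and compact sets
  apply.\<close>

lemma dist_fls_le_iff:
  fixes x :: "'a::{finite,field} fls"
  shows "dist x y \<le> 2 powi (- k) \<longleftrightarrow> laurent_abs (x - y) \<le> real CARD('a) powi (- k)"
proof (cases "x = y")
  case False
  have "2 powi i \<le> (2::real) powi j \<longleftrightarrow> i \<le> j" for i j :: int
    using power_int_increasing[of i j "2::real"] power_int_strict_increasing[of j i "2::real"]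
    by (cases "i \<le> j") auto
  thus ?thesis using False by (simp add: dist_fls_powi laurent_abs_def)
qed simp

lemma ex_two_powi_less:
  fixes e :: real assumes "0 < e" obtains k :: nat where "2 powi (- int k) < e"
proof -
  obtain k :: nat where "(1/2) ^ k < e" using real_arch_pow_inv[of e "1/2"] assms by auto
  thus ?thesis using that[of k] by (simp add: power_int_minus power_one_over field_simps)
qed

text \<open>Increasing \<open>k\<close> shrinks the ball; negative \<open>k\<close> gives the large
  balls that exhaust the field.\<close>

definition lball :: "'a::{finite,field} fls \<Rightarrow> int \<Rightarrow> 'a fls set" where
  "lball x k = {y. laurent_abs (y - x) \<le> real CARD('a) powi (- k)}"

lemma lball_conv_cball: "lball x k = cball x (2 powi (- k))"
  by (auto simp: lball_def dist_fls_le_iff[symmetric] dist_commute)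

lemma mem_lball_self [simp]: "x \<in> lball x k"
  by (simp add: lball_def)

lemma lball_eq:
  fixes x :: "'a::{finite,field} fls"
  assumes "y \<in> lball x k" shows "lball y k = lball x k"
proof -
  have "z \<in> lball x k" if "z \<in> lball y k" "y \<in> lball x k" for x y z :: "'a fls"
    using laurent_abs_add_le[of "z - y" _ "y - x"] that by (simp add: lball_def)
  moreover have "x \<in> lball y k" using assms by (simp add: lball_def laurent_abs_diff_commute)
  ultimately show ?thesis using assms by blast
qed

lemma lball_mono: "k \<le> l \<Longrightarrow> lball x l \<subseteq> lball x k"
  by (auto simp: lball_def elim!: order.trans)

lemma open_lball: "open (lball x k)"
  unfolding open_contains_cball
proof
  fix y assume "y \<in> lball x k"
  hence "cball y (2 powi (- k)) \<subseteq> lball x k" using lball_eq[of y x k] by (simp add: lball_conv_cball)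
  thus "\<exists>e>0. cball y e \<subseteq> lball x k" by (intro exI[of _ "2 powi (- k)"]) auto
qed

text \<open>Each digit of the sequence is eventually constant, and the limit is the series of these
  eventual digits.\<close>

lemma laurent_abs_Cauchy_limit:
  fixes X :: "nat \<Rightarrow> 'a::{finite,field} fls"
  assumes "\<And>k :: nat. \<exists>M. \<forall>m\<ge>M. \<forall>n\<ge>M. laurent_abs (X m - X n) \<le> real CARD('a) powi (- int k)"
  shows "\<exists>l. \<forall>k :: nat. \<exists>M. \<forall>m\<ge>M. laurent_abs (X m - l) \<le> real CARD('a) powi (- int k)"
proof -
  obtain M where M: "\<And>k m n. m \<ge> M k \<Longrightarrow> n \<ge> M k \<Longrightarrow>
      laurent_abs (X m - X n) \<le> real CARD('a) powi (- int k)"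
    using assms by metis
  have nth: "fls_nth (X m) i = fls_nth (X n) i" if "m \<ge> M k" "n \<ge> M k" "i < int k" for m n k i
    using M[OF that(1,2)] that(3) unfolding laurent_abs_le_powi_iff by simp
  define c where "c i = fls_nth (X (M (nat (i + 1)))) i" for i
  have c: "c i = fls_nth (X m) i" if "m \<ge> M k" "i < int k" for m k i
  proof -
    define m' where "m' = max m (M (nat (i + 1)))"
    have "fls_nth (X m') i = fls_nth (X m) i"
      using nth[of k m' m i] that by (simp add: m'_def)
    moreover have "fls_nth (X m') i = c i"
      unfolding c_def by (rule nth[of "nat (i + 1)"]) (auto simp: m'_def)
    ultimately show ?thesis by simp
  qed
  \<comment> \<open>Digits of negative index agree with those of \<open>X (M 0)\<close>, so only
    finitely many of them are nonzero and the candidate is a Laurent series.\<close>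
  obtain N where "\<forall>n<N. fls_nth (X (M 0)) n = 0" by (rule fls_nth_vanishes_belowE)
  hence "\<forall>n<min N 0. c n = 0" using c[of 0 "M 0"] by simp
  hence l: "fls_nth (Abs_fls c) i = c i" for i
    by (rule nth_Abs_fls_lower_bound)
  show ?thesis
  proof (intro exI allI impI)
    fix k m assume "m \<ge> M k"
    thus "laurent_abs (X m - Abs_fls c) \<le> real CARD('a) powi (- int k)"
      unfolding laurent_abs_le_powi_iff by (simp add: l c)
  qed
qed

text \<open>Serves Banach's fixed point theorem, which supplies the roots, and the compactness of
  balls.\<close>

instance fls :: ("{finite,field}") complete_space
proof
  fix X :: "nat \<Rightarrow> 'a fls" assume X: "Cauchy X"
  have "\<exists>M. \<forall>m\<ge>M. \<forall>n\<ge>M. laurent_abs (X m - X n) \<le> real CARD('a) powi (- int k)" for k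
    unfolding dist_fls_le_iff[symmetric]
    using metric_CauchyD[OF X, of "2 powi (- int k)"] by (auto intro: less_imp_le)
  from laurent_abs_Cauchy_limit[OF this] obtain l where
    l: "\<And>k :: nat. \<exists>M. \<forall>m\<ge>M. dist (X m) l \<le> 2 powi (- int k)" unfolding dist_fls_le_iff by blast
  have "X \<longlonglongrightarrow> l"
    unfolding lim_sequentially
  proof (intro allI impI)
    fix e :: real assume "0 < e"
    then obtain k :: nat where "2 powi (- int k) < e" using ex_two_powi_less by blast
    thus "\<exists>M. \<forall>m\<ge>M. dist (X m) l < e" using l[of k] by (meson order.strict_trans1)
  qed
  thus "convergent X" by (rule convergentI)
qed

text \<open>The subballs are indexed by the digit at position \<open>k\<close>. Both facts together
  give the factor \<open>q\<close> between the measures of consecutive balls.\<close>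

lemma lball_split:
  fixes x :: "'a::{finite,field} fls"
  shows "lball x k = (\<Union>c. lball (x + fls_shift (- k) (fls_const c)) (k + 1))"
    and "c \<noteq> d \<Longrightarrow> lball (x + fls_shift (- k) (fls_const c)) (k + 1) \<inter>
           lball (x + fls_shift (- k) (fls_const d)) (k + 1) = {}"
proof -
  have *: "y \<in> lball (x + fls_shift (- k) (fls_const c)) (k + 1) \<longleftrightarrow>
      y \<in> lball x k \<and> fls_nth (y - x) k = c" for y c
  proof -
    have "(\<forall>i<k + 1. fls_nth (y - (x + fls_shift (- k) (fls_const c))) i = 0) \<longleftrightarrow>
        (\<forall>i<k + 1. fls_nth (y - x) i = (if i = k then c else 0))"
      by (auto simp: algebra_simps)
    also have "\<dots> \<longleftrightarrow> (\<forall>i<k. fls_nth (y - x) i = 0) \<and> fls_nth (y - x) k = c"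
      by (auto simp: less_le)
    finally show ?thesis by (simp only: lball_def mem_Collect_eq laurent_abs_le_powi_iff)
  qed
  show "lball x k = (\<Union>c. lball (x + fls_shift (- k) (fls_const c)) (k + 1))"
    by (simp only: set_eq_iff UN_iff *) auto
  show "lball (x + fls_shift (- k) (fls_const c)) (k + 1) \<inter>
      lball (x + fls_shift (- k) (fls_const d)) (k + 1) = {}" if "c \<noteq> d"
    using that by (simp only: set_eq_iff Int_iff *) auto
qed

lemma lball_finite_cover:
  fixes x :: "'a::{finite,field} fls"
  shows "\<exists>Y. finite Y \<and> lball x k = (\<Union>y\<in>Y. lball y (k + int n))"
proof (induction n)
  case 0
  show ?case by (intro exI[of _ "{x}"]) auto
next
  case (Suc n)
  then obtain Y where Y: "finite Y" "lball x k = (\<Union>y\<in>Y. lball y (k + int n))" by blast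
  define Y' where "Y' = (\<Union>y\<in>Y. range (\<lambda>c. y + fls_shift (- (k + int n)) (fls_const c)))"
  have "lball x k = (\<Union>y\<in>Y'. lball y (k + int (Suc n)))"
    unfolding Y(2) lball_split(1)[of _ "k + int n"] Y'_def by (auto simp: algebra_simps)
  moreover have "finite Y'" using Y(1) unfolding Y'_def by auto
  ultimately show ?case by blast
qed

text \<open>This is what makes the Haar measure of a ball finite.\<close>

lemma compact_lball: "compact (lball x k)"
  unfolding compact_eq_totally_bounded
proof (intro conjI allI impI)
  have "closed (lball x k)" by (simp add: lball_conv_cball)
  thus "complete (lball x k)" by (simp add: complete_eq_closed)
next
  fix e :: real assume "0 < e"
  then obtain m :: nat where m: "2 powi (- int m) < e" using ex_two_powi_less by blast
  define n where "n = nat (int m - k)"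
  obtain Y where Y: "finite Y" "lball x k = (\<Union>y\<in>Y. lball y (k + int n))"
    using lball_finite_cover[of x k n] by (elim exE conjE)
  have *: "lball y (k + int n) \<subseteq> ball y e" for y :: "'a fls"
  proof -
    have "lball y (k + int n) \<subseteq> cball y (2 powi (- int m))"
      using lball_mono[of "int m" "k + int n" y] by (simp add: n_def lball_conv_cball)
    also have "\<dots> \<subseteq> ball y e" using m by (intro subsetI) (simp add: mem_cball mem_ball)
    finally show ?thesis .
  qed
  have "lball x k \<subseteq> (\<Union>y\<in>Y. ball y e)"
    unfolding Y(2) by (intro UN_mono order.refl *)
  thus "\<exists>Y. finite Y \<and> lball x k \<subseteq> (\<Union>y\<in>Y. ball y e)"
    using Y(1) by (intro exI[of _ Y] conjI)
qed

section \<open>Minors\<close>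

text \<open>The coordinates of the wedge product of \<open>bs\<close>. Columns are selected by an
  arbitrary list, unsorted and possibly with repetitions: expansions then need no reordering, and a
  repeated column merely yields 0.\<close>

definition minor :: "(nat \<Rightarrow> 'a::comm_ring_1) list \<Rightarrow> nat list \<Rightarrow> 'a" where
  "minor bs J = Determinant.det (Matrix.mat (length bs) (length bs) (\<lambda>(a, b). (bs ! a) (J ! b)))"

definition del :: "nat \<Rightarrow> 'a list \<Rightarrow> 'a list" where
  "del k xs = take k xs @ drop (Suc k) xs"

lemma length_del [simp]: "k < length xs \<Longrightarrow> length (del k xs) = length xs - 1"
  by (simp add: del_def)

lemma set_del_subset: "set (del k xs) \<subseteq> set xs"
  by (auto simp: del_def dest: in_set_takeD in_set_dropD)

lemma nth_del:
  "k < length xs \<Longrightarrow> i < length xs - 1 \<Longrightarrow> del k xs ! i = xs ! (if i < k then i else Suc i)"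
  by (auto simp: del_def nth_append)

lemma del_0_Cons [simp]: "del 0 (x # xs) = xs"
  by (simp add: del_def)

lemma del_Suc_Cons [simp]: "del (Suc k) (x # xs) = x # del k xs"
  by (simp add: del_def)

lemma minor_Nil [simp]: "minor [] J = 1"
  by (simp add: minor_def)

lemma minor_expand_row:
  assumes "length J = Suc (length bs)"
  shows "minor (v # bs) J = (\<Sum>k<length J. (- 1) ^ k * v (J ! k) * minor bs (del k J))"
proof -
  define n where "n = Suc (length bs)"
  define A where "A = Matrix.mat n n (\<lambda>(a, b). ((v # bs) ! a) (J ! b))"
  have A: "A \<in> carrier_mat n n" by (simp add: A_def)
  have "minor (v # bs) J = Determinant.det A" by (simp add: minor_def A_def n_def)
  also have "\<dots> = (\<Sum>j<n. A $$ (0, j) * cofactor A 0 j)"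
    by (rule laplace_expansion_row[OF A]) (simp add: n_def)
  also have "\<dots> = (\<Sum>k<length J. (- 1) ^ k * v (J ! k) * minor bs (del k J))"
  proof (rule sum.cong)
    fix j assume j: "j \<in> {..<length J}"
    have "mat_delete A 0 j =
        Matrix.mat (length bs) (length bs) (\<lambda>(a, b). (bs ! a) (del j J ! b))"
      by (rule eq_matI) (use assms j in \<open>auto simp: mat_delete_def A_def n_def nth_del\<close>)
    thus "A $$ (0, j) * cofactor A 0 j = (- 1) ^ j * v (J ! j) * minor bs (del j J)"
      using j assms by (simp add: cofactor_def minor_def A_def n_def)
  qed (use assms in \<open>simp add: n_def\<close>)
  finally show ?thesis .
qed

lemma minor_expand_col:
  assumes "length bs = Suc (length I)"
  shows "minor bs (i # I) = (\<Sum>a<length bs. (- 1) ^ a * (bs ! a) i * minor (del a bs) I)"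
proof -
  define n where "n = length bs"
  define A where "A = Matrix.mat n n (\<lambda>(a, b). (bs ! a) ((i # I) ! b))"
  have A: "A \<in> carrier_mat n n" by (simp add: A_def)
  have "minor bs (i # I) = Determinant.det A" by (simp add: minor_def A_def n_def)
  also have "\<dots> = (\<Sum>a<n. A $$ (a, 0) * cofactor A a 0)"
    by (rule laplace_expansion_column[OF A]) (simp add: n_def assms)
  also have "\<dots> = (\<Sum>a<length bs. (- 1) ^ a * (bs ! a) i * minor (del a bs) I)"
  proof (rule sum.cong)
    fix a assume a: "a \<in> {..<length bs}"
    have "mat_delete A a 0 =
        Matrix.mat (length bs - 1) (length bs - 1) (\<lambda>(a', b). (del a bs ! a') (I ! b))"
      by (rule eq_matI) (use assms a in \<open>auto simp: mat_delete_def A_def n_def nth_del\<close>)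
    thus "A $$ (a, 0) * cofactor A a 0 = (- 1) ^ a * (bs ! a) i * minor (del a bs) I"
      using a assms by (simp add: cofactor_def minor_def A_def n_def)
  qed (use assms in \<open>simp add: n_def\<close>)
  finally show ?thesis .
qed

lemma minor_row_dup: "v \<in> set bs \<Longrightarrow> minor (v # bs) J = 0"
proof -
  assume "v \<in> set bs"
  then obtain k where k: "k < length bs" "bs ! k = v" by (auto simp: in_set_conv_nth)
  let ?n = "Suc (length bs)"
  let ?A = "Matrix.mat ?n ?n (\<lambda>(a, b). ((v # bs) ! a) (J ! b))"
  have "Determinant.det ?A = 0"
    by (rule det_identical_rows[of _ ?n 0 "Suc k"]) (use k in \<open>auto intro!: eq_vecI\<close>)
  thus ?thesis by (simp add: minor_def)
qed

lemma minor_col_dup: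
  assumes "length J = length bs" "\<not> distinct J" shows "minor bs J = 0"
proof -
  obtain i j where ij: "i < length J" "j < length J" "i \<noteq> j" "J ! i = J ! j"
    using assms(2) by (auto simp: distinct_conv_nth)
  show ?thesis unfolding minor_def
    by (rule det_identical_columns[of _ "length bs" i j]) (use ij assms in \<open>auto intro!: eq_vecI\<close>)
qed

text \<open>Polarisation: expand the vanishing minor that has the row \<open>u + v\<close>
  twice.\<close>

lemma minor_swap:
  assumes "length J = Suc (Suc (length bs))"
  shows "minor (u # v # bs) J = - minor (v # u # bs) J"
proof -
  have lin: "minor ((\<lambda>i. f i + g i) # cs) J = minor (f # cs) J + minor (g # cs) J"
    if "length J = Suc (length cs)" for f g :: "nat \<Rightarrow> 'a" and cs
    using that by (simp add: minor_expand_row algebra_simps sum.distrib)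
  have lin2: "minor (w # (\<lambda>i. f i + g i) # bs) J = minor (w # f # bs) J + minor (w # g # bs) J"
    for w f g :: "nat \<Rightarrow> 'a"
  proof -
    have "minor ((\<lambda>i. f i + g i) # bs) (del k J) = minor (f # bs) (del k J) + minor (g # bs) (del k J)"
      if "k < length J" for k
      using that assms by (simp add: minor_expand_row algebra_simps sum.distrib)
    thus ?thesis using assms by (simp add: minor_expand_row[of J "_ # bs"] algebra_simps sum.distrib)
  qed
  let ?s = "\<lambda>i. u i + v i"
  have "0 = minor (?s # ?s # bs) J" by (rule minor_row_dup[symmetric]) simp
  also have "\<dots> = minor (u # u # bs) J + minor (u # v # bs) J + (minor (v # u # bs) J + minor (v # v # bs) J)"
    using assms by (simp add: lin lin2)
  also have "\<dots> = minor (u # v # bs) J + minor (v # u # bs) J"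
    by (simp add: minor_row_dup)
  finally show ?thesis by (simp add: eq_neg_iff_add_eq_0)
qed

lemma minor_lin_row:
  assumes "length J = Suc (length bs)"
  shows "minor ((\<lambda>i. c * f i + g i) # bs) J = c * minor (f # bs) J + minor (g # bs) J"
  using assms by (simp add: minor_expand_row algebra_simps sum.distrib sum_distrib_left)

lemma minor_lin_row_sum:
  assumes "length J = Suc (length bs)"
  shows "minor ((\<lambda>i. \<Sum>a\<in>S. c a * f a i) # bs) J = (\<Sum>a\<in>S. c a * minor (f a # bs) J)"
  using assms by (induction S rule: infinite_finite_induct)
    (auto simp: minor_lin_row, simp_all add: minor_expand_row)

text \<open>Padding with zeros makes both factors square matrices. For shorter \<open>bs\<close> the
  second factor has a zero row, so the minor vanishes.\<close>

lemma minor_product: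
  assumes len: "length bs \<le> length cs" and J: "length J = length cs"
    and cs: "\<And>a i. a < length cs \<Longrightarrow> i \<in> set J \<Longrightarrow> (cs ! a) i = (\<Sum>b<length bs. C a b * (bs ! b) i)"
  shows "minor cs J = (if length bs = length cs
    then Determinant.det (Matrix.mat (length cs) (length cs) (\<lambda>(a, b). C a b)) * minor bs J else 0)"
proof -
  let ?n = "length cs"
  let ?C = "Matrix.mat ?n ?n (\<lambda>(a, b). if b < length bs then C a b else 0)"
  let ?B = "Matrix.mat ?n ?n (\<lambda>(a, b). if a < length bs then (bs ! a) (J ! b) else 0)"
  have *: "Matrix.mat ?n ?n (\<lambda>(a, b). (cs ! a) (J ! b)) = ?C * ?B"
  proof (rule eq_matI)
    fix i j assume "i < dim_row (?C * ?B)" "j < dim_col (?C * ?B)"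
    hence ij: "i < ?n" "j < ?n" by auto
    have "(?C * ?B) $$ (i, j) = (\<Sum>b<?n. (if b < length bs then C i b * (bs ! b) (J ! j) else 0))"
      using ij by (auto simp: scalar_prod_def lessThan_atLeast0 intro!: sum.cong)
    also have "\<dots> = (\<Sum>b<length bs. C i b * (bs ! b) (J ! j))"
      using len by (intro sum.mono_neutral_cong_right) auto
    finally show "Matrix.mat ?n ?n (\<lambda>(a, b). (cs ! a) (J ! b)) $$ (i, j) = (?C * ?B) $$ (i, j)"
      using ij cs[of i "J ! j"] J by simp
  qed auto
  have det: "minor cs J = Determinant.det ?C * Determinant.det ?B"
    unfolding minor_def * by (rule det_mult) auto
  show ?thesis
  proof (cases "length bs = length cs")
    case True
    have "?B = Matrix.mat ?n ?n (\<lambda>(a, b). (bs ! a) (J ! b))"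
      "?C = Matrix.mat ?n ?n (\<lambda>(a, b). C a b)"
      using True by (auto intro!: eq_matI)
    thus ?thesis using det True by (simp add: minor_def)
  next
    case False
    hence less: "length bs < ?n" using len by simp
    have "Determinant.det ?B = (\<Sum>j<?n. ?B $$ (length bs, j) * cofactor ?B (length bs) j)"
      by (rule laplace_expansion_row) (use less in auto)
    also have "\<dots> = 0" by (rule sum.neutral) (use less in auto)
    finally show ?thesis using det False by simp
  qed
qed

section \<open>Linear independence and spans through minors\<close>

definition idx :: "nat \<Rightarrow> nat \<Rightarrow> nat list set" where
  "idx m j = {J. set J \<subseteq> {..<m} \<and> length J = j}"

lemma finite_idx [simp]: "finite (idx m j)"
  unfolding idx_def by (rule finite_lists_length_eq) simp

lemma idx_nonempty [simp]: "0 < m \<Longrightarrow> idx m j \<noteq> {}"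
  unfolding idx_def by (auto intro!: exI[of _ "replicate j 0"])

lemma del_in_idx: "J \<in> idx m (Suc j) \<Longrightarrow> k < Suc j \<Longrightarrow> del k J \<in> idx m j"
  using set_del_subset[of k J] by (auto simp: idx_def)

lemma Cons_in_idx: "i < m \<Longrightarrow> J \<in> idx m j \<Longrightarrow> i # J \<in> idx m (Suc j)"
  by (auto simp: idx_def)

definition indep :: "nat \<Rightarrow> (nat \<Rightarrow> 'a::field) list \<Rightarrow> bool" where
  "indep m bs \<longleftrightarrow> (\<exists>J\<in>idx m (length bs). minor bs J \<noteq> 0)"

text \<open>For independent \<open>bs\<close> this is the linear span, with coordinates from
  \<open>m\<close> on unrestricted; for dependent \<open>bs\<close> all these minors vanish and it
  is everything. In this form a vector enlarges an independent list exactly when it leaves the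
  span.\<close>

definition spn :: "nat \<Rightarrow> (nat \<Rightarrow> 'a::field) list \<Rightarrow> (nat \<Rightarrow> 'a) set" where
  "spn m bs = {v. \<forall>J\<in>idx m (Suc (length bs)). minor (v # bs) J = 0}"

lemma indep_Nil [simp]: "0 < m \<Longrightarrow> indep m []"
  by (auto simp: indep_def idx_def)

lemma indep_length_le: "indep m bs \<Longrightarrow> length bs \<le> m"
proof -
  assume "indep m bs"
  then obtain J where J: "set J \<subseteq> {..<m}" "length J = length bs" "minor bs J \<noteq> 0"
    by (auto simp: indep_def idx_def)
  hence "distinct J" using minor_col_dup by blast
  hence "length J = card (set J)" by (simp add: distinct_card)
  also have "\<dots> \<le> m" using card_mono[OF _ J(1)] by simp
  finally show ?thesis using J by simp
qed

lemma indep_Cons_iff: "indep m (v # bs) \<longleftrightarrow> v \<notin> spn m bs"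
  by (auto simp: indep_def spn_def)

lemma set_subset_spn: "set bs \<subseteq> spn m bs"
  by (auto simp: spn_def minor_row_dup)

lemma spn_cong:
  fixes v w :: "nat \<Rightarrow> 'a::field"
  assumes *: "\<And>i. i < m \<Longrightarrow> v i = w i"
  shows "v \<in> spn m bs \<longleftrightarrow> w \<in> spn m bs"
proof -
  have "minor (v # bs) J = minor (w # bs) J" if "J \<in> idx m (Suc (length bs))" for J
  proof -
    have "J ! k < m" if "k < length J" for k
      using \<open>J \<in> _\<close> nth_mem[OF that] by (auto simp: idx_def subset_iff)
    thus ?thesis using that * by (simp add: idx_def minor_expand_row)
  qed
  thus ?thesis by (simp add: spn_def)
qed

lemma sum_in_spn:
  fixes f :: "'b \<Rightarrow> nat \<Rightarrow> 'a::field"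
  assumes "\<And>a. a \<in> S \<Longrightarrow> f a \<in> spn m bs"
  shows "(\<lambda>i. \<Sum>a\<in>S. c a * f a i) \<in> spn m bs"
  using assms by (auto simp: spn_def minor_lin_row_sum idx_def)

text \<open>Cramer's rule: expand the vanishing minor with columns \<open>i # I\<close> along column
  \<open>i\<close>. The coefficients are quotients by \<open>minor bs I\<close> and do not depend on
  \<open>i\<close>.\<close>

lemma spn_expand:
  fixes v :: "nat \<Rightarrow> 'a::field"
  assumes "indep m bs" "v \<in> spn m bs"
  obtains c where "\<And>i. i < m \<Longrightarrow> v i = (\<Sum>a<length bs. c a * (bs ! a) i)"
proof -
  obtain I where I: "I \<in> idx m (length bs)" "minor bs I \<noteq> 0" using assms(1) by (auto simp: indep_def)
  let ?c = "\<lambda>a. (- 1) ^ a * minor (v # del a bs) I / minor bs I"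
  have "v i = (\<Sum>a<length bs. ?c a * (bs ! a) i)" if "i < m" for i
  proof -
    have "0 = minor (v # bs) (i # I)"
      using assms(2) I that by (simp add: spn_def Cons_in_idx)
    also have "\<dots> = v i * minor bs I +
        (\<Sum>a<length bs. (- 1) ^ Suc a * (bs ! a) i * minor (v # del a bs) I)"
      using I by (subst minor_expand_col) (simp_all add: idx_def sum.lessThan_Suc_shift del: sum.lessThan_Suc)
    finally have "v i * minor bs I = (\<Sum>a<length bs. (- 1) ^ a * (bs ! a) i * minor (v # del a bs) I)"
      by (simp add: sum_negf add_eq_0_iff2)
    hence "v i = (\<Sum>a<length bs. (- 1) ^ a * (bs ! a) i * minor (v # del a bs) I) / minor bs I"
      using I(2) by (simp add: field_simps)
    thus ?thesis by (simp add: sum_divide_distrib mult_ac)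
  qed
  thus thesis by (rule that)
qed

lemma spn_trans:
  assumes "indep m cs" "set cs \<subseteq> spn m bs" shows "spn m cs \<subseteq> spn m bs"
proof
  fix v assume "v \<in> spn m cs"
  then obtain c where c: "\<And>i. i < m \<Longrightarrow> v i = (\<Sum>a<length cs. c a * (cs ! a) i)"
    using spn_expand[OF assms(1)] by blast
  have "(\<lambda>i. \<Sum>a<length cs. c a * (cs ! a) i) \<in> spn m bs"
    by (rule sum_in_spn) (use assms(2) in auto)
  moreover have "v \<in> spn m bs \<longleftrightarrow> (\<lambda>i. \<Sum>a<length cs. c a * (cs ! a) i) \<in> spn m bs"
    by (rule spn_cong) (rule c)
  ultimately show "v \<in> spn m bs" by simp
qed

text \<open>The factor \<open>l\<close> is the determinant of the change of basis, hence common to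
  all column lists. For longer \<open>cs\<close> this yields the dimension bound, for equal length
  the comparison of covolumes.\<close>

lemma minor_spn_list:
  fixes bs cs :: "(nat \<Rightarrow> 'a::field) list"
  assumes "indep m bs" "set cs \<subseteq> spn m bs" "length bs \<le> length cs"
  shows "\<exists>l. \<forall>J\<in>idx m (length cs). minor cs J = (if length bs = length cs then l * minor bs J else 0)"
proof -
  have "\<exists>c. \<forall>i<m. (cs ! a) i = (\<Sum>b<length bs. c b * (bs ! b) i)" if a: "a < length cs" for a
  proof -
    have "cs ! a \<in> spn m bs" using a assms(2) by auto
    from spn_expand[OF assms(1) this] obtain c where
      "\<And>i. i < m \<Longrightarrow> (cs ! a) i = (\<Sum>b<length bs. c b * (bs ! b) i)" by blast
    thus ?thesis by blast
  qed
  hence "\<forall>a. \<exists>c. a < length cs \<longrightarrow> (\<forall>i<m. (cs ! a) i = (\<Sum>b<length bs. c b * (bs ! b) i))" by blast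
  from choice[OF this] obtain C where C: "\<And>a i. a < length cs \<Longrightarrow> i < m \<Longrightarrow>
      (cs ! a) i = (\<Sum>b<length bs. C a b * (bs ! b) i)" by blast
  show ?thesis
  proof (intro exI ballI)
    fix J assume "J \<in> idx m (length cs)"
    thus "minor cs J = (if length bs = length cs
        then Determinant.det (Matrix.mat (length cs) (length cs) (\<lambda>(a, b). C a b)) * minor bs J else 0)"
      by (intro minor_product) (use assms(3) C in \<open>auto simp: idx_def\<close>)
  qed
qed

lemma length_le_of_subset_spn:
  assumes "indep m bs" "indep m cs" "set cs \<subseteq> spn m bs"
  shows "length cs \<le> length bs"
proof (rule ccontr)
  assume "\<not> length cs \<le> length bs"
  hence "\<forall>J\<in>idx m (length cs). minor cs J = 0"
    using minor_spn_list[OF assms(1,3)] by auto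
  thus False using assms(2) by (auto simp: indep_def)
qed

lemma spn_eq_of_length_eq:
  assumes "indep m bs" "indep m cs" "set cs \<subseteq> spn m bs" "length cs = length bs"
  shows "spn m cs = spn m bs"
proof (intro equalityI spn_trans assms subsetI)
  fix b assume b: "b \<in> set bs"
  show "b \<in> spn m cs"
  proof (rule ccontr)
    assume "b \<notin> spn m cs"
    hence "length (b # cs) \<le> length bs"
      by (intro length_le_of_subset_spn[OF assms(1)])
        (use assms(3) b set_subset_spn[of bs m] in \<open>auto simp: indep_Cons_iff\<close>)
    thus False using assms(4) by simp
  qed
qed

section \<open>Heights and minimal polynomials\<close>

lemma eval_X_sum_le:
  assumes "degree P \<le> n"
  shows "eval_X P x = (\<Sum>i\<le>n. poly_T (coeff P i) * x ^ i)"
proof -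
  have "degree (map_poly poly_T P) \<le> n" using assms degree_map_poly_le order_trans by blast
  hence "eval_X P x = (\<Sum>i\<le>n. coeff (map_poly poly_T P) i * x ^ i)"
    unfolding eval_X_def poly_altdef
    by (intro sum.mono_neutral_left) (auto simp: coeff_eq_0)
  thus ?thesis by (simp add: coeff_map_poly)
qed

lemma eval_X_0 [simp]: "eval_X 0 x = 0"
  by (simp add: eval_X_def)

lemma eval_X_add: "eval_X (P + Q) x = eval_X P x + eval_X Q x"
proof -
  let ?n = "max (degree P) (degree Q)"
  have "degree (P + Q) \<le> ?n" by (rule degree_add_le_max)
  thus ?thesis
    by (subst (1 2 3) eval_X_sum_le[where n = ?n]) (auto simp: poly_T_add algebra_simps sum.distrib)
qed

lemma eval_X_pCons: "eval_X (pCons c P) x = poly_T c + x * eval_X P x"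
  by (cases "c = 0 \<and> P = 0") (auto simp: eval_X_def map_poly_pCons)

lemma eval_X_smult: "eval_X (smult c P) x = poly_T c * eval_X P x"
  by (subst (1 2) eval_X_sum_le[where n = "degree P"])
    (auto simp: poly_T_mult sum_distrib_left mult_ac degree_smult_le)

lemma eval_X_mult: "eval_X (P * Q) x = eval_X P x * eval_X Q x"
  by (induction P) (auto simp: eval_X_pCons eval_X_add eval_X_smult algebra_simps)

lemma eval_X_1 [simp]: "eval_X 1 x = 1"
  using eval_X_pCons[of 1 0 x] by simp

lemma eval_X_const [simp]: "eval_X [:c:] x = poly_T c"
  by (simp add: eval_X_pCons)

lemma map_poly_T_eq_0_iff [simp]: "map_poly poly_T P = 0 \<longleftrightarrow> P = 0"
  by (metis coeff_map_poly map_poly_0 poly_T_0 poly_T_eq_0_iff poly_eqI coeff_0)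

lemma finite_roots_eval_X:
  assumes "P \<noteq> 0" shows "finite {x. eval_X P x = 0}" "card {x. eval_X P x = 0} \<le> degree P"
proof -
  show "finite {x. eval_X P x = 0}"
    unfolding eval_X_def by (rule poly_roots_finite) (use assms in simp)
  have "card {x. eval_X P x = 0} \<le> degree (map_poly poly_T P)"
    unfolding eval_X_def by (rule card_poly_roots_bound) (use assms in simp)
  also have "\<dots> \<le> degree P" by (rule degree_map_poly_le)
  finally show "card {x. eval_X P x = 0} \<le> degree P" .
qed

lemma height_le_iff:
  assumes "0 \<le> c"
  shows "height P \<le> c \<longleftrightarrow> (\<forall>i. laurent_abs (poly_T (coeff P i)) \<le> c)"
proof -
  have "height P \<le> c \<longleftrightarrow> (\<forall>i\<le>degree P. laurent_abs (poly_T (coeff P i)) \<le> c)"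
    unfolding height_def by (subst Max_le_iff) auto
  also have "\<dots> \<longleftrightarrow> (\<forall>i. laurent_abs (poly_T (coeff P i)) \<le> c)"
    using assms by (metis coeff_eq_0 laurent_abs_0 not_le poly_T_0)
  finally show ?thesis .
qed

lemma laurent_abs_coeff_le_height: "laurent_abs (poly_T (coeff P i)) \<le> height P"
proof -
  have "0 \<le> laurent_abs (poly_T (coeff P 0))" by simp
  also have "\<dots> \<le> height P" unfolding height_def by (rule Max_ge) auto
  finally show ?thesis using height_le_iff[of "height P" P] by simp
qed

definition degree_T :: "'a::zero poly poly \<Rightarrow> nat" where
  "degree_T P = Max ((\<lambda>i. degree (coeff P i)) ` {..degree P})"

lemma degree_T_le_iff: "degree_T P \<le> k \<longleftrightarrow> (\<forall>i. degree (coeff P i) \<le> k)"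
proof -
  have "degree_T P \<le> k \<longleftrightarrow> (\<forall>i\<le>degree P. degree (coeff P i) \<le> k)"
    unfolding degree_T_def by (subst Max_le_iff) auto
  also have "\<dots> \<longleftrightarrow> (\<forall>i. degree (coeff P i) \<le> k)"
    by (metis coeff_eq_0 degree_0 le0 not_le)
  finally show ?thesis .
qed

lemma degree_coeff_le_degree_T: "degree (coeff P i) \<le> degree_T P"
  using degree_T_le_iff[of P "degree_T P"] by simp

lemma degree_T_attained:
  fixes P :: "'a::zero poly poly"
  assumes "P \<noteq> 0" obtains i where "coeff P i \<noteq> 0" "degree (coeff P i) = degree_T P"
proof -
  have "degree_T P \<in> (\<lambda>i. degree (coeff P i)) ` {..degree P}"
    unfolding degree_T_def by (rule Max_in) auto
  then obtain i where i: "degree (coeff P i) = degree_T P" by auto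
  show thesis
  proof (cases "coeff P i = 0")
    case True
    \<comment> \<open>A zero coefficient attains the maximum only if the maximum is 0; then the
      leading coefficient attains it too.\<close>
    hence "degree (lead_coeff P) = degree_T P"
      using i degree_coeff_le_degree_T[of P "degree P"] by simp
    thus ?thesis using that assms leading_coeff_0_iff by blast
  qed (use i that in blast)
qed

lemma height_eq_degree_T:
  fixes P :: "'a::{finite,field} poly poly"
  assumes "P \<noteq> 0" shows "height P = real CARD('a) ^ degree_T P"
proof (rule antisym)
  have "laurent_abs (poly_T (coeff P i)) \<le> real CARD('a) powi int (degree_T P)" for i
    by (subst laurent_abs_poly_T_le_iff) (auto simp: degree_coeff_le_degree_T)
  thus "height P \<le> real CARD('a) ^ degree_T P" by (subst height_le_iff) auto
next
  obtain i where i: "coeff P i \<noteq> 0" "degree (coeff P i) = degree_T P"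
    using degree_T_attained[OF assms] .
  thus "real CARD('a) ^ degree_T P \<le> height P"
    using laurent_abs_coeff_le_height[of P i] by (simp add: laurent_abs_poly_T)
qed

text \<open>Gauss's lemma for the degree in \<open>T\<close>: the coefficients of the highest power
  of \<open>T\<close> in \<open>P\<close> and in \<open>Q\<close> form nonzero polynomials over a
  field, and so their product is nonzero.\<close>

lemma degree_T_mult:
  fixes P Q :: "'a::field poly poly"
  assumes "P \<noteq> 0" "Q \<noteq> 0" shows "degree_T P + degree_T Q \<le> degree_T (P * Q)"
proof -
  define top :: "nat \<Rightarrow> 'a poly poly \<Rightarrow> 'a poly" where "top k = map_poly (\<lambda>c. coeff c k)" for k
  have coeff_top: "coeff (top k R) i = coeff (coeff R i) k" for k R i
    by (simp add: top_def coeff_map_poly)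
  have nz: "top (degree_T R) R \<noteq> 0" if R: "R \<noteq> 0" for R
  proof -
    obtain i where i: "coeff R i \<noteq> 0" "degree (coeff R i) = degree_T R"
      using degree_T_attained[OF R] .
    hence "coeff (top (degree_T R) R) i \<noteq> 0" by (metis coeff_top leading_coeff_0_iff)
    thus ?thesis by auto
  qed
  have cm: "coeff (a * b) (k + l) = coeff a k * coeff b l" if "degree a \<le> k" "degree b \<le> l"
    for a b :: "'a poly" and k l
  proof (cases "degree a = k \<and> degree b = l")
    case False
    hence "degree (a * b) < k + l" using that degree_mult_le[of a b] by linarith
    moreover have "coeff a k = 0 \<or> coeff b l = 0" using False that by (auto simp: coeff_eq_0)
    ultimately show ?thesis by (auto simp: coeff_eq_0)
  qed (auto simp: coeff_mult_degree_sum)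
  have "top (degree_T P + degree_T Q) (P * Q) = top (degree_T P) P * top (degree_T Q) Q"
  proof (rule poly_eqI)
    fix i
    have "coeff (coeff (P * Q) i) (degree_T P + degree_T Q) =
        (\<Sum>j\<le>i. coeff (coeff P j * coeff Q (i - j)) (degree_T P + degree_T Q))"
      by (simp only: coeff_mult[of P Q i] coeff_sum)
    also have "\<dots> = (\<Sum>j\<le>i. coeff (coeff P j) (degree_T P) * coeff (coeff Q (i - j)) (degree_T Q))"
      by (intro sum.cong refl cm degree_coeff_le_degree_T)
    finally show "coeff (top (degree_T P + degree_T Q) (P * Q)) i =
        coeff (top (degree_T P) P * top (degree_T Q) Q) i"
      by (simp only: coeff_top coeff_mult[of "top (degree_T P) P"])
  qed
  hence "top (degree_T P + degree_T Q) (P * Q) \<noteq> 0" using nz assms by simp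
  then obtain i where "coeff (coeff (P * Q) i) (degree_T P + degree_T Q) \<noteq> 0"
    by (metis coeff_top coeff_0 poly_eqI)
  hence "degree_T P + degree_T Q \<le> degree (coeff (P * Q) i)" by (rule le_degree)
  thus ?thesis using degree_coeff_le_degree_T order_trans by blast
qed

text \<open>Lets the height of any annihilating polynomial bound that of the algebraic
  series.\<close>

lemma height_dvd_le:
  fixes P Q :: "'a::{finite,field} poly poly"
  assumes "P dvd Q" "Q \<noteq> 0" shows "height P \<le> height Q"
proof -
  obtain R where R: "Q = P * R" using assms(1) by (elim dvdE)
  hence "P \<noteq> 0" "R \<noteq> 0" using assms(2) by auto
  hence "degree_T P \<le> degree_T Q" using degree_T_mult[of P R] R by simp
  thus ?thesis
    using \<open>P \<noteq> 0\<close> assms(2) card_field_gt_1[where 'a='a] by (simp add: height_eq_degree_T)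
qed

section \<open>Existence and uniqueness of the minimal defining polynomial\<close>

lemma alg_series_irreducible_factor:
  fixes P :: "'a::{finite,field} poly poly"
  assumes "P \<noteq> 0" "eval_X P \<alpha> = 0"
  obtains R where "irreducible R" "R dvd P" "eval_X R \<alpha> = 0" "lead_coeff (lead_coeff R) = 1"
proof -
  have "\<not> P dvd 1"
  proof
    assume "P dvd 1"
    then obtain Q where "1 = P * Q" by (elim dvdE)
    thus False using assms(2) eval_X_mult[of P Q \<alpha>] eval_X_1[of \<alpha>] by (metis mult_zero_left zero_neq_one)
  qed
  then obtain F where F: "\<And>f. f \<in># F \<Longrightarrow> irreducible f" "prod_mset F = P"
    using mset_factors_exist[OF assms(1)] by (metis mset_factorsE)
  have "eval_X (prod_mset F) \<alpha> = 0 \<Longrightarrow> \<exists>f. f \<in># F \<and> eval_X f \<alpha> = 0" for F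
    by (induction F) (auto simp: eval_X_mult)
  then obtain f where f: "f \<in># F" "eval_X f \<alpha> = 0" using F(2) assms(2) by blast
  define c where "c = lead_coeff (lead_coeff f)"
  have irr: "irreducible f" using F(1) f(1) by blast
  hence c: "c \<noteq> 0" unfolding c_def by (metis irreducible_def leading_coeff_0_iff)
  define R where "R = smult [:inverse c:] f"
  have fR: "f = smult [:c:] R" using c by (simp add: R_def)
  have u: "is_unit [:[:inverse c:]:]"
    by (rule dvdI[of _ _ "[:[:c:]:]"]) (use c in \<open>simp\<close>)
  show thesis
  proof (rule that[of R])
    have "R = [:[:inverse c:]:] * f" by (simp add: R_def)
    thus "irreducible R" by (simp only: irreducible_mult_unit_left[OF u] irr)
    have "R dvd f" unfolding fR by (rule dvd_smult) simp
    moreover have "f dvd P" using f(1) F(2) dvd_prod_mset by blast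
    ultimately show "R dvd P" by (rule dvd_trans)
    show "eval_X R \<alpha> = 0" by (simp add: R_def eval_X_smult f)
    have "lead_coeff R = smult (inverse c) (lead_coeff f)" by (simp add: R_def)
    thus "lead_coeff (lead_coeff R) = 1" using c by (simp add: c_def)
  qed
qed

text \<open>Compare with an annihilator \<open>R0\<close> of least degree in \<open>X\<close>. By
  pseudo-division \<open>R0\<close> divides a multiple of an irreducible annihilator
  \<open>R\<close> by an element of F_q[T]; as \<open>R\<close> is prime, \<open>R0\<close> is
  itself such a multiple of \<open>R\<close>.\<close>

lemma irreducible_annihilator_unique:
  fixes P Q :: "'a::{finite,field} poly poly"
  assumes P: "irreducible P" "eval_X P \<alpha> = 0" "lead_coeff (lead_coeff P) = 1"
    and Q: "irreducible Q" "eval_X Q \<alpha> = 0" "lead_coeff (lead_coeff Q) = 1"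
  shows "P = Q"
proof -
  let ?ann = "\<lambda>R. R \<noteq> 0 \<and> eval_X R \<alpha> = 0"
  have nzP: "P \<noteq> 0" "Q \<noteq> 0" using P(1) Q(1) by auto
  obtain R0 where R0: "?ann R0" "\<And>R. ?ann R \<Longrightarrow> degree R0 \<le> degree R"
    using ex_has_least_nat[of ?ann P degree] P nzP by auto
  have deg_pos: "degree R \<noteq> 0" if "?ann R" for R
  proof
    assume "degree R = 0"
    then obtain c where "R = [:c:]" by (elim degree_eq_zeroE)
    thus False using that by simp
  qed
  have main: "\<exists>u. u \<noteq> 0 \<and> R0 = smult u R" if R: "irreducible R" "?ann R" for R
  proof -
    obtain a q where aq: "a \<noteq> 0" "smult a R = R0 * q + pseudo_mod R R0"
      and lt: "pseudo_mod R R0 = 0 \<or> degree (pseudo_mod R R0) < degree R0"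
      using pseudo_mod[of R0 R] R0(1) by blast
    have "eval_X (smult a R) \<alpha> = eval_X (R0 * q + pseudo_mod R R0) \<alpha>" by (simp only: aq(2))
    hence "eval_X (pseudo_mod R R0) \<alpha> = 0"
      using R R0(1) by (simp add: eval_X_smult eval_X_add eval_X_mult)
    hence "pseudo_mod R R0 = 0" using R0(2)[of "pseudo_mod R R0"] lt by fastforce
    hence eq: "smult a R = R0 * q" using aq(2) by simp
    have "prime_elem R" using R by auto
    moreover have "R dvd R0 * q" unfolding eq[symmetric] by (rule dvd_smult) simp
    ultimately have "R dvd R0 \<or> R dvd q" by (simp add: prime_elem_dvd_mult_iff)
    thus ?thesis
    proof
      assume "R dvd R0"
      then obtain u where u: "R0 = R * u" by (elim dvdE)
      hence "u \<noteq> 0" using R0(1) by auto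
      hence "degree R0 = degree R + degree u" using u R by (simp add: degree_mult_eq)
      hence "degree u = 0" using R0(2)[of R] R by simp
      then obtain u' where "u = [:u':]" by (elim degree_eq_zeroE)
      thus ?thesis using u \<open>u \<noteq> 0\<close> by (intro exI[of _ u']) auto
    next
      assume "R dvd q"
      then obtain s where "q = R * s" by (elim dvdE)
      hence "R * [:a:] = R * (R0 * s)" using eq by (simp add: mult_ac)
      hence "[:a:] = R0 * s" using R(2) mult_left_cancel[of R "[:a:]" "R0 * s"] by blast
      moreover from this have "s \<noteq> 0" using aq(1) by auto
      ultimately have "degree R0 + degree s = degree [:a:]"
        using R0(1) degree_mult_eq[of R0 s] by simp
      hence "degree R0 = 0" by simp
      thus ?thesis using deg_pos R0(1) by blast
    qed
  qed
  have dvd: "A dvd B" if A: "irreducible A" "eval_X A \<alpha> = 0" and B: "irreducible B" "eval_X B \<alpha> = 0" for A B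
  proof -
    have nz: "A \<noteq> 0" "B \<noteq> 0" using A B by auto
    obtain u v where uv: "u \<noteq> 0" "R0 = smult u A" "v \<noteq> 0" "R0 = smult v B"
      using main[OF A(1)] main[OF B(1)] A B nz by blast
    have "B * [:v:] = R0" "A * [:u:] = R0" using uv(2,4) by simp_all
    hence "A dvd B * [:v:]" by (metis dvd_triv_left)
    moreover have "prime_elem A" using A by auto
    ultimately have "A dvd B \<or> A dvd [:v:]" by (simp only: prime_elem_dvd_mult_iff)
    moreover have "\<not> A dvd [:v:]" using dvd_const[of A "[:v:]"] uv(3) deg_pos[of A] A nz by auto
    ultimately show ?thesis by blast
  qed
  obtain k where k: "Q = P * k" using dvd[OF P(1,2) Q(1,2)] by (elim dvdE)
  obtain l where l: "P = Q * l" using dvd[OF Q(1,2) P(1,2)] by (elim dvdE)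
  have "P = P * (k * l)" by (metis k l mult.assoc)
  hence "k * l = 1" using nzP(1) by (metis mult_cancel_left1)
  \<comment> \<open>Units of the two-level polynomial ring are constants of the field, and the monic
    normalisation leaves only 1.\<close>
  hence "is_unit k" by (metis dvd_triv_left)
  then obtain c where c: "k = [:c:]" "is_unit c" unfolding is_unit_poly_iff by blast
  from c(2) obtain d where d: "c = [:d:]" unfolding is_unit_poly_iff by blast
  have "lead_coeff (lead_coeff Q) = d" unfolding k c(1) d using P(3) by (simp add: lead_coeff_mult)
  hence "k = 1" using Q(3) by (simp add: c(1) d)
  thus ?thesis using k by simp
qed

text \<open>Justifies the definite description: existence comes from the irreducible factor,
  uniqueness from the preceding lemma.\<close>

lemma min_def_poly:
  fixes \<alpha> :: "'a::{finite,field} fls"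
  assumes "alg_series \<alpha>"
  shows "irreducible (min_def_poly \<alpha>)" "eval_X (min_def_poly \<alpha>) \<alpha> = 0"
    "lead_coeff (lead_coeff (min_def_poly \<alpha>)) = 1"
proof -
  let ?Q = "\<lambda>P. irreducible P \<and> eval_X P \<alpha> = 0 \<and> lead_coeff (lead_coeff P) = 1"
  obtain P where P: "P \<noteq> 0" "eval_X P \<alpha> = 0" using assms by (auto simp: alg_series_def)
  obtain R where "irreducible R" "R dvd P" "eval_X R \<alpha> = 0" "lead_coeff (lead_coeff R) = 1"
    using alg_series_irreducible_factor[OF P] .
  hence "?Q R" by simp
  hence "?Q (min_def_poly \<alpha>)" unfolding min_def_poly_def
    using irreducible_annihilator_unique by (intro theI[of ?Q R]) blast+
  thus "irreducible (min_def_poly \<alpha>)" "eval_X (min_def_poly \<alpha>) \<alpha> = 0"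
    "lead_coeff (lead_coeff (min_def_poly \<alpha>)) = 1" by auto
qed

lemma min_def_poly_dvd:
  assumes "P \<noteq> 0" "eval_X P \<alpha> = 0" shows "min_def_poly \<alpha> dvd P"
proof -
  have "alg_series \<alpha>" using assms by (auto simp: alg_series_def)
  obtain R where R: "irreducible R" "R dvd P" "eval_X R \<alpha> = 0" "lead_coeff (lead_coeff R) = 1"
    using alg_series_irreducible_factor[OF assms] .
  have "R = min_def_poly \<alpha>"
    using irreducible_annihilator_unique[OF R(1,3,4)] min_def_poly[OF \<open>alg_series \<alpha>\<close>] by blast
  thus ?thesis using R(2) by simp
qed

lemma alg_degree_le:
  assumes "P \<noteq> 0" "eval_X P \<alpha> = 0" shows "alg_degree \<alpha> \<le> degree P"
  unfolding alg_degree_def using dvd_imp_degree_le[OF min_def_poly_dvd[OF assms] assms(1)] .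

lemma alg_height_le:
  assumes "P \<noteq> 0" "eval_X P \<alpha> = 0" shows "alg_height \<alpha> \<le> height P"
  unfolding alg_height_def using height_dvd_le[OF min_def_poly_dvd[OF assms] assms(1)] .

lemma eval_X_nonzero_of_not_algebraic:
  assumes "\<not> (alg_series \<xi> \<and> alg_degree \<xi> \<le> n)" "P \<noteq> 0" "degree P \<le> n"
  shows "eval_X P \<xi> \<noteq> 0"
  using assms alg_degree_le[of P \<xi>] by (auto simp: alg_series_def)

section \<open>Roots of nearly linear polynomials\<close>

text \<open>Each \<open>x ^ i - y ^ i\<close> contains the factor \<open>x - y\<close> with a
  cofactor bounded by \<open>C ^ (i - 1)\<close>, and an ultrametric sum is no larger than its
  largest term.\<close>

lemma laurent_abs_poly_diff:
  fixes f :: "'a::{finite,field} fls poly"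
  assumes coeff: "\<And>i. i \<ge> 1 \<Longrightarrow> laurent_abs (coeff f i) \<le> c" and C: "1 \<le> C"
    and x: "laurent_abs x \<le> C" and y: "laurent_abs y \<le> C" and n: "degree f \<le> n"
  shows "laurent_abs (poly f x - poly f y) \<le> c * C ^ (n - 1) * laurent_abs (x - y)"
proof -
  have c: "0 \<le> c" using coeff[of 1] laurent_abs_nonneg order_trans by blast
  have pow: "laurent_abs (x ^ i - y ^ i) \<le> C ^ (i - 1) * laurent_abs (x - y)" for i
  proof (cases i)
    case (Suc k)
    have "laurent_abs (x ^ Suc k - y ^ Suc k) \<le> C ^ k * laurent_abs (x - y)"
    proof (induction k)
      case (Suc k)
      have eq: "x ^ Suc (Suc k) - y ^ Suc (Suc k) = x * (x ^ Suc k - y ^ Suc k) + (x - y) * y ^ Suc k"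
        by (simp add: algebra_simps)
      have "laurent_abs (x * (x ^ Suc k - y ^ Suc k)) \<le> C * (C ^ k * laurent_abs (x - y))"
        unfolding laurent_abs_mult by (intro mult_mono Suc.IH x) (use C in auto)
      moreover have "laurent_abs ((x - y) * y ^ Suc k) \<le> laurent_abs (x - y) * C ^ Suc k"
        unfolding laurent_abs_mult laurent_abs_power by (intro mult_left_mono power_mono y) auto
      ultimately show ?case unfolding eq by (intro laurent_abs_add_le) (simp_all add: mult_ac)
    qed simp
    thus ?thesis by (simp add: Suc)
  qed simp
  have "poly f x - poly f y = (\<Sum>i\<le>n. coeff f i * (x ^ i - y ^ i))"
  proof -
    have "poly f z = (\<Sum>i\<le>n. coeff f i * z ^ i)" for z
      unfolding poly_altdef using n by (intro sum.mono_neutral_left) (auto simp: coeff_eq_0)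
    thus ?thesis by (simp add: sum_subtractf algebra_simps)
  qed
  also have "laurent_abs \<dots> \<le> c * C ^ (n - 1) * laurent_abs (x - y)"
  proof (rule laurent_abs_sum_le)
    fix i assume i: "i \<in> {..n}"
    show "laurent_abs (coeff f i * (x ^ i - y ^ i)) \<le> c * C ^ (n - 1) * laurent_abs (x - y)"
    proof (cases "i = 0")
      case False
      have "laurent_abs (coeff f i * (x ^ i - y ^ i)) \<le> c * (C ^ (i - 1) * laurent_abs (x - y))"
        unfolding laurent_abs_mult by (intro mult_mono pow coeff) (use False c in auto)
      also have "\<dots> \<le> c * (C ^ (n - 1) * laurent_abs (x - y))"
        by (intro mult_left_mono mult_right_mono power_increasing) (use i C c in auto)
      finally show ?thesis by (simp add: mult_ac)
    qed (use c C in simp)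
  qed (use c C in simp)
  finally show ?thesis .
qed

text \<open>A root of \<open>f = g + d X\<close> is a fixed point of
  \<open>F x = - g(x) / d\<close>. The bound on \<open>c\<close> makes the linear term beat the
  variation of \<open>g\<close> by a factor \<open>q\<close> on the unit ball around \<xi>, so
  \<open>F\<close> contracts; the same domination gives the exact distance.\<close>

lemma near_linear_root:
  fixes f :: "'a::{finite,field} fls poly"
  assumes deg: "degree f \<le> n" and d: "d \<noteq> 0" and C: "1 \<le> C" "laurent_abs \<xi> \<le> C"
    and coeff: "\<And>i. i \<ge> 1 \<Longrightarrow> laurent_abs (coeff f i - (if i = 1 then d else 0)) \<le> c"
    and c: "c * C ^ (n - 1) * real CARD('a) \<le> laurent_abs d"
    and small: "laurent_abs (poly f \<xi>) \<le> laurent_abs d" and n: "1 \<le> n"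
  obtains \<alpha> where "poly f \<alpha> = 0" "laurent_abs (\<xi> - \<alpha>) = laurent_abs (poly f \<xi>) / laurent_abs d"
proof -
  let ?q = "real CARD('a)"
  define g where "g = f - monom d 1"
  have q: "1 < ?q" by (rule card_field_gt_1)
  have ld: "laurent_abs d > 0" using d by simp
  have coeff_g: "laurent_abs (coeff g i) \<le> c" if "i \<ge> 1" for i
    using coeff[OF that] by (auto simp: g_def)
  have c0: "0 \<le> c" using coeff[of 1] laurent_abs_nonneg order_trans by blast
  have deg_g: "degree g \<le> n" unfolding g_def using deg n
    by (intro degree_diff_le) (auto intro: order_trans[OF degree_monom_le])
  have f: "poly f x = poly g x + d * x" for x by (simp add: g_def poly_monom)
  define S where "S = lball \<xi> 0"
  have S: "x \<in> S \<longleftrightarrow> laurent_abs (x - \<xi>) \<le> 1" for x by (simp add: S_def lball_def)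
  have absS: "laurent_abs x \<le> C" if "x \<in> S" for x
    using laurent_abs_add_le[of "x - \<xi>" C \<xi>] that C by (simp add: S)
  have contr: "laurent_abs (poly g x - poly g y) \<le> laurent_abs d / ?q * laurent_abs (x - y)"
    if "x \<in> S" "y \<in> S" for x y
  proof -
    have "laurent_abs (poly g x - poly g y) \<le> c * C ^ (n - 1) * laurent_abs (x - y)"
      by (rule laurent_abs_poly_diff) (use coeff_g C absS that deg_g in auto)
    also have "\<dots> \<le> laurent_abs d / ?q * laurent_abs (x - y)"
      by (intro mult_right_mono) (use c q in \<open>auto simp: field_simps\<close>)
    finally show ?thesis .
  qed
  define F where "F x = - (poly g x / d)" for x
  have Fd: "laurent_abs (F x - F y) \<le> laurent_abs (x - y) / ?q" if "x \<in> S" "y \<in> S" for x y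
  proof -
    have "F x - F y = (poly g y - poly g x) / d" by (simp add: F_def diff_divide_distrib)
    hence "laurent_abs (F x - F y) = laurent_abs (poly g x - poly g y) / laurent_abs d"
      by (simp add: laurent_abs_divide laurent_abs_diff_commute)
    also have "\<dots> \<le> (laurent_abs d / ?q * laurent_abs (x - y)) / laurent_abs d"
      by (intro divide_right_mono contr that) simp
    finally show ?thesis using ld by simp
  qed
  have Ff: "F x - x = - (poly f x / d)" for x using d by (simp add: F_def f field_simps)
  have mapS: "F x \<in> S" if x: "x \<in> S" for x
  proof -
    have "laurent_abs (F x - F \<xi>) \<le> laurent_abs (x - \<xi>) / ?q" by (rule Fd) (use x in \<open>auto simp: S\<close>)
    also have "\<dots> \<le> 1" using x q by (simp add: S field_simps)
    finally have "laurent_abs (F x - F \<xi>) \<le> 1" .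
    moreover have "laurent_abs (F \<xi> - \<xi>) \<le> 1"
      unfolding Ff using small ld by (simp add: laurent_abs_divide)
    ultimately show ?thesis using laurent_abs_add_le[of "F x - F \<xi>" 1 "F \<xi> - \<xi>"] by (simp add: S)
  qed
  \<comment> \<open>A factor \<open>1/q\<close> in absolute value raises the subdegree by one, which
    in the library metric is the factor 1/2 for every \<open>q\<close>.\<close>
  have dist_half: "dist (F x) (F y) \<le> (1/2) * dist x y" if xy: "x \<in> S" "y \<in> S" for x y
  proof (cases "x = y")
    case False
    define k where "k = fls_subdegree (x - y)"
    have k: "laurent_abs (x - y) = ?q powi (- k)" using False by (simp add: laurent_abs_def k_def)
    have "laurent_abs (F x - F y) \<le> ?q powi (- k) / ?q" using Fd[OF xy] by (simp add: k)
    also have "\<dots> = ?q powi (- (k + 1))" using q by (simp add: power_int_diff)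
    finally have "dist (F x) (F y) \<le> 2 powi (- (k + 1))" by (simp only: dist_fls_le_iff)
    also have "\<dots> = (1/2) * dist x y" using False by (simp add: dist_fls_powi k_def power_int_diff)
    finally show ?thesis .
  qed simp
  have "\<exists>!x\<in>S. F x = x"
  proof (rule Banach_fix[where c = "1/2"])
    have "closed S" by (simp add: S_def lball_conv_cball)
    thus "complete S" by (simp add: complete_eq_closed)
    show "S \<noteq> {}" using S[of \<xi>] by auto
  qed (use mapS dist_half in auto)
  then obtain \<alpha> where \<alpha>: "\<alpha> \<in> S" "F \<alpha> = \<alpha>" by blast
  have root: "poly f \<alpha> = 0" using Ff[of \<alpha>] \<alpha>(2) d by simp
  have "laurent_abs (poly g \<xi> - poly g \<alpha>) \<le> laurent_abs d / ?q * laurent_abs (\<xi> - \<alpha>)"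
    by (rule contr) (use \<alpha> in \<open>auto simp: S_def\<close>)
  have "laurent_abs (poly f \<xi>) = laurent_abs d * laurent_abs (\<xi> - \<alpha>)"
  proof (cases "\<xi> = \<alpha>")
    case False
    have "laurent_abs d / ?q * laurent_abs (\<xi> - \<alpha>) < laurent_abs d * laurent_abs (\<xi> - \<alpha>)"
      using False ld q by (intro mult_strict_right_mono) (auto simp: field_simps)
    hence lt: "laurent_abs (poly g \<xi> - poly g \<alpha>) < laurent_abs (d * (\<xi> - \<alpha>))"
      using \<open>laurent_abs (poly g \<xi> - poly g \<alpha>) \<le> _\<close> by (simp add: laurent_abs_mult)
    have "poly f \<xi> = d * (\<xi> - \<alpha>) + (poly g \<xi> - poly g \<alpha>)"
      using root by (simp add: f algebra_simps)
    thus ?thesis using laurent_abs_add_eq[OF lt] by (simp add: laurent_abs_mult)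
  qed (use root in simp)
  thus thesis using root ld that[of \<alpha>] by simp
qed

text \<open>Degree less than \<open>k\<close>, but with 0 included even for \<open>k = 0\<close>, so
  that the set always has \<open>q ^ k\<close> elements over F_q and membership is linear.\<close>

definition below :: "nat \<Rightarrow> 'a::zero poly set" where
  "below k = {p. \<forall>i\<ge>k. coeff p i = 0}"

lemma zero_in_below [simp]: "0 \<in> below k"
  by (simp add: below_def)

lemma below_degree: "p \<in> below (Suc k) \<longleftrightarrow> degree p \<le> k"
proof
  assume "p \<in> below (Suc k)"
  thus "degree p \<le> k" by (intro degree_le) (auto simp: below_def)
next
  assume "degree p \<le> k"
  thus "p \<in> below (Suc k)" by (auto simp: below_def intro!: coeff_eq_0)
qed

lemma in_below_iff: "p \<in> below k \<longleftrightarrow> p = 0 \<or> degree p < k"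
proof (cases k)
  case 0
  thus ?thesis by (auto simp: below_def poly_eq_iff)
next
  case (Suc j)
  thus ?thesis by (auto simp: below_degree less_Suc_eq_le)
qed

text \<open>The coefficient set \<open>S\<close> is general because counting is done twice: for
  polynomials in \<open>T\<close>, and for polynomials in \<open>X\<close> whose coefficients lie in
  \<open>below (Suc k)\<close>.\<close>

lemma bij_betw_below:
  "bij_betw (\<lambda>p. map (coeff p) [0..<k]) {p \<in> below k. range (coeff p) \<subseteq> S} {xs. set xs \<subseteq> S \<and> length xs = k}"
  if "(0::'a::zero) \<in> S"
proof (rule bij_betwI[where g = Poly])
  show "Poly \<in> {xs. set xs \<subseteq> S \<and> length xs = k} \<rightarrow> {p \<in> below k. range (coeff p) \<subseteq> S}"
    using that by (auto simp: below_def nth_default_def subset_iff)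
  show "Poly (map (coeff p) [0..<k]) = p" if "p \<in> {p \<in> below k. range (coeff p) \<subseteq> S}" for p
    by (rule poly_eqI) (use that in \<open>auto simp: below_def nth_default_def\<close>)
  show "map (coeff (Poly xs)) [0..<k] = xs" if "xs \<in> {xs. set xs \<subseteq> S \<and> length xs = k}" for xs
    by (rule nth_equalityI) (use that in \<open>auto simp: nth_default_def\<close>)
qed (auto simp: image_subset_iff)

lemma card_below_coeffs:
  assumes "finite S" "(0::'a::zero) \<in> S"
  shows "finite {p \<in> below k. range (coeff p) \<subseteq> S}" "card {p \<in> below k. range (coeff p) \<subseteq> S} = card S ^ k"
  using bij_betw_finite[OF bij_betw_below[OF assms(2)], of k] bij_betw_same_card[OF bij_betw_below[OF assms(2)], of k]
    finite_lists_length_eq[OF assms(1), of k] card_lists_length_eq[OF assms(1), of k] by auto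

lemma finite_below [simp]: "finite (below k :: 'a::{finite,zero} poly set)"
  and card_below: "card (below k :: 'a::{finite,zero} poly set) = CARD('a) ^ k"
  using card_below_coeffs[of "UNIV :: 'a set" k] by auto

section \<open>Duality\<close>

text \<open>Multiplication by \<open>T\<close> shifts digits by one place. The dependence on
  \<open>l + s\<close> alone is the Hankel symmetry behind the duality.\<close>

lemma fls_nth_poly_T_mult:
  assumes "Q \<in> below N"
  shows "fls_nth (poly_T Q * z) l = (\<Sum>s<N. coeff Q s * fls_nth z (l + int s))"
  using assms
proof (induction Q arbitrary: l N)
  case (pCons c Q)
  show ?case
  proof (cases N)
    case 0
    with pCons.prems have "pCons c Q = 0" by (auto simp: below_def poly_eq_iff)
    thus ?thesis using 0 by simp
  next
    case (Suc N')
    have Q: "Q \<in> below N'"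
      unfolding below_def
    proof safe
      fix i assume "N' \<le> i"
      thus "coeff Q i = 0" using pCons.prems Suc by (auto simp: below_def dest!: spec[of _ "Suc i"])
    qed
    have "fls_nth (poly_T (pCons c Q) * z) l = c * fls_nth z l + fls_nth (fls_X_inv * (poly_T Q * z)) l"
      by (simp add: poly_T_pCons algebra_simps)
    also have "fls_nth (fls_X_inv * (poly_T Q * z)) l = fls_nth (poly_T Q * z) (l + 1)"
      by (simp add: fls_X_inv_times_conv_shift)
    also have "\<dots> = (\<Sum>s<N'. coeff Q s * fls_nth z (l + 1 + int s))" by (rule pCons.IH[OF Q])
    also have "c * fls_nth z l + \<dots> = (\<Sum>s<N. coeff (pCons c Q) s * fls_nth z (l + int s))"
      unfolding Suc by (simp add: sum.lessThan_Suc_shift algebra_simps del: sum.lessThan_Suc)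
    finally show ?thesis .
  qed
qed simp

definition dual_approx :: "nat \<Rightarrow> nat \<Rightarrow> nat \<Rightarrow> 'a::{finite,field} fls \<Rightarrow> bool" where
  "dual_approx n N h \<xi> \<longleftrightarrow> (\<exists>Q\<in>below N. Q \<noteq> 0 \<and>
     (\<forall>i\<in>{1..n}. \<exists>P. laurent_abs (poly_T Q * \<xi> ^ i - poly_T P) < real CARD('a) powi (- int h)))"

lemma laurent_abs_less_iff_nth:
  fixes x :: "'a::{finite,field} fls"
  shows "laurent_abs x < real CARD('a) powi (- k) \<longleftrightarrow> (\<forall>i\<le>k. fls_nth x i = 0)"
proof -
  have "laurent_abs x < real CARD('a) powi (- k) \<longleftrightarrow> laurent_abs x \<le> real CARD('a) powi (- (k + 1))"
    unfolding laurent_abs_less_powi_iff[of x "- k"] by simp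
  also have "\<dots> \<longleftrightarrow> (\<forall>i\<le>k. fls_nth x i = 0)" unfolding laurent_abs_le_powi_iff by auto
  finally show ?thesis .
qed

text \<open>A polynomial can remove all digits of index at most 0, so only the digits 1 to
  \<open>h\<close> count; the strict inequality is what includes digit \<open>h\<close>.\<close>

lemma ex_poly_T_iff_digits:
  fixes x :: "'a::{finite,field} fls"
  shows "(\<exists>P. laurent_abs (x - poly_T P) < real CARD('a) powi (- int h)) \<longleftrightarrow>
    (\<forall>k<h. fls_nth x (int k + 1) = 0)"
proof
  assume "\<exists>P. laurent_abs (x - poly_T P) < real CARD('a) powi (- int h)"
  then obtain P where P: "\<forall>i\<le>int h. fls_nth (x - poly_T P) i = 0"
    unfolding laurent_abs_less_iff_nth by blast
  show "\<forall>k<h. fls_nth x (int k + 1) = 0"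
  proof safe
    fix k assume "k < h"
    thus "fls_nth x (int k + 1) = 0" using P[rule_format, of "int k + 1"] by (simp add: fls_nth_poly_T)
  qed
next
  assume *: "\<forall>k<h. fls_nth x (int k + 1) = 0"
  obtain P where P: "laurent_abs (x - poly_T P) < 1" using integer_part_ex by blast
  hence P0: "\<forall>i\<le>0. fls_nth (x - poly_T P) i = 0"
    using laurent_abs_less_iff_nth[of "x - poly_T P" 0] by simp
  have "fls_nth (x - poly_T P) i = 0" if "i \<le> int h" for i
  proof (cases "i \<le> 0")
    case False
    thus ?thesis using *[rule_format, of "nat (i - 1)"] that by (simp add: fls_nth_poly_T)
  qed (use P0 in simp)
  thus "\<exists>P. laurent_abs (x - poly_T P) < real CARD('a) powi (- int h)"
    unfolding laurent_abs_less_iff_nth by blast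
qed

text \<open>Over \<open>'a\<close> the map sending \<open>b\<close> to the first \<open>N\<close> fractional digits of \<open>\<Sum>i. b i * \<xi> ^ i\<close> is linear;
  a linear functional vanishing on its image is a polynomial \<open>Q\<close> all of whose products
  \<open>Q * \<xi> ^ i\<close> are within \<open>T^(-h)\<close> of polynomials.\<close>

lemma dual_approx_or_surjective:
  fixes \<xi> :: "'a::{finite,field} fls"
  assumes "\<not> dual_approx n N h \<xi>" "1 \<le> N"
  shows "\<exists>b a. (\<forall>i. b i \<in> below h) \<and>
    laurent_abs (x + (\<Sum>i=1..n. poly_T (b i) * \<xi> ^ i) + poly_T a) < real CARD('a) powi (- int N)"
proof -
  define val where "val b = (\<Sum>i=1..n. poly_T (b i) * \<xi> ^ i)" for b :: "nat \<Rightarrow> 'a poly"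
  define dig where "dig y = (\<lambda>k. fls_nth y (int k + 1))" for y :: "'a fls"
  define V where "V = dig ` val ` {b. \<forall>i. b i \<in> below h}"
  define good where "good vs \<longleftrightarrow> set vs \<subseteq> V \<and> indep N vs" for vs :: "(nat \<Rightarrow> 'a) list"
  have "good []" using assms(2) by (simp add: good_def)
  moreover have "length vs \<le> N" if "good vs" for vs
    using that indep_length_le by (auto simp: good_def)
  ultimately obtain vs where vs: "good vs" "\<And>us. good us \<Longrightarrow> length us \<le> length vs"
    using ex_has_greatest_nat[of good "[]" length "Suc N"] by (auto simp: less_Suc_eq_le)
  have V_spn: "v \<in> spn N vs" if "v \<in> V" for v
  proof (rule ccontr)
    assume "v \<notin> spn N vs"
    hence "good (v # vs)" using vs(1) that by (simp add: good_def indep_Cons_iff)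
    thus False using vs(2) by force
  qed
  obtain I where I: "I \<in> idx N (length vs)" "minor vs I \<noteq> 0"
    using vs(1) by (auto simp: good_def indep_def)
  have full: "length vs = N"
  proof (rule ccontr)
    assume "length vs \<noteq> N"
    hence lt: "length vs < N" using indep_length_le[of N vs] vs(1) by (simp add: good_def)
    have "card (set I) < N" using card_length[of I] I(1) lt by (simp add: idx_def)
    hence "\<not> {..<N} \<subseteq> set I" using card_mono[of "set I" "{..<N}"] by auto
    then obtain i0 where i0: "i0 < N" "i0 \<notin> set I" by auto
    define J where "J = i0 # I"
    have J: "J \<in> idx N (Suc (length vs))" using i0 I by (simp add: J_def Cons_in_idx)
    \<comment> \<open>The coefficients, collected by column, of the linear form sending
      \<open>v\<close> to \<open>minor (v # vs) J\<close>. It vanishes on \<open>V\<close>, and its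
      coefficient at \<open>i0\<close> is the nonzero \<open>minor vs I\<close>.\<close>
    define y where "y s = (\<Sum>k\<in>{k. k < length J \<and> J ! k = s}. (- 1) ^ k * minor vs (del k J))" for s
    have "{k. k < length J \<and> J ! k = i0} = {0}"
    proof -
      have "k = 0" if "k < length J" "J ! k = i0" for k
        using that i0(2) nth_mem[of "k - 1" I] by (cases k) (auto simp: J_def)
      thus ?thesis by (auto simp: J_def)
    qed
    hence y0: "y i0 = minor vs I" by (simp add: y_def J_def)
    have kill: "(\<Sum>s<N. y s * v s) = 0" if "v \<in> V" for v
    proof -
      have "0 = minor (v # vs) J" using V_spn[OF that] J by (simp add: spn_def)
      also have "\<dots> = (\<Sum>k<length J. (- 1) ^ k * v (J ! k) * minor vs (del k J))"
        by (rule minor_expand_row) (use J in \<open>simp add: idx_def\<close>)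
      also have "\<dots> = (\<Sum>s<N. \<Sum>k\<in>{k. k \<in> {..<length J} \<and> J ! k = s}.
          (- 1) ^ k * v (J ! k) * minor vs (del k J))"
      proof (rule sum.group[symmetric])
        have "(\<lambda>k. J ! k) ` {..<length J} = set J" by (auto simp: set_conv_nth)
        thus "(\<lambda>k. J ! k) ` {..<length J} \<subseteq> {..<N}" using J by (simp add: idx_def)
      qed auto
      also have "\<dots> = (\<Sum>s<N. y s * v s)"
        unfolding y_def sum_distrib_right by (intro sum.cong) auto
      finally show ?thesis by simp
    qed
    define Q where "Q = (\<Sum>s<N. monom (y s) s)"
    have cQ: "coeff Q s = (if s < N then y s else 0)" for s
      unfolding Q_def coeff_sum by (auto simp: if_distrib cong: if_cong)
    have QN: "Q \<in> below N" by (simp add: below_def cQ)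
    have "coeff Q i0 \<noteq> 0" using i0 y0 I(2) by (simp add: cQ)
    hence Q0: "Q \<noteq> 0" by auto
    have "fls_nth (poly_T Q * \<xi> ^ i) (int k + 1) = 0" if i: "i \<in> {1..n}" and k: "k < h" for i k
    proof -
      \<comment> \<open>Test with \<open>T ^ k\<close> in place \<open>i\<close>: digit
        \<open>s\<close> of \<open>T ^ k * \<xi> ^ i\<close> is digit \<open>k\<close> of
        \<open>T ^ s * \<xi> ^ i\<close>, so the vanishing of the form says that digit
        \<open>k\<close> of \<open>Q * \<xi> ^ i\<close> is 0.\<close>
      define b where "b = (\<lambda>j. if j = i then monom (1::'a) k else 0)"
      have "\<forall>j. b j \<in> below h" using k by (simp add: b_def below_def)
      hence "dig (val b) \<in> V" by (simp add: V_def)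
      hence "(\<Sum>s<N. y s * dig (val b) s) = 0" by (rule kill)
      moreover have "val b = poly_T (monom 1 k) * \<xi> ^ i"
      proof -
        have "val b = (\<Sum>j=1..n. if j = i then poly_T (monom 1 k) * \<xi> ^ i else 0)"
          unfolding val_def by (intro sum.cong) (auto simp: b_def)
        thus ?thesis using i by simp
      qed
      moreover have "dig (poly_T (monom 1 k) * \<xi> ^ i) s = fls_nth (\<xi> ^ i) (int k + 1 + int s)" for s
      proof -
        have "monom (1::'a) k \<in> below (Suc k)" by (simp add: below_def)
        thus ?thesis unfolding dig_def
          by (subst fls_nth_poly_T_mult) (auto simp: algebra_simps if_distrib cong: if_cong)
      qed
      ultimately have "(\<Sum>s<N. y s * fls_nth (\<xi> ^ i) (int k + 1 + int s)) = 0" by simp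
      thus ?thesis by (subst fls_nth_poly_T_mult[OF QN]) (simp add: cQ)
    qed
    hence "dual_approx n N h \<xi>"
      unfolding dual_approx_def ex_poly_T_iff_digits using QN Q0 by blast
    thus False using assms(1) by simp
  qed
  \<comment> \<open>The rank is now \<open>N\<close>: among \<open>N + 1\<close> columns with
    indices below \<open>N\<close> two coincide, so every vector lies in the span.\<close>
  have "dig (- x) \<in> spn N vs"
    unfolding spn_def full
  proof (safe, rule minor_col_dup)
    fix J assume J: "J \<in> idx N (Suc N)"
    thus "length J = length (dig (- x) # vs)" by (simp add: idx_def full)
    show "\<not> distinct J"
    proof
      assume "distinct J"
      hence "Suc N = card (set J)" using J by (simp add: distinct_card idx_def)
      also have "\<dots> \<le> N" using card_mono[of "{..<N}" "set J"] J by (simp add: idx_def)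
      finally show False by simp
    qed
  qed
  moreover have "indep N vs" using vs(1) by (simp add: good_def)
  ultimately obtain c where c: "\<And>k. k < N \<Longrightarrow> dig (- x) k = (\<Sum>a<length vs. c a * (vs ! a) k)"
    using spn_expand by blast
  have "\<forall>a. \<exists>b. a < length vs \<longrightarrow> (\<forall>i. b i \<in> below h) \<and> vs ! a = dig (val b)"
  proof
    fix a
    show "\<exists>b. a < length vs \<longrightarrow> (\<forall>i. b i \<in> below h) \<and> vs ! a = dig (val b)"
    proof (cases "a < length vs")
      case True
      hence "vs ! a \<in> V" using vs(1) by (auto simp: good_def)
      thus ?thesis unfolding V_def by blast
    qed simp
  qed
  from choice[OF this] obtain B where B: "\<And>a i. a < length vs \<Longrightarrow> B a i \<in> below h"
    "\<And>a. a < length vs \<Longrightarrow> vs ! a = dig (val (B a))" by blast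
  define b where "b i = (\<Sum>a<length vs. smult (c a) (B a i))" for i
  have bb: "\<forall>i. b i \<in> below h"
    using B(1) by (auto simp: b_def below_def coeff_sum)
  have "val b = (\<Sum>i=1..n. \<Sum>a<length vs. fls_const (c a) * (poly_T (B a i) * \<xi> ^ i))"
    unfolding val_def b_def by (simp add: poly_T_sum poly_T_smult sum_distrib_right mult.assoc)
  also have "\<dots> = (\<Sum>a<length vs. \<Sum>i=1..n. fls_const (c a) * (poly_T (B a i) * \<xi> ^ i))"
    by (rule sum.swap)
  also have "\<dots> = (\<Sum>a<length vs. fls_const (c a) * val (B a))"
    unfolding val_def by (simp add: sum_distrib_left)
  finally have "val b = (\<Sum>a<length vs. fls_const (c a) * val (B a))" .
  hence "dig (val b) k = (\<Sum>a<length vs. c a * (vs ! a) k)" for k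
    by (simp add: dig_def fls_nth_sum B(2))
  hence "\<forall>k<N. fls_nth (x + val b) (int k + 1) = 0"
    using c by (simp add: dig_def eq_neg_iff_add_eq_0 add.commute neg_eq_iff_add_eq_0)
  then obtain P where "laurent_abs (x + val b - poly_T P) < real CARD('a) powi (- int N)"
    unfolding ex_poly_T_iff_digits[symmetric] by blast
  hence "laurent_abs (x + val b + poly_T (- P)) < real CARD('a) powi (- int N)"
    by (simp add: poly_T_uminus)
  thus ?thesis using bb unfolding val_def by blast
qed

section \<open>Approximation by algebraic series\<close>

lemma eval_X_monom: "eval_X (monom c i) x = poly_T c * x ^ i"
proof -
  have "eval_X (monom c i) x = (\<Sum>j\<le>i. poly_T (coeff (monom c i) j) * x ^ j)"
    by (rule eval_X_sum_le) (rule degree_monom_le)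
  also have "\<dots> = (\<Sum>j\<le>i. if j = i then poly_T c * x ^ i else 0)"
    by (intro sum.cong) auto
  finally show ?thesis by simp
qed

lemma eval_X_sum: "eval_X (sum P I) x = (\<Sum>i\<in>I. eval_X (P i) x)"
  by (induction I rule: infinite_finite_induct) (auto simp: eval_X_add)

lemma laurent_abs_poly_T_below:
  fixes b :: "'a::{finite,field} poly"
  assumes "b \<in> below (Suc k)" shows "laurent_abs (poly_T b) \<le> real CARD('a) ^ k"
  using laurent_abs_poly_T_le_iff[of "int k" b] assms by (simp add: below_degree)

lemma ex_laurent_abs_le_power:
  fixes x :: "'a::{finite,field} fls"
  obtains M :: nat where "laurent_abs x \<le> real CARD('a) ^ M"
proof -
  obtain M :: nat where "laurent_abs x < real CARD('a) ^ M"
    using real_arch_pow card_field_gt_1 by blast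
  thus thesis using that[of M] by simp
qed

text \<open>Duality applied to \<open>x = D * \<xi>\<close> with \<open>D\<close> a power of
  \<open>T\<close> gives a polynomial that is small at \<xi> and whose linear coefficient
  \<open>D + b 1\<close> dominates the higher ones.\<close>

lemma approx_of_not_dual_approx:
  fixes \<xi> :: "'a::{finite,field} fls"
  assumes nd: "\<not> dual_approx n N h \<xi>" and N: "1 \<le> N" and n: "1 \<le> n"
    and M: "laurent_abs \<xi> \<le> real CARD('a) ^ M"
  obtains P \<alpha> where "P \<noteq> 0" "degree P \<le> n" "eval_X P \<alpha> = 0" "height P \<le> real CARD('a) ^ (h + n * M)"
    "laurent_abs (\<xi> - \<alpha>) < real CARD('a) powi (- int (N + h))"
proof -
  let ?q = "real CARD('a)"
  have q: "1 < ?q" by (rule card_field_gt_1)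
  \<comment> \<open>For |\<xi>| up to \<open>q ^ M\<close> the nonlinear terms can vary
    \<open>q ^ (M * (n - 1))\<close> times as fast as on the unit ball; the extra degree
    \<open>c\<close> of \<open>D\<close> makes up for this.\<close>
  define c where "c = M * (n - 1)"
  define D :: "'a poly" where "D = monom 1 (h + c)"
  have absD: "laurent_abs (poly_T D) = ?q ^ (h + c)" "D \<noteq> 0"
    by (auto simp: D_def laurent_abs_poly_T degree_monom_eq)
  obtain b a where b: "\<And>i. b i \<in> below h" and small:
    "laurent_abs (poly_T D * \<xi> + (\<Sum>i=1..n. poly_T (b i) * \<xi> ^ i) + poly_T a) < ?q powi (- int N)"
    using dual_approx_or_surjective[OF nd N, of "poly_T D * \<xi>"] by blast
  have abs_b: "laurent_abs (poly_T (b i)) \<le> ?q ^ h / ?q" for i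
  proof (cases h)
    case 0
    hence "b i = 0" using b[of i] by (simp add: in_below_iff)
    thus ?thesis by simp
  next
    case (Suc h')
    thus ?thesis using laurent_abs_poly_T_below[of "b i" h'] b[of i] q by simp
  qed
  define P where "P = monom a 0 + monom D 1 + (\<Sum>i=1..n. monom (b i) i)"
  have coeff_P: "coeff P i = (if i = 0 then a else 0) + (if i = 1 then D else 0) +
      (if 1 \<le> i \<and> i \<le> n then b i else 0)" for i
    unfolding P_def by (auto simp: coeff_sum if_distrib cong: if_cong)
  have degP: "degree P \<le> n"
    by (rule degree_le) (use n in \<open>auto simp: coeff_P\<close>)
  have eval: "eval_X P \<xi> = poly_T D * \<xi> + (\<Sum>i=1..n. poly_T (b i) * \<xi> ^ i) + poly_T a"
    by (simp add: P_def eval_X_add eval_X_sum eval_X_monom add_ac)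
  have bD: "laurent_abs (poly_T (b i)) < ?q ^ (h + c)" for i
  proof -
    have "?q ^ h / ?q < ?q ^ h" using q by (simp add: field_simps)
    also have "\<dots> \<le> ?q ^ (h + c)" using q by (intro power_increasing) auto
    finally show ?thesis using abs_b[of i] by simp
  qed
  have "coeff P 1 \<noteq> 0"
  proof
    assume "coeff P 1 = 0"
    hence "D = - b 1" using n by (simp add: coeff_P eq_neg_iff_add_eq_0)
    hence "laurent_abs (poly_T D) = laurent_abs (poly_T (b 1))" by (simp add: poly_T_uminus)
    thus False using bD[of 1] absD by simp
  qed
  hence P0: "P \<noteq> 0" by auto
  have less1: "laurent_abs (eval_X P \<xi>) < 1"
  proof -
    have "?q powi (- int N) \<le> ?q powi 0" unfolding card_powi_le_iff by simp
    thus ?thesis using small eval by simp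
  qed
  have one_le: "1 \<le> ?q ^ (h + c)" using q by (simp add: one_le_power)
  have degf: "degree (map_poly poly_T P) \<le> n" using degree_map_poly_le degP order_trans by blast
  obtain \<alpha> where \<alpha>: "poly (map_poly poly_T P) \<alpha> = 0"
    "laurent_abs (\<xi> - \<alpha>) = laurent_abs (poly (map_poly poly_T P) \<xi>) / laurent_abs (poly_T D)"
  proof (rule near_linear_root[OF degf, of "poly_T D" "?q ^ M" \<xi> "?q ^ h / ?q"])
    show "1 \<le> ?q ^ M" using q by (simp add: one_le_power)
    show "laurent_abs (coeff (map_poly poly_T P) i - (if i = 1 then poly_T D else 0)) \<le> ?q ^ h / ?q"
      if "1 \<le> i" for i
      using that abs_b[of i] by (auto simp: coeff_map_poly coeff_P poly_T_add)
    show "?q ^ h / ?q * (?q ^ M) ^ (n - 1) * ?q \<le> laurent_abs (poly_T D)"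
      using q by (simp add: absD c_def power_add flip: power_mult)
    show "laurent_abs (poly (map_poly poly_T P) \<xi>) \<le> laurent_abs (poly_T D)"
      using less1 one_le unfolding absD eval_X_def[symmetric] by linarith
  qed (use absD n M in auto)
  show thesis
  proof (rule that[OF P0 degP])
    show "eval_X P \<alpha> = 0" using \<alpha>(1) by (simp add: eval_X_def)
    have "laurent_abs (\<xi> - \<alpha>) = laurent_abs (eval_X P \<xi>) / ?q ^ (h + c)"
      using \<alpha>(2) by (simp add: absD eval_X_def)
    also have "\<dots> \<le> laurent_abs (eval_X P \<xi>) / ?q ^ h"
      by (intro divide_left_mono power_increasing) (use q in auto)
    also have "\<dots> < ?q powi (- int N) / ?q ^ h"
      using small eval q by (intro divide_strict_right_mono) auto
    also have "\<dots> = ?q powi (- int (N + h))"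
      using q by (simp add: power_int_diff flip: power_int_of_nat)
    finally show "laurent_abs (\<xi> - \<alpha>) < ?q powi (- int (N + h))" .
    \<comment> \<open>The constant coefficient has to cancel \<open>D * \<xi>\<close>, of size up to
      \<open>q ^ (h + c + M)\<close>; this fixes the height bound.\<close>
    have cM: "h + c + M = h + n * M" using n unfolding c_def by (cases n) (auto simp: algebra_simps)
    have big: "?q ^ h * ?q ^ (M * i) \<le> ?q ^ (h + n * M)" if "i \<le> n" for i
      unfolding power_add[symmetric] using q that by (intro power_increasing) (auto simp: mult.commute)
    have Dbig: "?q ^ (h + c) \<le> ?q ^ (h + n * M)"
      using q cM by (intro power_increasing) auto
    have ge1: "1 \<le> ?q ^ (h + n * M)" using q by (simp add: one_le_power)
    have a: "laurent_abs (poly_T a) \<le> ?q ^ (h + n * M)"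
    proof -
      have eq: "poly_T a = eval_X P \<xi> - (poly_T D * \<xi> + (\<Sum>i=1..n. poly_T (b i) * \<xi> ^ i))"
        by (simp add: eval)
      have "laurent_abs (poly_T D * \<xi>) \<le> ?q ^ (h + c) * ?q ^ M"
        unfolding laurent_abs_mult absD using M by (intro mult_left_mono) auto
      hence 1: "laurent_abs (poly_T D * \<xi>) \<le> ?q ^ (h + n * M)"
        by (simp only: cM flip: power_add)
      have 2: "laurent_abs (poly_T (b i) * \<xi> ^ i) \<le> ?q ^ (h + n * M)" if "i \<in> {1..n}" for i
      proof -
        have "laurent_abs (poly_T (b i) * \<xi> ^ i) \<le> ?q ^ h * (?q ^ M) ^ i"
          unfolding laurent_abs_mult laurent_abs_power
        proof (intro mult_mono power_mono M)
          have "?q ^ h / ?q \<le> ?q ^ h" using q by (simp add: field_simps)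
          thus "laurent_abs (poly_T (b i)) \<le> ?q ^ h" using abs_b[of i] by simp
        qed auto
        also have "\<dots> = ?q ^ h * ?q ^ (M * i)" by (simp add: power_mult)
        also have "\<dots> \<le> ?q ^ (h + n * M)" by (rule big) (use that in auto)
        finally show ?thesis .
      qed
      have 3: "laurent_abs (eval_X P \<xi>) \<le> ?q ^ (h + n * M)" using less1 ge1 by linarith
      show ?thesis unfolding eq
        by (intro laurent_abs_diff_le laurent_abs_add_le laurent_abs_sum_le 1 2 3) (use q in auto)
    qed
    show "height P \<le> ?q ^ (h + n * M)"
    proof (subst height_le_iff; safe?)
      fix i
      have "laurent_abs (poly_T (b i)) \<le> ?q ^ (h + n * M)" using bD[of i] Dbig by simp
      thus "laurent_abs (poly_T (coeff P i)) \<le> ?q ^ (h + n * M)"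
        unfolding coeff_P poly_T_add using a Dbig absD by (intro laurent_abs_add_le) auto
    qed (use ge1 in auto)
  qed
qed

text \<open>Turns approximations of growing quality into infinitely many distinct ones.\<close>

lemma infinite_of_arbitrarily_small:
  fixes f :: "'b \<Rightarrow> real"
  assumes "\<And>x. x \<in> S \<Longrightarrow> 0 < f x" "\<And>j :: nat. \<exists>x\<in>S. f x < (1/2) ^ j"
  shows "infinite S"
proof
  assume fin: "finite S"
  have "S \<noteq> {}" using assms(2) by blast
  define e where "e = Min (f ` S)"
  have "e \<in> f ` S" unfolding e_def using fin \<open>S \<noteq> {}\<close> by (intro Min_in) auto
  hence "0 < e" using assms(1) by auto
  then obtain j where "(1/2) ^ j < e" using real_arch_pow_inv[of e "1/2"] by auto
  moreover obtain x where "x \<in> S" "f x < (1/2) ^ j" using assms(2) by blast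
  moreover from this have "e \<le> f x" unfolding e_def using fin by (intro Min_le) auto
  ultimately show False by simp
qed

lemma card_powi_le_half_power:
  assumes "int j \<le> k" shows "real CARD('a::{finite,field}) powi (- k) \<le> (1/2) ^ j"
proof -
  have q: "2 \<le> real CARD('a)" using card_field_gt_1[where 'a='a] by simp
  have "real CARD('a) powi (- k) \<le> real CARD('a) powi (- int j)" using assms by simp
  also have "\<dots> = (1 / real CARD('a)) ^ j" by (simp add: power_int_minus power_one_over field_simps)
  also have "\<dots> \<le> (1/2) ^ j" using q by (intro power_mono) (auto simp: field_simps)
  finally show ?thesis .
qed

lemma height_ge_1: "P \<noteq> 0 \<Longrightarrow> 1 \<le> height P"
  for P :: "'a::{finite,field} poly poly"
  using card_field_gt_1[where 'a='a] by (simp add: height_eq_degree_T one_le_power)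

lemma card_powr_conv_powi: "real CARD('a::{finite,field}) powr (real_of_int k) = real CARD('a) powi k"
  by (rule powr_real_of_int') (use card_field_pos[where 'a='a] in auto)

text \<open>The roots have exponent close to \<open>(N + h) / h - 1 = n (k - 1) / k\<close>, up to
  the fixed loss \<open>n M\<close> in the height. A target \<open>r < n\<close> is met by choosing
  \<open>k\<close> large and then \<open>g\<close> large.\<close>

lemma w_star_ge:
  fixes \<xi> :: "'a::{finite,field} fls"
  assumes n: "1 \<le> n" and nalg: "\<not> (alg_series \<xi> \<and> alg_degree \<xi> \<le> n)"
    and nd: "\<And>k. 2 \<le> k \<Longrightarrow> \<exists>\<^sub>\<infinity>g. \<not> dual_approx n (n * (k - 1) * g) (k * g) \<xi>"
  shows "ereal (real n) \<le> w_star n \<xi>"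
proof (rule ereal_le_real)
  let ?q = "real CARD('a)"
  have q: "1 < ?q" by (rule card_field_gt_1)
  obtain M where M: "laurent_abs \<xi> \<le> ?q ^ M" using ex_laurent_abs_le_power .
  have key: "ereal r \<le> w_star n \<xi>" if r: "0 \<le> r" "r < real n" for r
  proof -
    define S where "S = {\<alpha> :: 'a fls. alg_series \<alpha> \<and> alg_degree \<alpha> \<le> n \<and>
       0 < laurent_abs (\<xi> - \<alpha>) \<and> laurent_abs (\<xi> - \<alpha>) < alg_height \<alpha> powr (- r - 1)}"
    \<comment> \<open>The threshold amounts to \<open>s > 0\<close>, where \<open>s * g\<close> is
      the surplus of \<open>N + k' * g\<close> over \<open>k' * g * (r + 1)\<close>.\<close>
    obtain k :: nat where "real n / (real n - r) < real k" using reals_Archimedean2 by blast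
    define k' where "k' = k + 2"
    have k': "2 \<le> k'" "real n / (real n - r) < real k'"
      using \<open>_ < real k\<close> by (auto simp: k'_def)
    define s where "s = real n * (real k' - 1) - real k' * r"
    have s: "0 < s" using k'(2) r by (simp add: s_def field_simps)
    have "\<exists>\<alpha>\<in>S. laurent_abs (\<xi> - \<alpha>) < (1/2) ^ j" for j
    proof -
      \<comment> \<open>Beyond \<open>G\<close> the surplus \<open>s * g\<close> pays for the extra
        \<open>n * M\<close> in the height exponent.\<close>
      obtain G :: nat where G: "real n * real M * (r + 1) / s < real G" using reals_Archimedean2 by blast
      obtain g where g: "g > max (max G j) 1" "\<not> dual_approx n (n * (k' - 1) * g) (k' * g) \<xi>"
        using nd[OF k'(1)] unfolding INFM_nat by blast
      define N where "N = n * (k' - 1) * g"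
      have N1: "1 \<le> N" using n k' g by (simp add: N_def)
      obtain P \<alpha> where P: "P \<noteq> 0" "degree P \<le> n" "eval_X P \<alpha> = 0" "height P \<le> ?q ^ (k' * g + n * M)"
        and close: "laurent_abs (\<xi> - \<alpha>) < ?q powi (- int (N + k' * g))"
        using approx_of_not_dual_approx[OF g(2)[folded N_def] N1 n M] .
      have alg: "alg_series \<alpha>" using P by (auto simp: alg_series_def)
      have deg: "alg_degree \<alpha> \<le> n" using alg_degree_le[OF P(1,3)] P(2) by simp
      have ht: "alg_height \<alpha> \<le> ?q ^ (k' * g + n * M)" using alg_height_le[OF P(1,3)] P(4) by simp
      have ht1: "1 \<le> alg_height \<alpha>"
        unfolding alg_height_def using min_def_poly[OF alg] by (intro height_ge_1) auto
      have neq: "\<xi> \<noteq> \<alpha>" using nalg alg deg by auto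
      have "?q powi (- int (N + k' * g)) = ?q powr (- real (N + k' * g))"
        by (simp flip: card_powr_conv_powi)
      also have "\<dots> \<le> ?q powr (- ((real (k' * g + n * M)) * (r + 1)))"
      proof (rule powr_mono)
        have "real n * real M * (r + 1) \<le> s * real G" using G s by (simp add: field_simps)
        also have "\<dots> \<le> s * real g" using g s by (intro mult_left_mono) auto
        finally have "real n * real M * (r + 1) \<le> s * real g" .
        moreover have "real N = real n * (real k' - 1) * real g"
          using k' by (simp add: N_def of_nat_diff)
        ultimately show "- real (N + k' * g) \<le> - (real (k' * g + n * M) * (r + 1))"
          by (simp add: s_def algebra_simps)
      qed (use q in auto)
      also have "\<dots> = (?q ^ (k' * g + n * M)) powr (- r - 1)"
      proof -
        have "- (real (k' * g + n * M) * (r + 1)) = real (k' * g + n * M) * (- r - 1)"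
          by (simp add: algebra_simps)
        thus ?thesis using q by (simp only: powr_powr powr_realpow[symmetric])
      qed
      also have "\<dots> \<le> alg_height \<alpha> powr (- r - 1)"
        using ht ht1 r by (intro powr_mono2') auto
      finally have "laurent_abs (\<xi> - \<alpha>) < alg_height \<alpha> powr (- r - 1)" using close by simp
      hence "\<alpha> \<in> S" using alg deg neq by (simp add: S_def)
      moreover have "?q powi (- int (N + k' * g)) \<le> (1/2) ^ j"
      proof (rule card_powi_le_half_power)
        have "g \<le> k' * g" using k' by simp
        hence "j \<le> N + k' * g" using g(1) by linarith
        thus "int j \<le> int (N + k' * g)" by (simp only: of_nat_le_iff)
      qed
      ultimately show ?thesis using close by force
    qed
    hence "infinite S" by (intro infinite_of_arbitrarily_small[of S "\<lambda>\<alpha>. laurent_abs (\<xi> - \<alpha>)"]) (auto simp: S_def)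
    thus ?thesis unfolding w_star_def S_def by (intro SUP_upper) auto
  qed
  fix y assume y: "w_star n \<xi> \<le> ereal y"
  show "ereal (real n) \<le> ereal y"
  proof (rule ccontr)
    assume "\<not> ereal (real n) \<le> ereal y"
    hence yn: "y < real n" by simp
    \<comment> \<open>The maximum supplies the nonnegativity that \<open>key\<close> demands, in
      case \<open>y\<close> is negative.\<close>
    define r where "r = max 0 ((y + real n) / 2)"
    have "0 \<le> r" "r < real n" "y < r" using yn n by (auto simp: r_def field_simps max_def)
    thus False using key[of r] y order_trans[of "ereal r" "w_star n \<xi>" "ereal y"] by simp
  qed
qed

section \<open>Comparison of the two exponents\<close>

definition bounded_polys :: "nat \<Rightarrow> nat \<Rightarrow> 'a::zero poly poly set" where
  "bounded_polys n k = {P \<in> below (Suc n). range (coeff P) \<subseteq> below (Suc k)}"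

lemma finite_bounded_polys [simp]: "finite (bounded_polys n k :: 'a::{finite,field} poly poly set)"
  and card_bounded_polys: "card (bounded_polys n k :: 'a::{finite,field} poly poly set) = CARD('a) ^ (Suc k * Suc n)"
  unfolding bounded_polys_def
  using card_below_coeffs[of "below (Suc k) :: 'a poly set" "Suc n"]
  by (simp_all only: card_below power_mult finite_below zero_in_below)

lemma bounded_polys_iff:
  fixes P :: "'a::{finite,field} poly poly"
  shows "P \<in> bounded_polys n k \<longleftrightarrow> degree P \<le> n \<and> height P \<le> real CARD('a) ^ k"
proof -
  have "height P \<le> real CARD('a) ^ k \<longleftrightarrow> (\<forall>i. degree (coeff P i) \<le> k)"
    using laurent_abs_poly_T_le_iff[of "int k"] by (subst height_le_iff) auto
  thus ?thesis by (auto simp: bounded_polys_def below_degree image_subset_iff)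
qed

text \<open>A collision of the map sending \<open>R\<close> to \<open>\<Sum> R_i P_i\<close> gives a
  nonzero \<open>R\<close> with \<open>\<Sum> R_i P_i = 0\<close>. Then \<open>Q * R(\<xi>)\<close>
  is the combination of the errors \<open>Q * \<xi> ^ i - P_i\<close> with coefficients
  \<open>R_i\<close>.\<close>

lemma small_polynomial_of_dual_approx:
  fixes \<xi> :: "'a::{finite,field} fls"
  assumes "dual_approx n N h \<xi>" and n: "1 \<le> n" and M: "laurent_abs \<xi> \<le> real CARD('a) ^ M"
  obtains R e d where "R \<noteq> 0" "R \<in> bounded_polys n e" "d < N" "n * e \<le> d + n * M" "d + n * M < n * (e + 1)"
    "laurent_abs (eval_X R \<xi>) < real CARD('a) powi (int e - int h - int d)"
proof -
  let ?q = "real CARD('a)"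
  have q: "1 < ?q" by (rule card_field_gt_1)
  obtain Q where Q: "Q \<in> below N" "Q \<noteq> 0" and
    P': "\<forall>i\<in>{1..n}. \<exists>P. laurent_abs (poly_T Q * \<xi> ^ i - poly_T P) < ?q powi (- int h)"
    using assms(1) unfolding dual_approx_def by blast
  have "\<forall>i. \<exists>P. i \<le> n \<longrightarrow> laurent_abs (poly_T Q * \<xi> ^ i - poly_T P) < ?q powi (- int h)"
  proof
    fix i show "\<exists>P. i \<le> n \<longrightarrow> laurent_abs (poly_T Q * \<xi> ^ i - poly_T P) < ?q powi (- int h)"
      using P'[rule_format, of i] by (cases "i = 0") (auto intro!: exI[of _ Q])
  qed
  from choice[OF this] obtain P where
    P: "\<And>i. i \<le> n \<Longrightarrow> laurent_abs (poly_T Q * \<xi> ^ i - poly_T (P i)) < ?q powi (- int h)" by blast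
  define d where "d = degree Q"
  \<comment> \<open>The least exponent for which the count works: there are
    \<open>q ^ ((e + 1) * (n + 1))\<close> candidates and at most
    \<open>q ^ (e + d + n * M + 1)\<close> values, and the former are more exactly when
    \<open>d + n * M < n * (e + 1)\<close>.\<close>
  define e where "e = (d + n * M) div n"
  have dN: "d < N" using Q by (simp add: in_below_iff d_def)
  have e1: "n * e \<le> d + n * M" by (simp add: e_def)
  have e2: "d + n * M < n * (e + 1)"
    using n dividend_less_times_div[of n "d + n * M"] by (simp add: e_def algebra_simps)
  have h1: "?q powi (- int h) \<le> 1"
  proof -
    have "?q powi (- int h) \<le> ?q powi 0" unfolding card_powi_le_iff by simp
    thus ?thesis by simp
  qed
  have degP: "P i \<in> below (Suc (d + n * M))" if i: "i \<le> n" for i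
  proof -
    have ge1: "1 \<le> ?q ^ (d + n * M)" using q by (simp add: one_le_power)
    have "laurent_abs (poly_T Q * \<xi> ^ i) \<le> ?q ^ d * (?q ^ M) ^ i"
      unfolding laurent_abs_mult laurent_abs_power using Q
      by (intro mult_mono power_mono M) (auto simp: laurent_abs_poly_T d_def)
    also have "\<dots> = ?q ^ (d + M * i)" by (simp add: power_add power_mult)
    also have "\<dots> \<le> ?q ^ (d + n * M)" using q i by (intro power_increasing) (auto simp: mult.commute)
    finally have "laurent_abs (poly_T Q * \<xi> ^ i) \<le> ?q ^ (d + n * M)" .
    moreover have "laurent_abs (poly_T Q * \<xi> ^ i - poly_T (P i)) \<le> ?q ^ (d + n * M)"
      using P[OF i] h1 ge1 by linarith
    ultimately have "laurent_abs (poly_T (P i)) \<le> ?q powi int (d + n * M)"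
      using laurent_abs_diff_le[of "poly_T Q * \<xi> ^ i" _ "poly_T Q * \<xi> ^ i - poly_T (P i)"]
      by (simp del: of_nat_add of_nat_mult)
    thus ?thesis by (subst (asm) laurent_abs_poly_T_le_iff) (auto simp: below_degree simp del: of_nat_add of_nat_mult)
  qed
  define \<phi> where "\<phi> R = (\<Sum>i\<le>n. coeff R i * P i)" for R :: "'a poly poly"
  have coeffR: "coeff R i \<in> below (Suc e)" if "R \<in> bounded_polys n e" for R :: "'a poly poly" and i
    using that by (auto simp: bounded_polys_def)
  have "\<phi> ` bounded_polys n e \<subseteq> below (Suc (e + (d + n * M)))"
  proof safe
    fix R :: "'a poly poly" assume R: "R \<in> bounded_polys n e"
    have "degree (coeff R i * P i) \<le> e + (d + n * M)" if "i \<le> n" for i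
      using degree_mult_le[of "coeff R i" "P i"] coeffR[OF R, of i] degP[OF that]
      unfolding below_degree by linarith
    thus "\<phi> R \<in> below (Suc (e + (d + n * M)))"
      unfolding \<phi>_def below_degree by (intro degree_sum_le) auto
  qed
  hence "card (\<phi> ` bounded_polys n e) \<le> CARD('a) ^ Suc (e + (d + n * M))"
    using card_mono[of "below (Suc (e + (d + n * M))) :: 'a poly set" "\<phi> ` bounded_polys n e"]
    by (simp add: card_below)
  also have "\<dots> < CARD('a) ^ (Suc e * Suc n)"
    using q e2 by (intro power_strict_increasing) (auto simp: algebra_simps)
  also have "\<dots> = card (bounded_polys n e :: 'a poly poly set)" by (rule card_bounded_polys[symmetric])
  finally have "\<not> inj_on \<phi> (bounded_polys n e)" by (rule pigeonhole)
  then obtain R1 R2 where R12: "R1 \<in> bounded_polys n e" "R2 \<in> bounded_polys n e" "R1 \<noteq> R2" "\<phi> R1 = \<phi> R2"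
    by (auto simp: inj_on_def)
  define R where "R = R1 - R2"
  have R: "R \<in> bounded_polys n e"
    using R12(1,2) by (auto simp: R_def bounded_polys_def below_def image_subset_iff)
  have \<phi>R: "(\<Sum>i\<le>n. coeff R i * P i) = 0"
    using R12(4) by (simp add: R_def \<phi>_def left_diff_distrib sum_subtractf)
  have degR: "degree R \<le> n" using R by (simp add: bounded_polys_iff)
  have "poly_T Q * eval_X R \<xi> = (\<Sum>i\<le>n. poly_T (coeff R i) * (poly_T Q * \<xi> ^ i - poly_T (P i)))
      + poly_T (\<Sum>i\<le>n. coeff R i * P i)"
    by (subst eval_X_sum_le[OF degR])
      (simp add: poly_T_sum poly_T_mult sum_distrib_left sum_subtractf right_diff_distrib mult_ac)
  also have "laurent_abs \<dots> < ?q ^ e * ?q powi (- int h)"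
    unfolding \<phi>R poly_T_0 add_0_right
  proof (rule laurent_abs_sum_less)
    fix i assume "i \<in> {..n}"
    hence "laurent_abs (poly_T Q * \<xi> ^ i - poly_T (P i)) < ?q powi (- int h)" by (intro P) simp
    moreover have "laurent_abs (poly_T (coeff R i)) \<le> ?q ^ e"
      by (rule laurent_abs_poly_T_below[OF coeffR[OF R]])
    ultimately show "laurent_abs (poly_T (coeff R i) * (poly_T Q * \<xi> ^ i - poly_T (P i))) < ?q ^ e * ?q powi (- int h)"
      unfolding laurent_abs_mult using q
      by (intro le_less_trans[OF mult_right_mono mult_strict_left_mono]) auto
  qed (use q in auto)
  finally have "?q ^ d * laurent_abs (eval_X R \<xi>) < ?q ^ e * ?q powi (- int h)"
    using Q by (simp add: laurent_abs_mult laurent_abs_poly_T d_def)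
  hence "laurent_abs (eval_X R \<xi>) < ?q powi (int e - int h - int d)"
    using q by (simp add: power_int_diff power_int_minus power_int_add field_simps)
  thus thesis using that[of R e d] R dN e1 e2 R12(3) by (simp add: R_def)
qed

lemma finite_bounded_height:
  "finite {P :: 'a::{finite,field} poly poly. degree P \<le> n \<and> height P \<le> c}"
proof -
  obtain k :: nat where "c < real CARD('a) ^ k" using real_arch_pow card_field_gt_1 by blast
  hence "{P :: 'a poly poly. degree P \<le> n \<and> height P \<le> c} \<subseteq> bounded_polys n k"
    by (auto simp: bounded_polys_iff)
  thus ?thesis by (rule finite_subset) simp
qed

text \<open>Otherwise polynomials \<open>R\<close> of height at most \<open>q ^ e\<close> satisfy
  |R(\<xi>)| < q^(-g - n e + C). Since \<open>e\<close> is at most about \<open>(k - 1) * g\<close>,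
  the gain \<open>g\<close> is at least about \<open>e / (k - 1)\<close>, which lifts the exponent
  strictly above \<open>n\<close>.\<close>

lemma not_dual_approx_of_w_le:
  fixes \<xi> :: "'a::{finite,field} fls"
  assumes n: "1 \<le> n" and nalg: "\<not> (alg_series \<xi> \<and> alg_degree \<xi> \<le> n)"
    and w: "w n \<xi> \<le> ereal (real n)" and k: "2 \<le> k"
  shows "\<exists>\<^sub>\<infinity>g. \<not> dual_approx n (n * (k - 1) * g) (k * g) \<xi>"
proof (rule ccontr)
  let ?q = "real CARD('a)"
  have q: "1 < ?q" by (rule card_field_gt_1)
  assume "\<not> (\<exists>\<^sub>\<infinity>g. \<not> dual_approx n (n * (k - 1) * g) (k * g) \<xi>)"
  then obtain G where G: "\<And>g. g > G \<Longrightarrow> dual_approx n (n * (k - 1) * g) (k * g) \<xi>"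
    unfolding INFM_nat by blast
  obtain M where M: "laurent_abs \<xi> \<le> ?q ^ M" using ex_laurent_abs_le_power .
  \<comment> \<open>Half of the available gain \<open>1 / (k - 1)\<close>; the other half absorbs
    the constants.\<close>
  define \<eta> where "\<eta> = 1 / (2 * real (k - 1))"
  have \<eta>: "0 < \<eta>" using k by (simp add: \<eta>_def)
  define r where "r = real n + \<eta>"
  define S where "S = {P :: 'a poly poly. degree P \<le> n \<and>
       0 < laurent_abs (eval_X P \<xi>) \<and> laurent_abs (eval_X P \<xi>) < height P powr (- r)}"
  define C where "C = (n + 1) * M"
  have "\<exists>P\<in>S. laurent_abs (eval_X P \<xi>) < (1/2) ^ j" for j
  proof -
    \<comment> \<open>The terms in \<open>C\<close> and \<open>M\<close> make \<open>g / 2\<close>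
      outweigh the constants; \<open>j\<close> drives the values at \<xi> to 0.\<close>
    define g where "g = G + j + 4 * C + 2 * M + 1"
    obtain R e d where R: "R \<noteq> 0" "R \<in> bounded_polys n e" "d < n * (k - 1) * g" "n * e \<le> d + n * M"
      "d + n * M < n * (e + 1)" and small: "laurent_abs (eval_X R \<xi>) < ?q powi (int e - int (k * g) - int d)"
      using small_polynomial_of_dual_approx[OF G n M, of g] by (auto simp: g_def)
    have deg: "degree R \<le> n" and ht: "height R \<le> ?q ^ e" using R(2) by (auto simp: bounded_polys_iff)
    have nz: "eval_X R \<xi> \<noteq> 0" by (rule eval_X_nonzero_of_not_algebraic[OF nalg R(1) deg])
    have "n * e < n * ((k - 1) * g + M)" using R(3,4) by (simp add: algebra_simps)
    hence e: "e < (k - 1) * g + M" by simp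
    have kg: "k * g = (k - 1) * g + g" using k by (cases k) auto
    have "int n * int e \<le> int d + int n * int M" using R(4) by (metis of_nat_add of_nat_le_iff of_nat_mult)
    moreover have "int e < int (k * g) - int g + int M" using e unfolding kg by linarith
    ultimately have exp: "int e - int (k * g) - int d \<le> - (int g + int n * int e - int C)"
      by (simp add: C_def algebra_simps)
    hence "?q powi (int e - int (k * g) - int d) \<le> ?q powi (- (int g + int n * int e - int C))"
      by (simp only: card_powi_le_iff)
    hence sm: "laurent_abs (eval_X R \<xi>) < ?q powi (- (int g + int n * int e - int C))"
      by (rule order.strict_trans2[OF small])
    have "?q powi (- (int g + int n * int e - int C)) \<le> (1/2) ^ j"
      by (rule card_powi_le_half_power) (simp add: g_def)
    hence 1: "laurent_abs (eval_X R \<xi>) < (1/2) ^ j" using sm by simp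
    have "?q powi (- (int g + int n * int e - int C)) = ?q powr (- (real g + real n * real e - real C))"
      by (simp flip: card_powr_conv_powi)
    also have "\<dots> \<le> ?q powr (real e * (- r))"
    proof (rule powr_mono)
      have "real e \<le> real (k - 1) * real g + real M"
        using e by (metis less_imp_le of_nat_add of_nat_le_iff of_nat_mult)
      hence "\<eta> * real e \<le> \<eta> * (real (k - 1) * real g + real M)" using \<eta> by (intro mult_left_mono) auto
      also have "\<dots> = real g / 2 + \<eta> * real M" using k by (simp add: \<eta>_def field_simps)
      also have "\<eta> * real M \<le> 1 * real M" using k by (intro mult_right_mono) (auto simp: \<eta>_def)
      finally have "\<eta> * real e \<le> real g / 2 + real M" by simp
      moreover have "real g / 2 \<ge> 2 * real C + real M" by (simp add: g_def)
      ultimately show "- (real g + real n * real e - real C) \<le> real e * (- r)"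
        by (simp add: r_def algebra_simps)
    qed (use q in auto)
    also have "\<dots> = (?q ^ e) powr (- r)" using q by (simp only: powr_powr powr_realpow[symmetric])
    also have "\<dots> \<le> height R powr (- r)"
      using ht height_ge_1[OF R(1)] \<eta> by (intro powr_mono2') (auto simp: r_def)
    finally have "laurent_abs (eval_X R \<xi>) < height R powr (- r)" using sm by simp
    hence "R \<in> S" using deg nz by (simp add: S_def)
    thus ?thesis using 1 by blast
  qed
  hence "infinite S"
    by (intro infinite_of_arbitrarily_small[of S "\<lambda>P. laurent_abs (eval_X P \<xi>)"]) (auto simp: S_def)
  hence "ereal r \<le> w n \<xi>" unfolding w_def S_def by (intro SUP_upper) auto
  hence "ereal r \<le> ereal (real n)" using w by (rule order_trans)
  thus False using \<eta> by (simp add: r_def)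
qed

text \<open>An \<alpha> close to \<xi> makes its minimal polynomial small at \<xi>: the value is at
  most \<open>height P * C ^ (n - 1)\<close> times the distance. Finitely many \<alpha> share a
  polynomial, so infinitely many polynomials arise.\<close>

lemma w_star_le:
  fixes \<xi> :: "'a::{finite,field} fls"
  assumes n: "1 \<le> n" and nalg: "\<not> (alg_series \<xi> \<and> alg_degree \<xi> \<le> n)"
    and w: "w n \<xi> \<le> ereal (real n)"
  shows "w_star n \<xi> \<le> ereal (real n)"
  unfolding w_star_def
proof (rule SUP_least, rule ccontr)
  let ?q = "real CARD('a)"
  fix r :: real
  define A where "A = {\<alpha> :: 'a fls. alg_series \<alpha> \<and> alg_degree \<alpha> \<le> n \<and>
       0 < laurent_abs (\<xi> - \<alpha>) \<and> laurent_abs (\<xi> - \<alpha>) < alg_height \<alpha> powr (- r - 1)}"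
  assume "r \<in> {r. infinite {\<alpha> :: 'a fls. alg_series \<alpha> \<and> alg_degree \<alpha> \<le> n \<and>
       0 < laurent_abs (\<xi> - \<alpha>) \<and> laurent_abs (\<xi> - \<alpha>) < alg_height \<alpha> powr (- r - 1)}}"
  hence inf: "infinite A" by (simp add: A_def)
  assume "\<not> ereal r \<le> ereal (real n)"
  hence r: "real n < r" by simp
  define r' where "r' = (real n + r) / 2"
  define C where "C = max 1 (laurent_abs \<xi>)"
  \<comment> \<open>Beyond this height the factor \<open>C ^ (n - 1)\<close> costs no more than the
    passage from \<open>r\<close> to \<open>r'\<close>, which still exceeds
    \<open>n\<close>.\<close>
  define H0 where "H0 = (C ^ (n - 1)) powr (1 / (r - r'))"
  have rr: "0 < r - r'" "real n < r'" using r by (auto simp: r'_def field_simps)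
  have "infinite (min_def_poly ` A)"
  proof
    assume fin: "finite (min_def_poly ` A)"
    have "finite (\<Union>P\<in>min_def_poly ` A. {x. eval_X P x = 0})"
    proof (intro finite_UN_I fin)
      fix P assume "P \<in> min_def_poly ` A"
      hence "irreducible P" using min_def_poly by (auto simp: A_def)
      thus "finite {x. eval_X P x = 0}" by (intro finite_roots_eval_X) auto
    qed
    moreover have "A \<subseteq> (\<Union>P\<in>min_def_poly ` A. {x. eval_X P x = 0})"
      using min_def_poly(2) by (auto simp: A_def)
    ultimately show False using inf finite_subset by blast
  qed
  moreover have "min_def_poly ` A \<subseteq> {P. degree P \<le> n \<and> height P \<le> H0} \<union>
    {P. degree P \<le> n \<and> 0 < laurent_abs (eval_X P \<xi>) \<and> laurent_abs (eval_X P \<xi>) < height P powr (- r')}"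
    (is "_ \<subseteq> _ \<union> ?S")
  proof
    fix P assume "P \<in> min_def_poly ` A"
    then obtain \<alpha> where \<alpha>: "\<alpha> \<in> A" "P = min_def_poly \<alpha>" by blast
    have alg: "alg_series \<alpha>" using \<alpha> by (simp add: A_def)
    have irr: "irreducible P" and root: "eval_X P \<alpha> = 0" using min_def_poly[OF alg] \<alpha>(2) by auto
    have P0: "P \<noteq> 0" using irr by auto
    have deg: "degree P \<le> n" using \<alpha> by (simp add: A_def alg_degree_def)
    have H1: "1 \<le> height P" by (rule height_ge_1[OF P0])
    have close: "laurent_abs (\<xi> - \<alpha>) < height P powr (- r - 1)"
      using \<alpha> by (simp add: A_def alg_height_def)
    show "P \<in> {P. degree P \<le> n \<and> height P \<le> H0} \<union> ?S"
    proof (cases "height P \<le> H0")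
      case False
      have "height P powr (- r - 1) \<le> height P powr 0" using H1 r by (intro powr_mono) auto
      hence "laurent_abs (\<xi> - \<alpha>) \<le> 1" using close H1 by simp
      hence absa: "laurent_abs \<alpha> \<le> C"
        using laurent_abs_diff_le[of \<xi> C "\<xi> - \<alpha>"] by (simp add: C_def)
      have "laurent_abs (eval_X P \<xi> - eval_X P \<alpha>) \<le> height P * C ^ (n - 1) * laurent_abs (\<xi> - \<alpha>)"
        unfolding eval_X_def
      proof (rule laurent_abs_poly_diff)
        show "degree (map_poly poly_T P) \<le> n" using degree_map_poly_le deg order_trans by blast
      qed (use absa laurent_abs_coeff_le_height in \<open>auto simp: C_def coeff_map_poly\<close>)
      also have "\<dots> < height P * C ^ (n - 1) * height P powr (- r - 1)"
        using close H1 by (intro mult_strict_left_mono mult_pos_pos) (auto simp: C_def)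
      also have "\<dots> = C ^ (n - 1) * height P powr (- r)"
        using H1 by (simp add: powr_diff powr_minus field_simps)
      also have "\<dots> \<le> height P powr (r - r') * height P powr (- r)"
      proof (rule mult_right_mono)
        have "C ^ (n - 1) = H0 powr (r - r')" using rr by (simp add: H0_def powr_powr C_def)
        also have "\<dots> \<le> height P powr (r - r')" using False rr by (intro powr_mono2) (auto simp: H0_def)
        finally show "C ^ (n - 1) \<le> height P powr (r - r')" .
      qed auto
      also have "\<dots> = height P powr (- r')" by (simp flip: powr_add)
      finally have "laurent_abs (eval_X P \<xi>) < height P powr (- r')" using root by simp
      moreover have "eval_X P \<xi> \<noteq> 0" by (rule eval_X_nonzero_of_not_algebraic[OF nalg P0 deg])
      ultimately show ?thesis using deg by simp
    qed (use deg in simp)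
  qed
  ultimately have "infinite ?S"
    using finite_bounded_height[of n H0, where 'a='a] by (meson finite_Un finite_subset)
  hence "ereal r' \<le> w n \<xi>" unfolding w_def by (intro SUP_upper) auto
  hence "ereal r' \<le> ereal (real n)" using w by (rule order_trans)
  thus False using rr by simp
qed

theorem w_star_eq_of_w_eq:
  fixes \<xi> :: "'a::{finite,field} fls"
  assumes "1 \<le> n" "\<not> (alg_series \<xi> \<and> alg_degree \<xi> \<le> n)" "w n \<xi> = ereal (real n)"
  shows "w_star n \<xi> = ereal (real n)"
  using w_star_le[OF assms(1,2)] w_star_ge[OF assms(1,2)] not_dual_approx_of_w_le[OF assms(1,2)] assms(3)
  by (intro antisym) auto

section \<open>Haar measure of balls\<close>

lemma haar_sets: "haar_measure \<mu> \<Longrightarrow> sets \<mu> = sets borel"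
  by (simp add: haar_measure_def)

lemma haar_open: "haar_measure \<mu> \<Longrightarrow> open U \<Longrightarrow> U \<in> sets \<mu>"
  by (simp add: haar_sets)

lemma lball_translate: "lball x k = (\<lambda>y. x + y) ` lball 0 k"
proof
  show "lball x k \<subseteq> (\<lambda>y. x + y) ` lball 0 k"
  proof
    fix z assume "z \<in> lball x k"
    hence "z = x + (z - x)" "z - x \<in> lball 0 k" by (simp_all add: lball_def)
    thus "z \<in> (\<lambda>y. x + y) ` lball 0 k" by (rule image_eqI)
  qed
qed (auto simp: lball_def)

text \<open>The Haar measure is not normalised, so all bounds carry this factor.\<close>

definition unit_mass :: "'a::{finite,field} fls measure \<Rightarrow> real" where
  "unit_mass \<mu> = measure \<mu> (lball 0 0)"

lemma unit_mass_nonneg [simp]: "0 \<le> unit_mass \<mu>"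
  by (simp add: unit_mass_def)

text \<open>By translation invariance the \<open>q\<close> subballs of a ball have equal mass;
  iterate in both directions from the unit ball.\<close>

lemma emeasure_lball:
  fixes \<mu> :: "'a::{finite,field} fls measure"
  assumes \<mu>: "haar_measure \<mu>"
  shows "emeasure \<mu> (lball x k) = ennreal (unit_mass \<mu> * real CARD('a) powi (- k))"
proof -
  let ?q = "real CARD('a)"
  have q: "1 < ?q" by (rule card_field_gt_1)
  have sets: "lball x k \<in> sets \<mu>" for x :: "'a fls" and k
    by (rule haar_open[OF \<mu> open_lball])
  have shift: "emeasure \<mu> (lball x k) = emeasure \<mu> (lball 0 k)" for x :: "'a fls" and k
    unfolding lball_translate[of x] using \<mu> sets[of 0 k] unfolding haar_measure_def by blast
  have fin: "emeasure \<mu> (lball 0 k) < \<infinity>" for k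
    using \<mu> compact_lball[of "0 :: 'a fls" k] unfolding haar_measure_def by blast
  define m where "m k = measure \<mu> (lball 0 k)" for k
  have m: "emeasure \<mu> (lball 0 k) = ennreal (m k)" for k
    unfolding m_def using fin[of k] by (intro emeasure_eq_ennreal_measure) auto
  have step: "m k = ?q * m (k + 1)" for k
  proof -
    let ?B = "\<lambda>c. lball (0 + fls_shift (- k) (fls_const c)) (k + 1) :: 'a fls set"
    have "emeasure \<mu> (lball 0 k) = emeasure \<mu> (\<Union>c. ?B c)"
      using lball_split(1)[of "0 :: 'a fls" k] by simp
    also have "\<dots> = (\<Sum>c\<in>UNIV. emeasure \<mu> (?B c))"
    proof (rule sum_emeasure[symmetric])
      show "disjoint_family ?B"
        unfolding disjoint_family_on_def using lball_split(2)[of _ _ "0 :: 'a fls" k] by blast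
    qed (use sets in auto)
    also have "\<dots> = (\<Sum>c\<in>(UNIV :: 'a set). ennreal (m (k + 1)))"
      by (intro sum.cong refl trans[OF shift m])
    also have "\<dots> = ennreal (?q * m (k + 1))"
      by (simp add: ennreal_mult m_def ennreal_of_nat_eq_real_of_nat)
    finally show ?thesis using q by (simp add: m m_def)
  qed
  have "m k = m 0 * ?q powi (- k)"
  proof (induction k rule: int_induct[of _ 0])
    case (step1 i)
    have "m (i + 1) = m i / ?q" using step[of i] q by simp
    also have "\<dots> = m 0 * ?q powi (- (i + 1))" using step1 q by (simp add: power_int_diff)
    finally show ?case .
  next
    case (step2 i)
    have "m (i - 1) = ?q * m i" using step[of "i - 1"] by simp
    also have "\<dots> = m 0 * ?q powi (- (i - 1))" using step2 q by (simp add: power_int_diff power_int_minus field_simps)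
    finally show ?case .
  qed simp
  thus ?thesis using shift[of x k] m[of k] by (simp add: unit_mass_def m_def)
qed

lemma emeasure_UN_lball_le:
  fixes \<mu> :: "'a::{finite,field} fls measure"
  assumes \<mu>: "haar_measure \<mu>" and X: "finite X" "card X \<le> d"
  shows "emeasure \<mu> (\<Union>x\<in>X. lball x k) \<le> ennreal (real d * unit_mass \<mu> * real CARD('a) powi (- k))"
proof -
  let ?c = "unit_mass \<mu> * real CARD('a) powi (- k)"
  have c: "0 \<le> ?c" by simp
  have "emeasure \<mu> (\<Union>x\<in>X. lball x k) \<le> (\<Sum>x\<in>X. emeasure \<mu> (lball x k))"
    using X by (intro emeasure_subadditive_finite) (auto intro: haar_open[OF \<mu> open_lball])
  also have "\<dots> = (\<Sum>x\<in>X. ennreal ?c)" by (simp only: emeasure_lball[OF \<mu>])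
  also have "\<dots> = ennreal (real (card X) * ?c)"
    using c by (simp add: ennreal_mult ennreal_of_nat_eq_real_of_nat)
  also have "\<dots> \<le> ennreal (real d * ?c)"
    using X(2) c by (intro ennreal_leI mult_right_mono) auto
  finally show ?thesis by (simp add: mult.assoc)
qed

text \<open>As \<open>lev\<close> is constant on the ball attached to a point, these balls partition
  \<open>D\<close>: two of them are equal or disjoint. Hence local bounds of relative size
  \<open>a\<close> add up to a global one without the overlap constant of Euclidean covering
  theorems.\<close>

lemma lball_patching:
  fixes \<mu> :: "'a::{finite,field} fls measure" and D :: "'a fls set" and lev :: "'a fls \<Rightarrow> nat"
  assumes \<mu>: "haar_measure \<mu>" and D: "D \<subseteq> lball x k"
    and lev: "\<And>y z. y \<in> D \<Longrightarrow> z \<in> lball y (k + int (lev y)) \<Longrightarrow> z \<in> D \<and> lev z = lev y"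
    and a: "0 \<le> a"
    and W: "\<And>y. y \<in> D \<Longrightarrow> open (W y)"
      "\<And>y. y \<in> D \<Longrightarrow> emeasure \<mu> (W y) \<le> ennreal (a * unit_mass \<mu> * real CARD('a) powi (- (k + int (lev y))))"
  shows "\<exists>U. open U \<and> emeasure \<mu> U \<le> ennreal (a * unit_mass \<mu> * real CARD('a) powi (- k)) \<and>
    (\<forall>z\<in>D - U. \<exists>y\<in>D. z \<in> lball y (k + int (lev y)) - W y)"
proof -
  define DD where "DD j = {y\<in>D. lev y = j}" for j
  define BB where "BB j = (\<lambda>y. lball y (k + int j)) ` DD j" for j
  have in_DD: "z \<in> DD j" if "y \<in> DD j" "z \<in> lball y (k + int j)" for y z j
    using that lev[of y z] by (auto simp: DD_def)
  have UnBB: "\<Union>(BB j) = DD j" for j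
  proof
    show "\<Union>(BB j) \<subseteq> DD j" unfolding BB_def using in_DD by blast
    show "DD j \<subseteq> \<Union>(BB j)"
    proof
      fix y assume "y \<in> DD j"
      thus "y \<in> \<Union>(BB j)" unfolding BB_def by (intro UnionI[of "lball y (k + int j)"]) auto
    qed
  qed
  have finBB: "finite (BB j)" for j
  proof -
    obtain Y where Y: "finite Y" "lball x k = (\<Union>y\<in>Y. lball y (k + int j))"
      using lball_finite_cover[of x k j] by (elim exE conjE)
    have "BB j \<subseteq> (\<lambda>y. lball y (k + int j)) ` Y"
    proof
      fix b assume "b \<in> BB j"
      then obtain y where y: "y \<in> DD j" "b = lball y (k + int j)" by (auto simp: BB_def)
      hence "y \<in> lball x k" using D by (auto simp: DD_def)
      then obtain y' where y': "y' \<in> Y" "y \<in> lball y' (k + int j)" unfolding Y(2) by (elim UN_E)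
      thus "b \<in> (\<lambda>y. lball y (k + int j)) ` Y" using y(2) lball_eq[OF y'(2)] by (intro image_eqI) auto
    qed
    thus ?thesis using Y(1) finite_subset by blast
  qed
  \<comment> \<open>\<open>W\<close> depends on the centre, so one centre per ball is chosen and
    only its set enters the union.\<close>
  define rep where "rep j b = (SOME y. y \<in> DD j \<and> b = lball y (k + int j))" for j b
  have rep: "rep j b \<in> DD j" "b = lball (rep j b) (k + int j)" if b: "b \<in> BB j" for j b
  proof -
    have "\<exists>y. y \<in> DD j \<and> b = lball y (k + int j)" using b by (auto simp: BB_def)
    from someI_ex[OF this] show "rep j b \<in> DD j" "b = lball (rep j b) (k + int j)"
      unfolding rep_def by blast+
  qed
  have open_b: "open b" if "b \<in> BB j" for b j
    using that by (auto simp: BB_def open_lball)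
  define UU where "UU j = (\<Union>b\<in>BB j. W (rep j b))" for j
  have WB: "open (W (rep j b))" if "b \<in> BB j" for j b
    using W(1) rep(1)[OF that] by (auto simp: DD_def)
  have open_UU: "open (UU j)" for j unfolding UU_def using WB by blast
  have meas_DD: "DD j \<in> sets \<mu>" for j
  proof -
    have "open (\<Union>(BB j))" using open_b by blast
    thus ?thesis unfolding UnBB by (rule haar_open[OF \<mu>])
  qed
  have UU_le: "emeasure \<mu> (UU j) \<le> ennreal a * emeasure \<mu> (DD j)" for j
  proof -
    have "emeasure \<mu> (UU j) \<le> (\<Sum>b\<in>BB j. emeasure \<mu> (W (rep j b)))"
      unfolding UU_def using finBB WB
      by (intro emeasure_subadditive_finite) (auto intro: haar_open[OF \<mu>])
    also have "\<dots> \<le> (\<Sum>b\<in>BB j. ennreal a * emeasure \<mu> b)"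
    proof (rule sum_mono)
      fix b assume b: "b \<in> BB j"
      have "rep j b \<in> D" "lev (rep j b) = j" using rep(1)[OF b] by (auto simp: DD_def)
      hence "emeasure \<mu> (W (rep j b)) \<le> ennreal (a * unit_mass \<mu> * real CARD('a) powi (- (k + int j)))"
        using W(2)[of "rep j b"] by simp
      also have "\<dots> = ennreal a * emeasure \<mu> (lball (rep j b) (k + int j))"
        unfolding emeasure_lball[OF \<mu>] using a by (simp add: ennreal_mult mult.assoc)
      also have "lball (rep j b) (k + int j) = b" using rep(2)[OF b] by simp
      finally show "emeasure \<mu> (W (rep j b)) \<le> ennreal a * emeasure \<mu> b" .
    qed
    also have "\<dots> = ennreal a * (\<Sum>b\<in>BB j. emeasure \<mu> b)" by (simp add: sum_distrib_left)
    also have "(\<Sum>b\<in>BB j. emeasure \<mu> b) = emeasure \<mu> (\<Union>(BB j))"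
    proof -
      have "disjoint_family_on (\<lambda>b. b) (BB j)"
        unfolding disjoint_family_on_def
      proof (intro ballI impI)
        fix b c assume bc: "b \<in> BB j" "c \<in> BB j" "b \<noteq> c"
        show "b \<inter> c = {}"
        proof (rule ccontr)
          assume "b \<inter> c \<noteq> {}"
          then obtain z where z: "z \<in> b" "z \<in> c" by auto
          have "lball z (k + int j) = b" using lball_eq[of z "rep j b"] rep(2)[OF bc(1)] z(1) by simp
          moreover have "lball z (k + int j) = c" using lball_eq[of z "rep j c"] rep(2)[OF bc(2)] z(2) by simp
          ultimately show False using bc(3) by simp
        qed
      qed
      moreover have "BB j \<subseteq> sets \<mu>" using open_b haar_open[OF \<mu>] by blast
      ultimately show ?thesis using sum_emeasure[of "\<lambda>b. b" "BB j" \<mu>] finBB by simp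
    qed
    finally show ?thesis unfolding UnBB .
  qed
  have "emeasure \<mu> (\<Union>j. UU j) \<le> (\<Sum>j. emeasure \<mu> (UU j))"
    using open_UU by (intro emeasure_subadditive_countably) (auto intro: haar_open[OF \<mu>])
  also have "\<dots> \<le> (\<Sum>j. ennreal a * emeasure \<mu> (DD j))"
    by (intro suminf_le UU_le) auto
  also have "\<dots> = ennreal a * (\<Sum>j. emeasure \<mu> (DD j))" by simp
  also have "(\<Sum>j. emeasure \<mu> (DD j)) = emeasure \<mu> (\<Union>j. DD j)"
    using meas_DD by (intro suminf_emeasure) (auto simp: disjoint_family_on_def DD_def)
  also have "\<dots> \<le> emeasure \<mu> (lball x k)"
    using D by (intro emeasure_mono haar_open[OF \<mu> open_lball]) (auto simp: DD_def)
  finally have le: "emeasure \<mu> (\<Union>j. UU j) \<le> ennreal a * emeasure \<mu> (lball x k)"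
    by (simp add: mult_left_mono)
  show ?thesis
  proof (intro exI[of _ "\<Union>j. UU j"] conjI ballI)
    show "open (\<Union>j. UU j)" using open_UU by blast
    show "emeasure \<mu> (\<Union>j. UU j) \<le> ennreal (a * unit_mass \<mu> * real CARD('a) powi (- k))"
      using le a unfolding emeasure_lball[OF \<mu>] by (simp add: ennreal_mult mult.assoc)
    fix z assume z: "z \<in> D - (\<Union>j. UU j)"
    define j where "j = lev z"
    have zD: "z \<in> DD j" using z by (simp add: DD_def j_def)
    define b where "b = lball z (k + int j)"
    have b: "b \<in> BB j" using zD by (auto simp: BB_def b_def)
    have "z \<notin> W (rep j b)" using z b by (auto simp: UU_def)
    moreover have "z \<in> lball (rep j b) (k + int j)" using rep(2)[OF b] mem_lball_self[of z "k + int j"] by (simp add: b_def)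
    moreover have "rep j b \<in> D" "lev (rep j b) = j" using rep(1)[OF b] by (auto simp: DD_def)
    ultimately show "\<exists>y\<in>D. z \<in> lball y (k + int (lev y)) - W y" by (intro bexI[of _ "rep j b"]) auto
  qed
qed

section \<open>Sets where a polynomial is small\<close>

lemma poly_split_at:
  fixes f :: "'b::field poly"
  obtains g where "\<And>y. poly f y = poly f x + (y - x) * poly g y" "degree g \<le> degree f - 1"
    "f = [:poly f x:] + [:- x, 1:] * g"
proof -
  have "poly (f - [:poly f x:]) x = 0" by simp
  then obtain g where g: "f - [:poly f x:] = [:- x, 1:] * g" by (metis dvdE poly_eq_0_iff_dvd)
  hence f: "f = [:poly f x:] + [:- x, 1:] * g" by (simp only: eq_diff_eq add.commute diff_eq_eq)
  have "degree g \<le> degree f - 1"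
  proof (cases "g = 0")
    case False
    have "Suc (degree g) = degree ([:- x, 1:] * g)" using False by (subst degree_mult_eq) auto
    also have "\<dots> = degree (f - [:poly f x:])" using g by simp
    also have "\<dots> \<le> degree f" by (rule degree_diff_le) auto
    finally show ?thesis by simp
  qed simp
  moreover have "poly f y = poly f x + (y - x) * poly g y" for y
    using arg_cong[OF f, of "\<lambda>p. poly p y"] by (simp add: algebra_simps)
  ultimately show thesis using that f by blast
qed

text \<open>Divided differences: if the set where \<open>f\<close> is small is not covered by \<open>degree f\<close> small balls, it contains
  well separated points, and then \<open>f\<close> is small on the whole ball.\<close>

lemma poly_small_set_cover:
  fixes f :: "'a::{finite,field} fls poly"
  assumes "degree f \<le> d" "0 < \<epsilon>" "k \<le> l"
  shows "(\<exists>X. finite X \<and> card X \<le> d \<and> {y\<in>lball x k. laurent_abs (poly f y) < \<epsilon>} \<subseteq> (\<Union>z\<in>X. lball z l))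
    \<or> (\<forall>y\<in>lball x k. laurent_abs (poly f y) < \<epsilon> * (real CARD('a) powi (l - k)) ^ d)"
  using assms
proof (induction d arbitrary: f \<epsilon>)
  case 0
  then obtain c where f: "f = [:c:]" by (auto elim: degree_eq_zeroE)
  show ?case
  proof (cases "laurent_abs c < \<epsilon>")
    case False
    hence "{y\<in>lball x k. laurent_abs (poly f y) < \<epsilon>} = {}" by (simp add: f)
    thus ?thesis by (intro disjI1 exI[of _ "{}"]) simp
  qed (simp add: f)
next
  case (Suc d)
  let ?q = "real CARD('a)"
  have q: "1 < ?q" by (rule card_field_gt_1)
  let ?E = "{y\<in>lball x k. laurent_abs (poly f y) < \<epsilon>}"
  show ?case
  proof (cases "?E = {}")
    case True
    thus ?thesis by (intro disjI1 exI[of _ "{}"]) simp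
  next
    case False
    then obtain x0 where x0: "x0 \<in> lball x k" "laurent_abs (poly f x0) < \<epsilon>" by auto
    obtain g where g: "\<And>y. poly f y = poly f x0 + (y - x0) * poly g y" "degree g \<le> degree f - 1"
      using poly_split_at[of f x0] by blast
    have qk: "0 < ?q powi i" for i using q by simp
    have dist: "laurent_abs (y - x0) \<le> ?q powi (- k)" if "y \<in> lball x k" for y
      using that lball_eq[OF x0(1)] by (auto simp: lball_def)
    \<comment> \<open>Off the small ball around \<open>x0\<close>, division by \<open>y - x0\<close>
      costs at most \<open>q ^ l\<close>; on the large ball, multiplication by it contributes at
      most \<open>q powi (- k)\<close>. Hence one factor \<open>q powi (l - k)\<close> per
      degree.\<close>
    let ?\<epsilon> = "\<epsilon> * ?q powi l"
    have "degree g \<le> d" using g(2) Suc.prems(1) by simp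
    hence "(\<exists>X. finite X \<and> card X \<le> d \<and> {y\<in>lball x k. laurent_abs (poly g y) < ?\<epsilon>} \<subseteq> (\<Union>z\<in>X. lball z l))
      \<or> (\<forall>y\<in>lball x k. laurent_abs (poly g y) < ?\<epsilon> * (?q powi (l - k)) ^ d)"
      by (rule Suc.IH) (use Suc.prems qk in auto)
    thus ?thesis
    proof
      assume "\<exists>X. finite X \<and> card X \<le> d \<and> {y\<in>lball x k. laurent_abs (poly g y) < ?\<epsilon>} \<subseteq> (\<Union>z\<in>X. lball z l)"
      then obtain X where X: "finite X" "card X \<le> d"
        "{y\<in>lball x k. laurent_abs (poly g y) < ?\<epsilon>} \<subseteq> (\<Union>z\<in>X. lball z l)" by (elim exE conjE)
      have "?E \<subseteq> (\<Union>z\<in>insert x0 X. lball z l)"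
      proof
        fix y assume y: "y \<in> ?E"
        show "y \<in> (\<Union>z\<in>insert x0 X. lball z l)"
        proof (cases "y \<in> lball x0 l")
          case False
          hence far: "?q powi (- l) < laurent_abs (y - x0)" by (simp add: lball_def not_le)
          have "laurent_abs ((y - x0) * poly g y) < \<epsilon>"
            using laurent_abs_diff_less[of "poly f y" \<epsilon> "poly f x0"] y x0(2) g(1)[of y] by simp
          hence lt: "laurent_abs (y - x0) * laurent_abs (poly g y) < \<epsilon>" by (simp only: laurent_abs_mult)
          have "?q powi (- l) * laurent_abs (poly g y) \<le> laurent_abs (y - x0) * laurent_abs (poly g y)"
            using far by (intro mult_right_mono) auto
          hence "?q powi (- l) * laurent_abs (poly g y) < \<epsilon>" using lt by linarith
          hence "laurent_abs (poly g y) < ?\<epsilon>" using qk[of l] by (simp add: power_int_minus field_simps)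
          hence "y \<in> (\<Union>z\<in>X. lball z l)" using y by (intro subsetD[OF X(3)]) simp
          thus ?thesis by simp
        qed simp
      qed
      moreover have "card (insert x0 X) \<le> Suc d" using X(1,2) card_insert_le_m1[of "Suc d" X x0] by simp
      ultimately show ?thesis using X(1) by (intro disjI1 exI[of _ "insert x0 X"]) simp
    next
      assume *: "\<forall>y\<in>lball x k. laurent_abs (poly g y) < ?\<epsilon> * (?q powi (l - k)) ^ d"
      have "laurent_abs (poly f y) < \<epsilon> * (?q powi (l - k)) ^ Suc d" if y: "y \<in> lball x k" for y
      proof -
        have pos: "0 < ?\<epsilon> * (?q powi (l - k)) ^ d" using Suc.prems(2) qk by simp
        have "laurent_abs ((y - x0) * poly g y) < ?q powi (- k) * (?\<epsilon> * (?q powi (l - k)) ^ d)"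
          unfolding laurent_abs_mult
          by (rule le_less_trans[OF mult_right_mono[OF dist[OF y]] mult_strict_left_mono]) (use * y qk in auto)
        also have "\<dots> = \<epsilon> * (?q powi (l - k)) ^ Suc d"
          using q by (simp add: power_int_diff power_int_minus field_simps)
        finally have 1: "laurent_abs ((y - x0) * poly g y) < \<epsilon> * (?q powi (l - k)) ^ Suc d" .
        have "1 \<le> (?q powi (l - k)) ^ Suc d" using Suc.prems(3) q by (intro one_le_power one_le_power_int) auto
        hence "\<epsilon> * 1 \<le> \<epsilon> * (?q powi (l - k)) ^ Suc d" using Suc.prems(2) by (intro mult_left_mono) auto
        hence 2: "laurent_abs (poly f x0) < \<epsilon> * (?q powi (l - k)) ^ Suc d" using x0(2) by linarith
        show ?thesis unfolding g(1)[of y] by (rule laurent_abs_add_less[OF 2 1])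
      qed
      thus ?thesis by blast
    qed
  qed
qed

text \<open>Split off one point of \<open>X\<close> at a time. Each division costs the inverse
  separation \<open>R\<close>, and reassembling the coefficients is free because the points lie in
  the unit ball.\<close>

lemma coeff_less_of_small_values:
  fixes f :: "'a::{finite,field} fls poly"
  assumes "degree f \<le> d" "finite X" "d < card X" "0 < \<sigma>" "1 \<le> R"
    and "\<And>x. x \<in> X \<Longrightarrow> laurent_abs x \<le> 1"
    and "\<And>x y. x \<in> X \<Longrightarrow> y \<in> X \<Longrightarrow> x \<noteq> y \<Longrightarrow> 1 \<le> R * laurent_abs (x - y)"
    and "\<And>x. x \<in> X \<Longrightarrow> laurent_abs (poly f x) < \<sigma>"
  shows "laurent_abs (coeff f i) < \<sigma> * R ^ d"
  using assms
proof (induction d arbitrary: f X \<sigma> i)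
  case 0
  then obtain c where f: "f = [:c:]" by (auto elim: degree_eq_zeroE)
  obtain x where "x \<in> X" using 0 by fastforce
  thus ?case using 0(8)[of x] 0(4) by (cases i) (auto simp: f)
next
  case (Suc d)
  obtain x0 where x0: "x0 \<in> X" using Suc.prems(3) by fastforce
  obtain g where g: "\<And>y. poly f y = poly f x0 + (y - x0) * poly g y" "degree g \<le> degree f - 1"
    "f = [:poly f x0:] + [:- x0, 1:] * g" using poly_split_at[of f x0] by blast
  have small_g: "laurent_abs (coeff g i) < (\<sigma> * R) * R ^ d" for i
  proof (rule Suc.IH[of g "X - {x0}"])
    fix x assume x: "x \<in> X - {x0}"
    have "laurent_abs ((x - x0) * poly g x) < \<sigma>"
      using laurent_abs_diff_less[of "poly f x" \<sigma> "poly f x0"] Suc.prems(8)[of x] Suc.prems(8)[OF x0] x g(1)[of x] by simp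
    hence lt: "laurent_abs (x - x0) * laurent_abs (poly g x) < \<sigma>" by (simp only: laurent_abs_mult)
    have "1 * laurent_abs (poly g x) \<le> (R * laurent_abs (x - x0)) * laurent_abs (poly g x)"
      using Suc.prems(7)[of x x0] x x0 by (intro mult_right_mono) auto
    also have "\<dots> = R * (laurent_abs (x - x0) * laurent_abs (poly g x))" by simp
    also have "\<dots> < R * \<sigma>" using lt Suc.prems(5) by (intro mult_strict_left_mono) auto
    finally show "laurent_abs (poly g x) < \<sigma> * R" by (simp add: mult.commute)
  qed (use Suc.prems x0 g(2) in auto)
  have ge: "\<sigma> \<le> \<sigma> * R ^ Suc d"
    using mult_left_mono[OF one_le_power[OF Suc.prems(5), of "Suc d"], of \<sigma>] Suc.prems(4) by simp
  have pos: "0 < \<sigma> * R ^ Suc d" using ge Suc.prems(4) by linarith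
  have 1: "laurent_abs (coeff [:poly f x0:] i) < \<sigma> * R ^ Suc d" for i
    using less_le_trans[OF Suc.prems(8)[OF x0] ge] pos by (cases i) (simp_all del: power_Suc)
  have 2: "laurent_abs (coeff ([:- x0, 1:] * g) i) < \<sigma> * R ^ Suc d" for i
  proof -
    have a: "laurent_abs (coeff (smult (- x0) g) i) < \<sigma> * R ^ Suc d"
    proof -
      have "laurent_abs (coeff (smult (- x0) g) i) \<le> 1 * laurent_abs (coeff g i)"
        unfolding coeff_smult laurent_abs_mult laurent_abs_uminus using Suc.prems(6)[OF x0] by (intro mult_right_mono) auto
      thus ?thesis using small_g[of i] by (simp add: mult_ac)
    qed
    have b: "laurent_abs (coeff (pCons 0 g) i) < \<sigma> * R ^ Suc d"
    proof (cases i)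
      case 0
      thus ?thesis using pos by (simp del: power_Suc)
    next
      case (Suc j)
      thus ?thesis using small_g[of j] by (simp add: mult_ac)
    qed
    have "[:- x0, 1:] * g = smult (- x0) g + pCons 0 g" by simp
    thus ?thesis using laurent_abs_add_less[OF a b] by (simp only: coeff_add)
  qed
  show ?case
    by (subst g(3)) (simp only: coeff_add laurent_abs_add_less[OF 1 2])
qed

text \<open>The test points are the powers of 1/T with exponents 0 to \<open>n\<close>, available
  even if F_q has too few elements. Their distances are at least \<open>q powi (- n)\<close>, whence
  the constant \<open>q ^ (n * n)\<close>.\<close>

lemma coeff_less_of_small_on_unit_ball:
  fixes f :: "'a::{finite,field} fls poly"
  assumes deg: "degree f \<le> n" and \<sigma>: "0 < \<sigma>" and small: "\<And>y. y \<in> lball 0 0 \<Longrightarrow> laurent_abs (poly f y) < \<sigma>"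
  shows "laurent_abs (coeff f i) < \<sigma> * real CARD('a) ^ (n * n)"
proof -
  let ?q = "real CARD('a)"
  have q: "1 < ?q" by (rule card_field_gt_1)
  define X :: "'a fls set" where "X = (\<lambda>i. fls_X ^ i) ` {..n}"
  have abs_X: "laurent_abs (fls_X ^ i :: 'a fls) = ?q powi (- int i)" for i
    by (simp add: laurent_abs_def)
  have diff: "laurent_abs (fls_X ^ i - fls_X ^ j :: 'a fls) = ?q powi (- int i)" if "i < j" for i j :: nat
    using laurent_abs_add_eq[of "- (fls_X ^ j)" "fls_X ^ i :: 'a fls"] that by (simp add: abs_X)
  have sep: "1 \<le> ?q ^ n * laurent_abs (fls_X ^ i - fls_X ^ j :: 'a fls)" if ij: "i \<le> n" "j \<le> n" "i \<noteq> j" for i j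
  proof -
    have *: "1 \<le> ?q ^ n * laurent_abs (fls_X ^ i - fls_X ^ j :: 'a fls)" if "i < j" "i \<le> n" for i j
    proof -
      have "?q ^ n * laurent_abs (fls_X ^ i - fls_X ^ j :: 'a fls) = ?q powi (int n - int i)"
        using diff[OF that(1)] q by (simp add: power_int_diff power_int_minus field_simps)
      also have "\<dots> \<ge> ?q powi 0" using that(2) unfolding card_powi_le_iff by simp
      finally show ?thesis by simp
    qed
    show ?thesis using *[of i j] *[of j i] ij by (cases "i < j") (auto simp: laurent_abs_diff_commute)
  qed
  have inj: "inj_on (\<lambda>i. fls_X ^ i :: 'a fls) {..n}"
    by (rule inj_onI) (metis abs_X diff sep atMost_iff diff_self laurent_abs_0 mult_zero_right not_one_le_zero)
  have "laurent_abs (coeff f i) < \<sigma> * (?q ^ n) ^ n"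
  proof (rule coeff_less_of_small_values[OF deg, of X])
    show "n < card X" unfolding X_def using inj by (simp add: card_image)
    show le1: "laurent_abs x \<le> 1" if x: "x \<in> X" for x
    proof -
      obtain i :: nat where "x = fls_X ^ i" using x unfolding X_def by blast
      moreover have "?q powi (- int i) \<le> ?q powi 0" unfolding card_powi_le_iff by simp
      ultimately show ?thesis by (simp add: abs_X)
    qed
    show "laurent_abs (poly f x) < \<sigma>" if "x \<in> X" for x
      using le1[OF that] by (intro small) (simp add: lball_def)
  qed (use \<sigma> q sep in \<open>auto simp: X_def one_le_power\<close>)
  thus ?thesis by (simp add: power_mult)
qed

text \<open>Induction on the degree: the difference quotient is bounded near \<open>y\<close>, and
  the factor \<open>z - y\<close> tends to 0.\<close>

lemma poly_locally_small:
  fixes f :: "'a::{finite,field} fls poly"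
  assumes "laurent_abs (poly f y) < c"
  shows "eventually (\<lambda>l::nat. \<forall>z\<in>lball y (int l). laurent_abs (poly f z) < c) sequentially"
  using assms
proof (induction "degree f" arbitrary: f c rule: less_induct)
  case less
  have c: "0 < c" using less.prems laurent_abs_nonneg le_less_trans by blast
  obtain g where g: "\<And>z. poly f z = poly f y + (z - y) * poly g z" "degree g \<le> degree f - 1"
    using poly_split_at[of f y] by blast
  show ?case
  proof (cases "degree f = 0")
    case True
    then obtain a where "f = [:a:]" by (elim degree_eq_zeroE)
    thus ?thesis using less.prems by simp
  next
    case False
    define b where "b = laurent_abs (poly g y) + 1"
    have b: "0 < b" "laurent_abs (poly g y) < b"
      unfolding b_def by (rule add_nonneg_pos) auto
    have "eventually (\<lambda>l::nat. \<forall>z\<in>lball y (int l). laurent_abs (poly g z) < b) sequentially"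
      by (rule less.hyps) (use False g(2) b in auto)
    moreover have "eventually (\<lambda>l::nat. real CARD('a) powi (- int l) < c / b) sequentially"
    proof -
      have "(\<lambda>l. (1 / real CARD('a)) ^ l) \<longlonglongrightarrow> 0"
        using card_field_gt_1[where 'a='a] by (intro LIMSEQ_power_zero) simp
      hence "eventually (\<lambda>l. (1 / real CARD('a)) ^ l < c / b) sequentially"
        using b c by (intro order_tendstoD) auto
      thus ?thesis by (simp add: power_int_minus power_one_over inverse_eq_divide)
    qed
    ultimately show ?thesis
    proof eventually_elim
      case (elim l)
      show ?case
      proof
        fix z assume z: "z \<in> lball y (int l)"
        have "laurent_abs ((z - y) * poly g z) \<le> real CARD('a) powi (- int l) * b"
          unfolding laurent_abs_mult using z elim(1) b
          by (intro mult_mono) (auto simp: lball_def less_imp_le)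
        also have "\<dots> < c" using elim(2) b by (simp add: field_simps)
        finally show "laurent_abs (poly f z) < c"
          unfolding g(1)[of z] using less.prems by (rule laurent_abs_add_less[rotated])
      qed
    qed
  qed
qed

section \<open>Quantitative nondivergence\<close>

definition comparable_to :: "'o::order set \<Rightarrow> 'o \<Rightarrow> bool" where
  "comparable_to F x \<longleftrightarrow> (\<forall>y\<in>F. x \<le> y \<or> y \<le> x)"

text \<open>Each step of the induction below passes from a ball to the ball \<open>q\<close> times as large.\<close>

primrec amplification :: "real \<Rightarrow> nat \<Rightarrow> real" where
  "amplification q 0 = 0"
| "amplification q (Suc i) = q * (amplification q i + 1)"

lemma amplification_nonneg: "0 \<le> q \<Longrightarrow> 0 \<le> amplification q i"
  by (induction i) auto

text \<open>Elements of \<open>P\<close> stand for rational subspaces, \<open>rk\<close> for their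
  dimension and \<open>psi\<close> for their covolume at a point. By \<open>good\<close>, a
  \<open>psi\<close> that reaches \<rho> somewhere on a ball is below \<epsilon> only on a
  proportion \<kappa> of it.\<close>

locale nondivergence =
  fixes \<mu> :: "'a::{finite,field} fls measure" and P :: "'o::order set" and rk :: "'o \<Rightarrow> nat"
    and psi :: "'o \<Rightarrow> 'a fls \<Rightarrow> real" and m :: nat and \<rho> \<epsilon> \<kappa> :: real
  assumes haar: "haar_measure \<mu>"
    and rk_bounds: "x \<in> P \<Longrightarrow> rk x \<in> {1..m}"
    and rk_strict: "x \<in> P \<Longrightarrow> y \<in> P \<Longrightarrow> x < y \<Longrightarrow> rk x < rk y"
    and \<kappa>_nonneg: "0 \<le> \<kappa>"
    and locally_small: "x \<in> P \<Longrightarrow> psi x t < \<rho> \<Longrightarrow> \<exists>l::nat. \<forall>z\<in>lball t (int l). psi x z < \<rho>"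
    and good: "x \<in> P \<Longrightarrow> \<exists>y\<in>lball c k. \<rho> \<le> psi x y \<Longrightarrow>
      \<exists>U. open U \<and> {y\<in>lball c k. psi x y < \<epsilon>} \<subseteq> U \<and>
        emeasure \<mu> U \<le> ennreal (\<kappa> * unit_mass \<mu> * real CARD('a) powi (- k))"
begin

definition is_chain :: "'o set \<Rightarrow> bool" where
  "is_chain F \<longleftrightarrow> F \<subseteq> P \<and> (\<forall>x\<in>F. comparable_to F x)"

text \<open>\<open>F'\<close> is a flag whose new members have \<open>psi\<close> below \<rho> but
  not below \<epsilon>, and which nothing of \<open>psi\<close> below \<rho> can extend. Marking for
  the empty chain excludes short vectors; general \<open>F\<close> serves the induction.\<close>

definition marked :: "'o set \<Rightarrow> 'a fls \<Rightarrow> bool" where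
  "marked F y \<longleftrightarrow> (\<exists>F'. F \<subseteq> F' \<and> is_chain F' \<and> (\<forall>x\<in>F' - F. \<epsilon> \<le> psi x y \<and> psi x y < \<rho>) \<and>
     (\<forall>x\<in>P - F'. comparable_to F' x \<longrightarrow> \<rho> \<le> psi x y))"

lemma is_chain_insert: "is_chain F \<Longrightarrow> x \<in> P \<Longrightarrow> comparable_to F x \<Longrightarrow> is_chain (insert x F)"
  by (auto simp: is_chain_def comparable_to_def)

text \<open>The rank embeds a chain into \<open>{1..m}\<close>, which bounds the depth of the
  induction.\<close>

lemma is_chain_finite:
  assumes "is_chain F" shows "finite F" "card F \<le> m"
proof -
  have "inj_on rk F"
  proof (rule inj_onI, rule ccontr)
    fix x y assume xy: "x \<in> F" "y \<in> F" "rk x = rk y" "x \<noteq> y"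
    hence "x < y \<or> y < x" using assms by (auto simp: is_chain_def comparable_to_def less_le)
    thus False using xy assms rk_strict[of x y] rk_strict[of y x] by (auto simp: is_chain_def)
  qed
  moreover have "rk ` F \<subseteq> {1..m}" using assms rk_bounds by (force simp: is_chain_def)
  ultimately show "finite F" "card F \<le> m"
    using inj_on_finite[of rk F "{1..m}"] card_inj_on_le[of rk F "{1..m}"] by auto
qed

text \<open>Around a point where some admissible \<open>psi x\<close> is below \<open>\<rho>\<close>, take the largest ball on which some admissible
  \<open>psi x\<close> stays below \<open>\<rho>\<close>. On the next larger ball every admissible one reaches \<open>\<rho>\<close>, so that \<open>good\<close> applies
  to this \<open>x\<close> and the induction hypothesis to \<open>F\<close> enlarged by \<open>x\<close>.\<close>

lemma unmarked_bound:
  assumes "is_chain F" "m \<le> card F + i"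
    and "\<And>x. x \<in> P \<Longrightarrow> x \<notin> F \<Longrightarrow> comparable_to F x \<Longrightarrow> \<exists>y\<in>lball c k. \<rho> \<le> psi x y"
  shows "\<exists>U. open U \<and> (\<forall>y\<in>lball c k - U. marked F y) \<and>
    emeasure \<mu> U \<le> ennreal (amplification (real CARD('a)) i * \<kappa> * unit_mass \<mu> * real CARD('a) powi (- k))"
  using assms
proof (induction i arbitrary: F c k)
  case 0
  have "x \<in> F" if x: "x \<in> P" "comparable_to F x" for x
  proof (rule ccontr)
    assume "x \<notin> F"
    hence "card (insert x F) = Suc (card F)" using is_chain_finite[OF 0(1)] by simp
    thus False using is_chain_finite(2)[OF is_chain_insert[OF 0(1) x]] 0(2) by simp
  qed
  hence "marked F y" for y unfolding marked_def using 0(1) by (intro exI[of _ F]) auto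
  thus ?case by (intro exI[of _ "{}"]) auto
next
  case (Suc i)
  let ?q = "real CARD('a)"
  let ?A = "amplification ?q"
  have q: "1 < ?q" by (rule card_field_gt_1)
  have A0: "0 \<le> ?A i" using q by (intro amplification_nonneg) auto
  define fresh where "fresh x \<longleftrightarrow> x \<in> P \<and> x \<notin> F \<and> comparable_to F x" for x
  define low where "low y l \<longleftrightarrow> (\<exists>x. fresh x \<and> (\<forall>z\<in>lball y l. psi x z < \<rho>))" for y l
  define D where "D = {y\<in>lball c k. \<exists>j::nat. low y (k + int j)}"
  define lev where "lev y = (LEAST j::nat. low y (k + int j))" for y
  have low_top: "\<not> low y k" if "y \<in> lball c k" for y
    unfolding low_def lball_eq[OF that] using Suc.prems(3) by (fastforce simp: fresh_def)
  have lev: "low y (k + int (lev y))" if "y \<in> D" for y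
    using that unfolding lev_def D_def by (auto intro: LeastI_ex)
  have lev_inv: "z \<in> D \<and> lev z = lev y" if y: "y \<in> D" and z: "z \<in> lball y (k + int (lev y))" for y z
  proof -
    have eq: "lball z (k + int j) = lball y (k + int j)" if "j \<le> lev y" for j
    proof (rule lball_eq)
      show "z \<in> lball y (k + int j)" using z lball_mono[of "k + int j" "k + int (lev y)" y] that by auto
    qed
    have low_eq: "low z (k + int j) = low y (k + int j)" if "j \<le> lev y" for j
      unfolding low_def eq[OF that] ..
    have "z \<in> lball y k" using eq[of 0] mem_lball_self[of z k] by simp
    hence zc: "z \<in> lball c k" using lball_eq[of y c k] y by (simp add: D_def)
    have "low z (k + int (lev y))" using low_eq[of "lev y"] lev[OF y] by simp
    moreover have "lev y \<le> j" if "low z (k + int j)" for j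
    proof (rule ccontr)
      assume "\<not> lev y \<le> j"
      hence "low y (k + int j)" using low_eq[of j] that by simp
      hence "lev y \<le> j" unfolding lev_def by (rule Least_le)
      thus False using \<open>\<not> lev y \<le> j\<close> by simp
    qed
    ultimately have "lev z = lev y" unfolding lev_def[of z] by (intro Least_equality) auto
    thus ?thesis using zc \<open>low z _\<close> by (auto simp: D_def)
  qed
  have "\<exists>W. open W \<and> (\<forall>z\<in>lball y (k + int (lev y)) - W. marked F z) \<and>
      emeasure \<mu> W \<le> ennreal ((?A (Suc i) * \<kappa>) * unit_mass \<mu> * ?q powi (- (k + int (lev y))))"
    if y: "y \<in> D" for y
  proof -
    obtain x where x: "fresh x" "\<And>z. z \<in> lball y (k + int (lev y)) \<Longrightarrow> psi x z < \<rho>"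
      using lev[OF y] unfolding low_def by blast
    \<comment> \<open>At level 0 the hypothesis on \<open>lball c k\<close> makes every admissible
      \<open>psi\<close> reach \<rho>. So there is a next larger ball \<open>lball y p\<close> that
      is still inside \<open>lball c k\<close>.\<close>
    have "lev y \<noteq> 0" using lev[OF y] low_top[of y] y by (auto simp: D_def intro: gr0I)
    then obtain j where j: "lev y = Suc j" by (cases "lev y") auto
    define p where "p = k + int j"
    have notlow: "\<not> low y p"
      unfolding p_def using not_less_Least[of j "\<lambda>j. low y (k + int j)"] j by (simp add: lev_def)
    have high: "\<exists>z\<in>lball y p. \<rho> \<le> psi x' z" if "fresh x'" for x'
      using notlow that unfolding low_def by (meson not_le)
    have chain: "is_chain (insert x F)"
      using is_chain_insert[OF Suc.prems(1)] x(1) by (simp add: fresh_def)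
    have "m \<le> card (insert x F) + i"
      using Suc.prems(2) x(1) is_chain_finite(1)[OF Suc.prems(1)] by (simp add: fresh_def)
    then obtain U1 where U1: "open U1" "\<And>z. z \<in> lball y p - U1 \<Longrightarrow> marked (insert x F) z"
      "emeasure \<mu> U1 \<le> ennreal (?A i * \<kappa> * unit_mass \<mu> * ?q powi (- p))"
      using Suc.IH[OF chain, of y p] high by (auto simp: fresh_def comparable_to_def)
    obtain U2 where U2: "open U2" "{z\<in>lball y p. psi x z < \<epsilon>} \<subseteq> U2"
      "emeasure \<mu> U2 \<le> ennreal (\<kappa> * unit_mass \<mu> * ?q powi (- p))"
      using good[of x y p] high[OF x(1)] x(1) by (auto simp: fresh_def)
    have sub: "lball y (k + int (lev y)) \<subseteq> lball y p" by (rule lball_mono) (simp add: p_def j)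
    show ?thesis
    proof (intro exI[of _ "U1 \<union> U2"] conjI ballI)
      show "open (U1 \<union> U2)" using U1 U2 by auto
      have "emeasure \<mu> (U1 \<union> U2) \<le> emeasure \<mu> U1 + emeasure \<mu> U2"
        using U1 U2 haar_open[OF haar] by (intro emeasure_subadditive) auto
      also have "\<dots> \<le> ennreal (?A i * \<kappa> * unit_mass \<mu> * ?q powi (- p)) + ennreal (\<kappa> * unit_mass \<mu> * ?q powi (- p))"
        by (intro add_mono U1 U2)
      also have "\<dots> = ennreal (?A i * \<kappa> * unit_mass \<mu> * ?q powi (- p) + \<kappa> * unit_mass \<mu> * ?q powi (- p))"
        using A0 \<kappa>_nonneg by (intro ennreal_plus[symmetric]) auto
      also have "?A i * \<kappa> * unit_mass \<mu> * ?q powi (- p) + \<kappa> * unit_mass \<mu> * ?q powi (- p) =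
          (?A (Suc i) * \<kappa>) * unit_mass \<mu> * ?q powi (- (k + int (lev y)))"
      proof -
        have "- p = - (k + int (lev y)) + 1" by (simp add: p_def j)
        hence "?q powi (- p) = ?q * ?q powi (- (k + int (lev y)))" by (simp only: card_powi_add power_int_1_right mult.commute)
        thus ?thesis by (simp only: amplification.simps) (simp add: algebra_simps)
      qed
      finally show "emeasure \<mu> (U1 \<union> U2) \<le> ennreal ((?A (Suc i) * \<kappa>) * unit_mass \<mu> * ?q powi (- (k + int (lev y))))" .
      fix z assume z: "z \<in> lball y (k + int (lev y)) - (U1 \<union> U2)"
      have "z \<in> lball y p" using z sub by auto
      hence mk: "marked (insert x F) z" and \<epsilon>: "\<epsilon> \<le> psi x z" using U1(2) U2(2) z by (auto simp: not_less[symmetric])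
      have \<rho>: "psi x z < \<rho>" using x(2) z by simp
      from mk[unfolded marked_def] obtain F' where F': "insert x F \<subseteq> F' \<and> is_chain F' \<and>
        (\<forall>x'\<in>F' - insert x F. \<epsilon> \<le> psi x' z \<and> psi x' z < \<rho>) \<and>
        (\<forall>x'\<in>P - F'. comparable_to F' x' \<longrightarrow> \<rho> \<le> psi x' z)" by (elim exE)
      have "\<epsilon> \<le> psi x' z \<and> psi x' z < \<rho>" if "x' \<in> F' - F" for x'
        using F' \<epsilon> \<rho> that by (cases "x' = x") auto
      thus "marked F z" unfolding marked_def using F' by (intro exI[of _ F']) simp
    qed
  qed
  hence "\<forall>y. \<exists>W. y \<in> D \<longrightarrow> open W \<and> (\<forall>z\<in>lball y (k + int (lev y)) - W. marked F z) \<and>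
      emeasure \<mu> W \<le> ennreal ((?A (Suc i) * \<kappa>) * unit_mass \<mu> * ?q powi (- (k + int (lev y))))" by blast
  from choice[OF this] obtain W where W: "\<And>y. y \<in> D \<Longrightarrow> open (W y)"
    "\<And>y z. y \<in> D \<Longrightarrow> z \<in> lball y (k + int (lev y)) - W y \<Longrightarrow> marked F z"
    "\<And>y. y \<in> D \<Longrightarrow> emeasure \<mu> (W y) \<le> ennreal ((?A (Suc i) * \<kappa>) * unit_mass \<mu> * ?q powi (- (k + int (lev y))))"
    by (elim exE) blast
  have "\<exists>U. open U \<and> emeasure \<mu> U \<le> ennreal ((?A (Suc i) * \<kappa>) * unit_mass \<mu> * ?q powi (- k)) \<and>
    (\<forall>z\<in>D - U. \<exists>y\<in>D. z \<in> lball y (k + int (lev y)) - W y)"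
  proof (rule lball_patching[OF haar])
    show "D \<subseteq> lball c k" by (auto simp: D_def)
    show "z \<in> D \<and> lev z = lev y" if "y \<in> D" "z \<in> lball y (k + int (lev y))" for y z
      using that by (rule lev_inv)
    show "0 \<le> ?A (Suc i) * \<kappa>" using \<kappa>_nonneg q by (intro mult_nonneg_nonneg amplification_nonneg) auto
  qed (use W in auto)
  then obtain U where U: "open U" "emeasure \<mu> U \<le> ennreal ((?A (Suc i) * \<kappa>) * unit_mass \<mu> * ?q powi (- k))"
    "\<And>z. z \<in> D - U \<Longrightarrow> \<exists>y\<in>D. z \<in> lball y (k + int (lev y)) - W y" by blast
  have "marked F y" if y: "y \<in> lball c k - U" for y
  proof (cases "y \<in> D")
    case True
    then obtain y' where "y' \<in> D" "y \<in> lball y' (k + int (lev y')) - W y'" using U(3)[of y] y by blast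
    thus ?thesis by (rule W(2))
  next
    case False
    \<comment> \<open>Outside \<open>D\<close> the chain \<open>F\<close> itself is the witness: by
      \<open>locally_small\<close> a value below \<rho> would put \<open>y\<close> into
      \<open>D\<close>.\<close>
    have "\<rho> \<le> psi x y" if x: "fresh x" for x
    proof (rule ccontr)
      assume "\<not> \<rho> \<le> psi x y"
      then obtain l :: nat where l: "\<forall>z\<in>lball y (int l). psi x z < \<rho>"
        using locally_small[of x y] x by (auto simp: fresh_def)
      define j where "j = nat (int l - k)"
      have "lball y (k + int j) \<subseteq> lball y (int l)" by (rule lball_mono) (simp add: j_def)
      hence "low y (k + int j)" unfolding low_def using l x by blast
      thus False using False y by (auto simp: D_def)
    qed
    thus ?thesis unfolding marked_def using Suc.prems(1) by (intro exI[of _ F]) (auto simp: fresh_def)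
  qed
  thus ?case using U(1,2) by blast
qed

end

section \<open>Covolumes of sublattices\<close>

text \<open>The maximum norm of the wedge product of \<open>bs\<close>, that is, the covolume before
  any distortion.\<close>

definition minor_norm :: "nat \<Rightarrow> (nat \<Rightarrow> 'a::{finite,field} fls) list \<Rightarrow> real" where
  "minor_norm m bs = Max ((\<lambda>J. laurent_abs (minor bs J)) ` idx m (length bs))"

lemma minor_norm_le_iff:
  "0 < m \<Longrightarrow> minor_norm m bs \<le> c \<longleftrightarrow> (\<forall>J\<in>idx m (length bs). laurent_abs (minor bs J) \<le> c)"
  unfolding minor_norm_def by (subst Max_le_iff) auto

lemma minor_norm_less_iff:
  "0 < m \<Longrightarrow> minor_norm m bs < c \<longleftrightarrow> (\<forall>J\<in>idx m (length bs). laurent_abs (minor bs J) < c)"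
  unfolding minor_norm_def by (subst Max_less_iff) auto

lemma laurent_abs_minor_le: "J \<in> idx m (length bs) \<Longrightarrow> laurent_abs (minor bs J) \<le> minor_norm m bs"
  unfolding minor_norm_def by (intro Max_ge) auto

lemma minor_norm_attained:
  assumes "0 < m" obtains J where "J \<in> idx m (length bs)" "minor_norm m bs = laurent_abs (minor bs J)"
proof -
  have "minor_norm m bs \<in> (\<lambda>J. laurent_abs (minor bs J)) ` idx m (length bs)"
    unfolding minor_norm_def using assms by (intro Max_in) auto
  thus thesis using that by auto
qed

lemma minor_norm_nonneg: "0 < m \<Longrightarrow> 0 \<le> minor_norm m bs"
  by (metis minor_norm_attained laurent_abs_nonneg)

lemma minor_single: "minor [v] [i] = v i"
  by (simp add: minor_expand_row)

lemma laurent_abs_neg_one_power [simp]: "laurent_abs ((- 1) ^ k) = 1"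
  by (simp add: laurent_abs_power)

lemma minor_Cons_le:
  assumes J: "J \<in> idx m (Suc (length bs))" and v: "\<And>i. i < m \<Longrightarrow> laurent_abs (v i) \<le> c"
  shows "laurent_abs (minor (v # bs) J) \<le> c * minor_norm m bs"
proof -
  have len: "length J = Suc (length bs)" using J by (simp add: idx_def)
  have m: "0 < m" using J by (cases J) (auto simp: idx_def)
  have c: "0 \<le> c" using v[OF m] laurent_abs_nonneg order_trans by blast
  show ?thesis unfolding minor_expand_row[OF len]
  proof (rule laurent_abs_sum_le)
    fix k assume k: "k \<in> {..<length J}"
    hence "J ! k < m" using J nth_mem[of k J] by (auto simp: idx_def subset_iff)
    moreover have "del k J \<in> idx m (length bs)" using k J len by (intro del_in_idx) auto
    ultimately show "laurent_abs ((- 1) ^ k * v (J ! k) * minor bs (del k J)) \<le> c * minor_norm m bs"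
      using v c by (simp add: laurent_abs_mult mult_mono laurent_abs_minor_le)
  qed (use c minor_norm_nonneg[OF m, of bs] in simp)
qed

definition powers :: "'a::monoid_mult \<Rightarrow> nat \<Rightarrow> 'a" where
  "powers y = (\<lambda>i. y ^ i)"

lemma minor_powers_single: "minor [powers y, v] [i, j] = y ^ i * v j - y ^ j * v i"
  by (simp add: minor_expand_row[of _ "[v]"] minor_single powers_def numeral_2_eq_2)

text \<open>The difference is the minor with columns 0 and \<open>i\<close>; it is the component of
  \<open>v\<close> transversal to the curve.\<close>

lemma shifted_row:
  assumes "0 < m" "i < m"
  shows "laurent_abs (v i - v 0 * y ^ i) \<le> minor_norm m [powers y, v]"
proof -
  have "[0, i] \<in> idx m (length [powers y, v])" using assms by (simp add: idx_def)
  from laurent_abs_minor_le[OF this] show ?thesis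
    by (simp add: minor_powers_single mult.commute)
qed

text \<open>Split \<open>v\<close> into \<open>v 0\<close> times \<open>powers y\<close> and the
  transversal remainder; the ultrametric inequality turns the sum into a maximum.\<close>

lemma minor_norm_Cons_le:
  assumes m: "0 < m"
  shows "minor_norm m (v # bs) \<le>
    max (minor_norm m [v] * minor_norm m (powers y # bs)) (minor_norm m [powers y, v] * minor_norm m bs)"
proof (subst minor_norm_le_iff[OF m], safe)
  fix J assume "J \<in> idx m (length (v # bs))"
  hence J: "J \<in> idx m (Suc (length bs))" and len: "length J = Suc (length bs)" by (auto simp: idx_def)
  have "v = (\<lambda>i. v 0 * powers y i + (v i - v 0 * y ^ i))" by (simp add: powers_def)
  hence "minor (v # bs) J = minor ((\<lambda>i. v 0 * powers y i + (v i - v 0 * y ^ i)) # bs) J" by simp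
  also have "\<dots> = v 0 * minor (powers y # bs) J + minor ((\<lambda>i. v i - v 0 * y ^ i) # bs) J"
    by (rule minor_lin_row[OF len])
  finally have eq: "minor (v # bs) J = \<dots>" .
  have "[0] \<in> idx m (length [v])" using m by (simp add: idx_def)
  from laurent_abs_minor_le[OF this] have "laurent_abs (v 0) \<le> minor_norm m [v]" by (simp add: minor_single)
  hence 1: "laurent_abs (v 0 * minor (powers y # bs) J) \<le> minor_norm m [v] * minor_norm m (powers y # bs)"
    unfolding laurent_abs_mult using J m by (intro mult_mono laurent_abs_minor_le minor_norm_nonneg) auto
  have 2: "laurent_abs (minor ((\<lambda>i. v i - v 0 * y ^ i) # bs) J) \<le> minor_norm m [powers y, v] * minor_norm m bs"
    by (rule minor_Cons_le[OF J]) (rule shifted_row[OF m])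
  show "laurent_abs (minor (v # bs) J) \<le>
    max (minor_norm m [v] * minor_norm m (powers y # bs)) (minor_norm m [powers y, v] * minor_norm m bs)"
    unfolding eq using 1 2 by (intro laurent_abs_add_le) auto
qed

text \<open>Next to the row \<open>powers y\<close> the multiple of \<open>powers y\<close> in
  \<open>v\<close> drops out, leaving the transversal remainder.\<close>

lemma minor_norm_powers_Cons_le:
  assumes m: "0 < m"
  shows "minor_norm m (powers y # v # bs) \<le> minor_norm m [powers y, v] * minor_norm m (powers y # bs)"
proof (subst minor_norm_le_iff[OF m], safe)
  fix J assume "J \<in> idx m (length (powers y # v # bs))"
  hence J: "J \<in> idx m (Suc (length (powers y # bs)))" and len: "length J = Suc (length (powers y # bs))"
    by (auto simp: idx_def)
  have "v = (\<lambda>i. v 0 * powers y i + (v i - v 0 * y ^ i))" by (simp add: powers_def)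
  hence "minor (v # powers y # bs) J = minor ((\<lambda>i. v 0 * powers y i + (v i - v 0 * y ^ i)) # powers y # bs) J" by simp
  also have "\<dots> = minor ((\<lambda>i. v i - v 0 * y ^ i) # powers y # bs) J"
    by (subst minor_lin_row[OF len]) (simp add: minor_row_dup)
  finally have "minor (powers y # v # bs) J = - minor ((\<lambda>i. v i - v 0 * y ^ i) # powers y # bs) J"
    using len by (subst minor_swap) auto
  moreover have "laurent_abs (minor ((\<lambda>i. v i - v 0 * y ^ i) # powers y # bs) J)
      \<le> minor_norm m [powers y, v] * minor_norm m (powers y # bs)"
    by (rule minor_Cons_le[OF J]) (rule shifted_row[OF m])
  ultimately show "laurent_abs (minor (powers y # v # bs) J)
      \<le> minor_norm m [powers y, v] * minor_norm m (powers y # bs)" by simp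
qed

text \<open>Up to a factor depending on \<open>|y|\<close>, this is the covolume of the lattice spanned by \<open>bs\<close> for the norm
  \<open>max (q^(-N) |v 0|, q^h |v i - y^i v 0|)\<close> of a vector \<open>v\<close>: every vector but one contributes \<open>q^h\<close> to a
  minor of \<open>bs\<close>, while all of them do so to the component transversal to the curve \<open>(1, y, \<dots>, y^n)\<close>.\<close>

definition covol :: "nat \<Rightarrow> nat \<Rightarrow> nat \<Rightarrow> 'a::{finite,field} fls \<Rightarrow> (nat \<Rightarrow> 'a fls) list \<Rightarrow> real" where
  "covol n N h y bs =
    max (real CARD('a) powi (int (length bs) * int h - int h - int N) * minor_norm (Suc n) bs)
        (real CARD('a) powi (int (length bs) * int h) * minor_norm (Suc n) (powers y # bs))"

lemma covol_nonneg: "0 \<le> covol n N h y bs"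
  using minor_norm_nonneg[of "Suc n" bs] by (simp add: covol_def le_max_iff_disj)

text \<open>The exponents match because in each product of terms at most one factor carries
  \<open>- N\<close>, while each vector that counts transversally brings its own
  \<open>h\<close>.\<close>

lemma covol_Cons_le: "covol n N h y (v # bs) \<le> covol n N h y [v] * covol n N h y bs"
proof -
  let ?q = "real CARD('a)"
  let ?m = "Suc n"
  let ?L = "int (length bs)"
  have nn: "0 \<le> minor_norm ?m cs" for cs :: "(nat \<Rightarrow> 'a fls) list" by (rule minor_norm_nonneg) simp
  have qp: "0 \<le> ?q powi i" for i by simp
  have v1: "?q powi (- int N) * minor_norm ?m [v] \<le> covol n N h y [v]"
    and v2: "?q powi int h * minor_norm ?m [powers y, v] \<le> covol n N h y [v]"
    by (simp_all add: covol_def)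
  have b1: "?q powi (?L * int h - int h - int N) * minor_norm ?m bs \<le> covol n N h y bs"
    and b2: "?q powi (?L * int h) * minor_norm ?m (powers y # bs) \<le> covol n N h y bs"
    by (simp_all add: covol_def)
  have prod: "?q powi (i + j) * (a * b) \<le> covol n N h y [v] * covol n N h y bs"
    if "?q powi i * a \<le> covol n N h y [v]" "?q powi j * b \<le> covol n N h y bs" "0 \<le> b" for i j a b
  proof -
    have "?q powi (i + j) * (a * b) = (?q powi i * a) * (?q powi j * b)"
      unfolding card_powi_add by (simp add: mult_ac)
    also have "\<dots> \<le> covol n N h y [v] * covol n N h y bs"
      using that qp by (intro mult_mono covol_nonneg) auto
    finally show ?thesis .
  qed
  have 1: "?q powi (int (length (v # bs)) * int h - int h - int N) * minor_norm ?m (v # bs)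
      \<le> covol n N h y [v] * covol n N h y bs"
  proof -
    let ?e = "int (length (v # bs)) * int h - int h - int N"
    have "?q powi ?e * minor_norm ?m (v # bs) \<le> ?q powi ?e *
        max (minor_norm ?m [v] * minor_norm ?m (powers y # bs)) (minor_norm ?m [powers y, v] * minor_norm ?m bs)"
      by (intro mult_left_mono minor_norm_Cons_le qp) simp
    also have "\<dots> = max (?q powi ?e * (minor_norm ?m [v] * minor_norm ?m (powers y # bs)))
        (?q powi ?e * (minor_norm ?m [powers y, v] * minor_norm ?m bs))"
      using qp[of ?e] by (simp add: max_mult_distrib_left)
    also have "\<dots> \<le> covol n N h y [v] * covol n N h y bs"
    proof (rule max.boundedI)
      have "?e = - int N + ?L * int h" by (simp add: algebra_simps)
      thus "?q powi ?e * (minor_norm ?m [v] * minor_norm ?m (powers y # bs)) \<le> covol n N h y [v] * covol n N h y bs"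
        using prod[OF v1 b2 nn] by simp
      have "?e = int h + (?L * int h - int h - int N)" by (simp add: algebra_simps)
      thus "?q powi ?e * (minor_norm ?m [powers y, v] * minor_norm ?m bs) \<le> covol n N h y [v] * covol n N h y bs"
        using prod[OF v2 b1 nn] by simp
    qed
    finally show ?thesis .
  qed
  have 2: "?q powi (int (length (v # bs)) * int h) * minor_norm ?m (powers y # v # bs)
      \<le> covol n N h y [v] * covol n N h y bs"
  proof -
    have e: "int (length (v # bs)) * int h = int h + ?L * int h" by (simp add: algebra_simps)
    have "?q powi (int h + ?L * int h) * minor_norm ?m (powers y # v # bs) \<le>
        ?q powi (int h + ?L * int h) * (minor_norm ?m [powers y, v] * minor_norm ?m (powers y # bs))"
      by (intro mult_left_mono minor_norm_powers_Cons_le qp) simp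
    also have "\<dots> \<le> covol n N h y [v] * covol n N h y bs" by (rule prod[OF v2 b2 nn])
    finally show ?thesis unfolding e .
  qed
  show ?thesis unfolding covol_def[of n N h y "v # bs"] by (rule max.boundedI[OF 1 2])
qed

section \<open>The covolume as a function of y\<close>

definition minor_poly :: "(nat \<Rightarrow> 'a::comm_ring_1) list \<Rightarrow> nat list \<Rightarrow> 'a poly" where
  "minor_poly bs J = (\<Sum>k<length J. monom ((- 1) ^ k * minor bs (del k J)) (J ! k))"

lemma poly_minor_poly:
  assumes "J \<in> idx m (Suc (length bs))"
  shows "poly (minor_poly bs J) y = minor (powers y # bs) J"
proof -
  have "length J = Suc (length bs)" using assms by (simp add: idx_def)
  thus ?thesis by (simp add: minor_poly_def poly_sum poly_monom minor_expand_row powers_def mult_ac)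
qed

lemma degree_minor_poly:
  assumes "J \<in> idx (Suc n) j" shows "degree (minor_poly bs J) \<le> n"
  unfolding minor_poly_def
proof (rule degree_sum_le)
  fix k assume "k \<in> {..<length J}"
  hence "J ! k \<le> n" using assms nth_mem[of k J] by (auto simp: idx_def subset_iff less_Suc_eq_le)
  thus "degree (monom ((- 1) ^ k * minor bs (del k J)) (J ! k)) \<le> n"
    using degree_monom_le order_trans by blast
qed simp

text \<open>Only the first column contributes to this coefficient, so a nonzero minor of
  \<open>bs\<close> shows up as a coefficient.\<close>

lemma coeff_minor_poly_Cons:
  assumes "i \<notin> set I" shows "coeff (minor_poly bs (i # I)) i = minor bs I"
proof -
  have "I ! k \<noteq> i" if "k < length I" for k using assms nth_mem[OF that] by auto
  hence "(\<Sum>k<length I. coeff (monom ((- 1) ^ Suc k * minor bs (i # del k I)) (I ! k)) i) = 0"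
    by (intro sum.neutral) auto
  thus ?thesis
    by (simp add: minor_poly_def coeff_sum sum.lessThan_Suc_shift del: sum.lessThan_Suc)
qed

definition integral_vec :: "(nat \<Rightarrow> 'a::{finite,field} fls) \<Rightarrow> bool" where
  "integral_vec v \<longleftrightarrow> (\<forall>i. v i \<in> range poly_T)"

lemma minor_integral:
  assumes "\<forall>v\<in>set bs. integral_vec v" "length J = length bs"
  shows "minor bs J \<in> range poly_T"
  using assms
proof (induction bs arbitrary: J)
  case Nil
  show ?case using rangeI[of poly_T 1] by simp
next
  case (Cons v bs)
  have "\<exists>c. (- 1) ^ k * v (J ! k) * minor bs (del k J) = poly_T c" if "k < length J" for k
  proof -
    have "minor bs (del k J) \<in> range poly_T" by (rule Cons.IH) (use Cons.prems that in auto)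
    moreover have "v (J ! k) \<in> range poly_T" using Cons.prems by (auto simp: integral_vec_def)
    ultimately obtain a b where "v (J ! k) = poly_T a" "minor bs (del k J) = poly_T b" by auto
    hence "(- 1) ^ k * v (J ! k) * minor bs (del k J) = poly_T ((- 1) ^ k * a * b)"
      by (simp add: poly_T_mult poly_T_power poly_T_uminus)
    thus ?thesis ..
  qed
  hence "\<forall>k. \<exists>c. k < length J \<longrightarrow> (- 1) ^ k * v (J ! k) * minor bs (del k J) = poly_T c" by blast
  from choice[OF this] obtain c where
    c: "\<And>k. k < length J \<Longrightarrow> (- 1) ^ k * v (J ! k) * minor bs (del k J) = poly_T (c k)" by blast
  have "minor (v # bs) J = (\<Sum>k<length J. (- 1) ^ k * v (J ! k) * minor bs (del k J))"
    using Cons.prems(2) by (intro minor_expand_row) simp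
  also have "\<dots> = poly_T (\<Sum>k<length J. c k)" unfolding poly_T_sum by (intro sum.cong refl c) simp
  finally show ?case by simp
qed

lemma minor_norm_integral:
  fixes bs :: "(nat \<Rightarrow> 'a::{finite,field} fls) list"
  assumes "indep m bs" "\<forall>v\<in>set bs. integral_vec v" "0 < m"
  obtains k :: nat where "minor_norm m bs = real (CARD('a) ^ k)"
proof -
  obtain J0 where J0: "J0 \<in> idx m (length bs)" "minor bs J0 \<noteq> 0" using assms(1) by (auto simp: indep_def)
  obtain J where J: "J \<in> idx m (length bs)" "minor_norm m bs = laurent_abs (minor bs J)"
    using minor_norm_attained[OF assms(3)] .
  have "0 < laurent_abs (minor bs J0)" using J0(2) by simp
  also have "\<dots> \<le> minor_norm m bs" by (rule laurent_abs_minor_le[OF J0(1)])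
  finally have "0 < minor_norm m bs" .
  hence nz: "minor bs J \<noteq> 0" using J by auto
  obtain a where a: "minor bs J = poly_T a" using minor_integral[OF assms(2), of J] J(1) by (auto simp: idx_def)
  hence "a \<noteq> 0" using nz by auto
  thus thesis using that[of "degree a"] J a by (simp add: laurent_abs_poly_T)
qed

text \<open>The first term of \<open>covol\<close> does not depend on \<open>y\<close>; otherwise
  take a minor with row \<open>powers y\<close> that is large at \<open>y0\<close>. It is a
  polynomial of degree at most \<open>n\<close>, and its size at \<open>y0\<close> excludes the
  second alternative of \<open>poly_small_set_cover\<close>, which leaves \<open>n\<close> balls of
  relative measure \<open>q powi (- t)\<close>.\<close>

lemma covol_good:
  fixes \<mu> :: "'a::{finite,field} fls measure" and bs :: "(nat \<Rightarrow> 'a fls) list" and t :: nat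
  assumes \<mu>: "haar_measure \<mu>" and \<epsilon>: "0 < \<epsilon>" "\<epsilon> * real CARD('a) ^ (t * n) \<le> \<rho>"
    and y0: "y0 \<in> lball c k" "\<rho> \<le> covol n N h y0 bs"
  shows "\<exists>U. open U \<and> {y\<in>lball c k. covol n N h y bs < \<epsilon>} \<subseteq> U \<and>
    emeasure \<mu> U \<le> ennreal ((real n * real CARD('a) powi (- int t)) * unit_mass \<mu> * real CARD('a) powi (- k))"
proof -
  let ?q = "real CARD('a)"
  have q: "1 < ?q" by (rule card_field_gt_1)
  let ?a = "?q powi (int (length bs) * int h - int h - int N)"
  let ?b = "?q powi (int (length bs) * int h)"
  have b: "0 < ?b" using q by simp
  have "\<epsilon> * 1 \<le> \<epsilon> * ?q ^ (t * n)" using \<epsilon>(1) q by (intro mult_left_mono one_le_power) auto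
  hence \<epsilon>\<rho>: "\<epsilon> \<le> \<rho>" using \<epsilon>(2) by simp
  show ?thesis
  proof (cases "\<rho> \<le> ?a * minor_norm (Suc n) bs")
    case True
    hence "\<epsilon> \<le> covol n N h y bs" for y using \<epsilon>\<rho> by (simp add: covol_def le_max_iff_disj)
    hence "{y\<in>lball c k. covol n N h y bs < \<epsilon>} = {}" by (simp add: not_less)
    thus ?thesis by (intro exI[of _ "{}"]) simp
  next
    case False
    hence big: "\<rho> \<le> ?b * minor_norm (Suc n) (powers y0 # bs)" using y0(2) by (simp add: covol_def le_max_iff_disj)
    obtain J where J: "J \<in> idx (Suc n) (length (powers y0 # bs))"
      "minor_norm (Suc n) (powers y0 # bs) = laurent_abs (minor (powers y0 # bs) J)"
      using minor_norm_attained[of "Suc n" "powers y0 # bs"] by blast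
    have J': "J \<in> idx (Suc n) (Suc (length bs))" using J(1) by simp
    define f where "f = minor_poly bs J"
    have fy: "poly f y = minor (powers y # bs) J" for y unfolding f_def by (rule poly_minor_poly[OF J'])
    have deg: "degree f \<le> n" unfolding f_def by (rule degree_minor_poly[OF J'])
    have "\<not> (\<forall>y\<in>lball c k. laurent_abs (poly f y) < \<epsilon> / ?b * (?q powi ((k + int t) - k)) ^ n)"
    proof
      assume "\<forall>y\<in>lball c k. laurent_abs (poly f y) < \<epsilon> / ?b * (?q powi ((k + int t) - k)) ^ n"
      hence "laurent_abs (poly f y0) < \<epsilon> / ?b * (?q powi ((k + int t) - k)) ^ n" using y0(1) by blast
      hence "laurent_abs (poly f y0) < \<epsilon> * ?q ^ (t * n) / ?b" by (simp add: power_mult)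
      also have "\<dots> \<le> \<rho> / ?b" using \<epsilon>(2) b by (intro divide_right_mono) auto
      finally show False using big b by (simp add: J(2) fy field_simps)
    qed
    moreover have "(\<exists>X. finite X \<and> card X \<le> n \<and>
        {y\<in>lball c k. laurent_abs (poly f y) < \<epsilon> / ?b} \<subseteq> (\<Union>z\<in>X. lball z (k + int t)))
      \<or> (\<forall>y\<in>lball c k. laurent_abs (poly f y) < \<epsilon> / ?b * (?q powi ((k + int t) - k)) ^ n)"
      using \<epsilon>(1) b by (intro poly_small_set_cover deg) auto
    ultimately obtain X where X: "finite X" "card X \<le> n"
      "{y\<in>lball c k. laurent_abs (poly f y) < \<epsilon> / ?b} \<subseteq> (\<Union>z\<in>X. lball z (k + int t))" by (elim disjE exE conjE) auto
    show ?thesis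
    proof (intro exI[of _ "\<Union>z\<in>X. lball z (k + int t)"] conjI)
      show "open (\<Union>z\<in>X. lball z (k + int t))" using open_lball by blast
      show "{y\<in>lball c k. covol n N h y bs < \<epsilon>} \<subseteq> (\<Union>z\<in>X. lball z (k + int t))"
      proof (rule order.trans[OF _ X(3)], safe)
        fix y assume "covol n N h y bs < \<epsilon>"
        hence "?b * minor_norm (Suc n) (powers y # bs) < \<epsilon>" by (simp add: covol_def)
        moreover have "laurent_abs (poly f y) \<le> minor_norm (Suc n) (powers y # bs)"
          unfolding fy by (rule laurent_abs_minor_le) (use J' in simp)
        ultimately have "?b * laurent_abs (poly f y) < \<epsilon>" using b by (meson le_less_trans mult_left_mono less_imp_le)
        thus "laurent_abs (poly f y) < \<epsilon> / ?b" using b by (simp add: field_simps)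
      qed
      have "- (k + int t) = - int t + - k" by simp
      hence "?q powi (- (k + int t)) = ?q powi (- int t) * ?q powi (- k)" by (simp only: card_powi_add)
      thus "emeasure \<mu> (\<Union>z\<in>X. lball z (k + int t)) \<le>
          ennreal ((real n * ?q powi (- int t)) * unit_mass \<mu> * ?q powi (- k))"
        using emeasure_UN_lball_le[OF \<mu> X(1,2), of "k + int t"] by (simp add: mult_ac)
    qed
  qed
qed

lemma covol_locally_small:
  assumes "covol n N h y bs < \<rho>"
  shows "\<exists>l::nat. \<forall>z\<in>lball y (int l). covol n N h z bs < \<rho>"
proof -
  let ?q = "real CARD('a)"
  let ?b = "?q powi (int (length bs) * int h)"
  have b: "0 < ?b" by simp
  have 1: "?q powi (int (length bs) * int h - int h - int N) * minor_norm (Suc n) bs < \<rho>"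
    and 2: "?b * minor_norm (Suc n) (powers y # bs) < \<rho>" using assms by (auto simp: covol_def)
  let ?Js = "idx (Suc n) (Suc (length bs))"
  have "eventually (\<lambda>l::nat. \<forall>J\<in>?Js. \<forall>z\<in>lball y (int l). laurent_abs (poly (minor_poly bs J) z) < \<rho> / ?b) sequentially"
  proof (intro eventually_ball_finite ballI poly_locally_small)
    fix J assume J: "J \<in> ?Js"
    have "laurent_abs (minor (powers y # bs) J) \<le> minor_norm (Suc n) (powers y # bs)"
      by (rule laurent_abs_minor_le) (use J in simp)
    also have "\<dots> < \<rho> / ?b" using 2 b by (simp add: field_simps)
    finally show "laurent_abs (poly (minor_poly bs J) y) < \<rho> / ?b" by (simp add: poly_minor_poly[OF J])
  qed simp
  then obtain l :: nat where l: "\<forall>J\<in>?Js. \<forall>z\<in>lball y (int l). laurent_abs (poly (minor_poly bs J) z) < \<rho> / ?b"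
    unfolding eventually_sequentially by blast
  have "covol n N h z bs < \<rho>" if z: "z \<in> lball y (int l)" for z
  proof -
    have "minor_norm (Suc n) (powers z # bs) < \<rho> / ?b"
      using l z by (subst minor_norm_less_iff) (auto simp: poly_minor_poly)
    hence "?b * minor_norm (Suc n) (powers z # bs) < \<rho>" using b by (simp add: field_simps)
    thus ?thesis using 1 by (simp add: covol_def)
  qed
  thus ?thesis by blast
qed

text \<open>For full rank the first term is at least \<open>q ^ (n * h - N)\<close>, hence the
  condition on \<open>N\<close>. For smaller rank a column outside a nonzero integral minor gives a
  polynomial in \<open>y\<close> with a coefficient of size at least 1, which cannot be below
  \<open>q powi (- n * n)\<close> on all of the unit ball.\<close>

lemma covol_large_somewhere:
  fixes bs :: "(nat \<Rightarrow> 'a::{finite,field} fls) list"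
  assumes bs: "indep (Suc n) bs" "\<forall>v\<in>set bs. integral_vec v" and N: "N \<le> n * h"
  shows "\<exists>y\<in>lball 0 0. real CARD('a) powi (- int (n * n)) \<le> covol n N h y bs"
proof -
  let ?q = "real CARD('a)"
  have q: "1 < ?q" by (rule card_field_gt_1)
  obtain I where I: "I \<in> idx (Suc n) (length bs)" "minor bs I \<noteq> 0" using bs(1) by (auto simp: indep_def)
  obtain a where a: "minor bs I = poly_T a" using minor_integral[OF bs(2), of I] I(1) by (auto simp: idx_def)
  have ge1: "1 \<le> laurent_abs (minor bs I)" unfolding a by (rule laurent_abs_poly_T_ge_1) (use a I(2) in auto)
  have dI: "distinct I" using minor_col_dup[of I bs] I by (auto simp: idx_def)
  have le1: "?q powi (- int (n * n)) \<le> 1"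
  proof -
    have "?q powi (- int (n * n)) \<le> ?q powi 0" unfolding card_powi_le_iff by simp
    thus ?thesis by simp
  qed
  show ?thesis
  proof (cases "{..<Suc n} \<subseteq> set I")
    case True
    have "Suc n \<le> length bs"
      using card_mono[OF _ True] dI I(1) by (simp add: distinct_card idx_def)
    hence "int n * int h \<le> (int (length bs) - 1) * int h" by (intro mult_right_mono) auto
    hence "int n * int h \<le> int (length bs) * int h - int h" by (simp add: algebra_simps)
    moreover have "int N \<le> int n * int h" using N by (metis of_nat_le_iff of_nat_mult)
    ultimately have "?q powi 0 \<le> ?q powi (int (length bs) * int h - int h - int N)"
      unfolding card_powi_le_iff by linarith
    hence "1 * 1 \<le> ?q powi (int (length bs) * int h - int h - int N) * minor_norm (Suc n) bs"
      using ge1 laurent_abs_minor_le[OF I(1)] by (intro mult_mono) auto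
    hence "1 \<le> covol n N h 0 bs" by (simp add: covol_def le_max_iff_disj)
    thus ?thesis using le1 by (intro bexI[of _ 0]) auto
  next
    case False
    then obtain i where i: "i < Suc n" "i \<notin> set I" by auto
    define J where "J = i # I"
    have J: "J \<in> idx (Suc n) (Suc (length bs))" unfolding J_def using i I(1) by (intro Cons_in_idx)
    have "\<exists>y\<in>lball 0 0. ?q powi (- int (n * n)) \<le> laurent_abs (poly (minor_poly bs J) y)"
    proof (rule ccontr)
      assume "\<not> (\<exists>y\<in>lball 0 0. ?q powi (- int (n * n)) \<le> laurent_abs (poly (minor_poly bs J) y))"
      hence "laurent_abs (coeff (minor_poly bs J) i) < ?q powi (- int (n * n)) * ?q ^ (n * n)"
        using q by (intro coeff_less_of_small_on_unit_ball degree_minor_poly[OF J]) (auto simp: not_le)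
      moreover have "?q powi (- int (n * n)) * ?q ^ (n * n) = 1"
        unfolding power_int_minus power_int_of_nat using q by simp
      ultimately show False using ge1 coeff_minor_poly_Cons[OF i(2), of bs] by (simp add: J_def)
    qed
    then obtain y where y: "y \<in> lball 0 0" "?q powi (- int (n * n)) \<le> laurent_abs (minor (powers y # bs) J)"
      unfolding poly_minor_poly[OF J] by blast
    have "?q powi 0 \<le> ?q powi (int (length bs) * int h)" unfolding card_powi_le_iff by simp
    hence "1 * ?q powi (- int (n * n)) \<le> ?q powi (int (length bs) * int h) * minor_norm (Suc n) (powers y # bs)"
      using y(2) laurent_abs_minor_le[of J "Suc n" "powers y # bs"] J by (intro mult_mono) auto
    thus ?thesis using y(1) by (intro bexI[of _ y]) (auto simp: covol_def le_max_iff_disj)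
  qed
qed

section \<open>Short vectors\<close>

definition lattice_basis :: "nat \<Rightarrow> (nat \<Rightarrow> 'a::{finite,field} fls) set \<Rightarrow> (nat \<Rightarrow> 'a fls) list \<Rightarrow> bool" where
  "lattice_basis n S bs \<longleftrightarrow>
    indep (Suc n) bs \<and> (\<forall>v\<in>set bs. integral_vec v) \<and> spn (Suc n) bs = S"

text \<open>Subspaces rather than lists, so that inclusion is a partial order ranked by the length
  of a basis; the zero space is left out to keep ranks positive.\<close>

definition rational_spaces :: "nat \<Rightarrow> (nat \<Rightarrow> 'a::{finite,field} fls) set set" where
  "rational_spaces n = {S. \<exists>bs. bs \<noteq> [] \<and> lattice_basis n S bs}"

lemma lattice_basis_subset: "lattice_basis n S bs \<Longrightarrow> set bs \<subseteq> S"
  using set_subset_spn[of bs "Suc n"] by (simp add: lattice_basis_def)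

lemma lattice_basis_length_le:
  "lattice_basis n S bs \<Longrightarrow> lattice_basis n T cs \<Longrightarrow> S \<subseteq> T \<Longrightarrow> length bs \<le> length cs"
  using length_le_of_subset_spn[of "Suc n" cs bs] lattice_basis_subset[of n S bs]
  by (auto simp: lattice_basis_def)

lemma lattice_basis_length_less:
  assumes "lattice_basis n S bs" "lattice_basis n T cs" "S \<subset> T"
  shows "length bs < length cs"
proof (rule ccontr)
  assume "\<not> length bs < length cs"
  hence "length bs = length cs" using lattice_basis_length_le[OF assms(1,2)] assms(3) by auto
  hence "S = T"
    using spn_eq_of_length_eq[of "Suc n" cs bs] lattice_basis_subset[OF assms(1)] assms
    by (auto simp: lattice_basis_def)
  thus False using assms(3) by simp
qed

text \<open>A basis of minimal norm plays the role of a basis of the primitive sublattice of \<open>S\<close>.\<close>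

definition min_basis :: "nat \<Rightarrow> (nat \<Rightarrow> 'a::{finite,field} fls) set \<Rightarrow> (nat \<Rightarrow> 'a fls) list" where
  "min_basis n S = (SOME bs. lattice_basis n S bs \<and>
     (\<forall>cs. lattice_basis n S cs \<longrightarrow> minor_norm (Suc n) bs \<le> minor_norm (Suc n) cs))"

text \<open>Norms of integral bases are powers of \<open>q\<close>, hence natural numbers, so a
  least one exists.\<close>

lemma min_basis:
  fixes S :: "(nat \<Rightarrow> 'a::{finite,field} fls) set"
  assumes "lattice_basis n S cs0"
  shows "lattice_basis n S (min_basis n S)"
    and "lattice_basis n S cs \<Longrightarrow> minor_norm (Suc n) (min_basis n S) \<le> minor_norm (Suc n) cs"
proof -
  define size where "size bs = nat \<lfloor>minor_norm (Suc n) bs\<rfloor>" for bs :: "(nat \<Rightarrow> 'a fls) list"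
  have size: "minor_norm (Suc n) bs = real (size bs)" if bs: "lattice_basis n S bs" for bs
  proof -
    obtain k :: nat where "minor_norm (Suc n) bs = real (CARD('a) ^ k)"
      using minor_norm_integral[of "Suc n" bs] bs by (auto simp: lattice_basis_def)
    thus ?thesis by (simp add: size_def del: of_nat_power)
  qed
  obtain bs where bs: "lattice_basis n S bs" "\<And>cs. lattice_basis n S cs \<Longrightarrow> size bs \<le> size cs"
    using ex_has_least_nat[of "lattice_basis n S" cs0 size] assms by blast
  have "\<exists>bs. lattice_basis n S bs \<and>
     (\<forall>cs. lattice_basis n S cs \<longrightarrow> minor_norm (Suc n) bs \<le> minor_norm (Suc n) cs)"
    by (rule exI[of _ bs]) (use bs size in auto)
  from someI_ex[OF this] show "lattice_basis n S (min_basis n S)"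
    and "lattice_basis n S cs \<Longrightarrow> minor_norm (Suc n) (min_basis n S) \<le> minor_norm (Suc n) cs"
    unfolding min_basis_def by blast+
qed

text \<open>The minors of \<open>cs\<close> are those of the minimal basis times a common factor
  \<open>l\<close>. Minimality forces |l| to be at least 1, and both terms of \<open>covol\<close>
  scale with |l|.\<close>

lemma covol_min_basis_le:
  assumes cs: "lattice_basis n S cs"
  shows "covol n N h y (min_basis n S) \<le> covol n N h y cs"
proof -
  let ?m = "Suc n"
  define bs where "bs = min_basis n S"
  have bs: "lattice_basis n S bs" and le: "minor_norm ?m bs \<le> minor_norm ?m cs"
    unfolding bs_def using min_basis[OF cs] cs by blast+
  have len: "length bs = length cs"
    using lattice_basis_length_le[OF bs cs] lattice_basis_length_le[OF cs bs] by simp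
  have "set cs \<subseteq> spn ?m bs" using lattice_basis_subset[OF cs] bs by (simp add: lattice_basis_def)
  then obtain l where l: "\<And>J. J \<in> idx ?m (length cs) \<Longrightarrow> minor cs J = l * minor bs J"
    using minor_spn_list[of ?m bs cs] bs len by (auto simp: lattice_basis_def)
  have "1 \<le> laurent_abs l"
  proof -
    obtain J where J: "J \<in> idx ?m (length cs)" "minor_norm ?m cs = laurent_abs (minor cs J)"
      using minor_norm_attained[of ?m cs] by blast
    obtain J0 where J0: "J0 \<in> idx ?m (length bs)" "minor bs J0 \<noteq> 0"
      using bs by (auto simp: lattice_basis_def indep_def)
    have "0 < laurent_abs (minor bs J0)" using J0(2) by simp
    also have "\<dots> \<le> minor_norm ?m bs" by (rule laurent_abs_minor_le[OF J0(1)])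
    finally have pos: "0 < minor_norm ?m bs" .
    have "1 * minor_norm ?m bs \<le> laurent_abs l * laurent_abs (minor bs J)"
      using le J l[OF J(1)] by (simp add: laurent_abs_mult)
    also have "\<dots> \<le> laurent_abs l * minor_norm ?m bs"
      using J(1) len by (intro mult_left_mono laurent_abs_minor_le) auto
    finally show ?thesis using pos by (simp only: mult_le_cancel_right_pos)
  qed
  have "minor_norm ?m (powers y # bs) \<le> minor_norm ?m (powers y # cs)"
  proof (subst minor_norm_le_iff, simp, safe)
    fix J assume "J \<in> idx ?m (length (powers y # bs))"
    hence J: "J \<in> idx ?m (Suc (length cs))" and lenJ: "length J = Suc (length cs)"
      using len by (auto simp: idx_def)
    have "minor (powers y # cs) J = (\<Sum>k<length J. (- 1) ^ k * powers y (J ! k) * minor cs (del k J))"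
      by (rule minor_expand_row[OF lenJ])
    also have "\<dots> = (\<Sum>k<length J. l * ((- 1) ^ k * powers y (J ! k) * minor bs (del k J)))"
    proof (rule sum.cong)
      fix k assume "k \<in> {..<length J}"
      hence "del k J \<in> idx ?m (length cs)" using J lenJ by (intro del_in_idx) auto
      thus "(- 1) ^ k * powers y (J ! k) * minor cs (del k J) = l * ((- 1) ^ k * powers y (J ! k) * minor bs (del k J))"
        by (simp add: l mult_ac)
    qed simp
    also have "\<dots> = l * (\<Sum>k<length J. (- 1) ^ k * powers y (J ! k) * minor bs (del k J))"
      by (rule sum_distrib_left[symmetric])
    also have "(\<Sum>k<length J. (- 1) ^ k * powers y (J ! k) * minor bs (del k J)) = minor (powers y # bs) J"
      by (rule minor_expand_row[symmetric]) (simp add: lenJ len)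
    finally have eq: "minor (powers y # cs) J = l * minor (powers y # bs) J" .
    have "1 * laurent_abs (minor (powers y # bs) J) \<le> laurent_abs l * laurent_abs (minor (powers y # bs) J)"
      using \<open>1 \<le> laurent_abs l\<close> by (intro mult_right_mono) auto
    also have "\<dots> = laurent_abs (minor (powers y # cs) J)" by (simp add: eq laurent_abs_mult)
    also have "\<dots> \<le> minor_norm ?m (powers y # cs)" by (rule laurent_abs_minor_le) (use J in simp)
    finally show "laurent_abs (minor (powers y # bs) J) \<le> minor_norm ?m (powers y # cs)" by simp
  qed
  thus ?thesis unfolding bs_def[symmetric] covol_def len using le
    by (intro max.mono mult_left_mono) auto
qed

text \<open>Let \<open>S\<close> be the largest member of the chain that misses \<open>v\<close>.
  Adjoining \<open>v\<close> to \<open>S\<close> gives a space comparable with the whole chain, so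
  its covolume is at least \<epsilon>; it is also at most the length of \<open>v\<close> times the
  covolume of \<open>S\<close>, which is at most 1. If no member misses \<open>v\<close>, the line
  through \<open>v\<close> does the same.\<close>

lemma covol_vector_ge:
  fixes F :: "(nat \<Rightarrow> 'a::{finite,field} fls) set set"
  assumes F: "finite F" "F \<subseteq> rational_spaces n" "\<And>S T. S \<in> F \<Longrightarrow> T \<in> F \<Longrightarrow> S \<subseteq> T \<or> T \<subseteq> S"
    and in_F: "\<And>S. S \<in> F \<Longrightarrow> \<epsilon> \<le> covol n N h y (min_basis n S) \<and> covol n N h y (min_basis n S) \<le> 1"
    and not_in_F: "\<And>S. S \<in> rational_spaces n \<Longrightarrow> S \<notin> F \<Longrightarrow> (\<And>T. T \<in> F \<Longrightarrow> S \<subseteq> T \<or> T \<subseteq> S) \<Longrightarrow>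
      \<epsilon> \<le> covol n N h y (min_basis n S)"
    and v: "integral_vec v" "i \<le> n" "v i \<noteq> 0"
  shows "\<epsilon> \<le> covol n N h y [v]"
proof -
  let ?m = "Suc n"
  have basis: "lattice_basis n S (min_basis n S)" if "S \<in> rational_spaces n" for S
    using that min_basis(1) by (auto simp: rational_spaces_def)
  have span: "spn ?m bs \<subseteq> S" if "set bs \<subseteq> S" "indep ?m bs" "S \<in> rational_spaces n" for bs S
    using spn_trans[of ?m bs "min_basis n S"] that basis[OF that(3)] by (auto simp: lattice_basis_def)
  have key: "\<epsilon> \<le> covol n N h y cs"
    if cs: "cs \<noteq> []" "lattice_basis n S cs" and cmp: "\<And>T. T \<in> F \<Longrightarrow> S \<subseteq> T \<or> T \<subseteq> S" for cs S
  proof -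
    have "S \<in> rational_spaces n" using cs by (auto simp: rational_spaces_def)
    hence "\<epsilon> \<le> covol n N h y (min_basis n S)" using in_F not_in_F cmp by blast
    also have "\<dots> \<le> covol n N h y cs" by (rule covol_min_basis_le[OF cs(2)])
    finally show ?thesis .
  qed
  define G where "G = {S\<in>F. v \<notin> S}"
  have vbasis: "indep ?m [v]"
    unfolding indep_def by (rule bexI[of _ "[i]"]) (use v in \<open>auto simp: minor_single idx_def\<close>)
  show ?thesis
  proof (cases "G = {}")
    case True
    show ?thesis
    proof (rule key)
      show "lattice_basis n (spn ?m [v]) [v]" using vbasis v(1) by (simp add: lattice_basis_def)
      show "spn ?m [v] \<subseteq> T \<or> T \<subseteq> spn ?m [v]" if "T \<in> F" for T
        using span[of "[v]" T] vbasis that True F(2) by (auto simp: G_def)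
    qed simp
  next
    case False
    have finG: "finite G" using F(1) by (simp add: G_def)
    obtain S where S: "S \<in> G" "\<And>T. T \<in> G \<Longrightarrow> S \<subseteq> T \<Longrightarrow> S = T"
      using finite_has_maximal[OF finG False] by blast
    have SF: "S \<in> F" "v \<notin> S" "S \<in> rational_spaces n" using S(1) F(2) by (auto simp: G_def)
    define cs where "cs = v # min_basis n S"
    have mb: "lattice_basis n S (min_basis n S)" by (rule basis[OF SF(3)])
    have cs: "lattice_basis n (spn ?m cs) cs"
      using mb SF(2) v(1) by (auto simp: lattice_basis_def cs_def indep_Cons_iff)
    have S_sub: "S \<subseteq> spn ?m cs"
    proof -
      have "set (min_basis n S) \<subseteq> spn ?m cs" using set_subset_spn[of cs ?m] by (auto simp: cs_def)
      hence "spn ?m (min_basis n S) \<subseteq> spn ?m cs" using mb by (intro spn_trans) (auto simp: lattice_basis_def)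
      thus ?thesis using mb by (simp add: lattice_basis_def)
    qed
    have "\<epsilon> \<le> covol n N h y cs"
    proof (rule key[OF _ cs])
      show "cs \<noteq> []" by (simp add: cs_def)
      fix T assume T: "T \<in> F"
      show "spn ?m cs \<subseteq> T \<or> T \<subseteq> spn ?m cs"
      proof (cases "v \<in> T")
        case True
        hence "S \<subseteq> T" using F(3)[OF SF(1) T] SF(2) by blast
        hence "set cs \<subseteq> T" using lattice_basis_subset[OF mb] True by (auto simp: cs_def)
        thus ?thesis using span[of cs T] cs T F(2) by (auto simp: lattice_basis_def)
      next
        case False
        hence "T \<subseteq> S" using F(3)[OF SF(1) T] S(2)[of T] T by (auto simp: G_def)
        thus ?thesis using S_sub by blast
      qed
    qed
    also have "\<dots> \<le> covol n N h y [v] * covol n N h y (min_basis n S)"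
      unfolding cs_def by (rule covol_Cons_le)
    also have "\<dots> \<le> covol n N h y [v] * 1"
      using in_F[OF SF(1)] by (intro mult_left_mono covol_nonneg) auto
    finally show ?thesis by simp
  qed
qed

text \<open>\<rho> is the value guaranteed by \<open>covol_large_somewhere\<close>, and \<epsilon>
  is \<rho> lowered by \<open>q ^ (n * s)\<close>, which by \<open>covol_good\<close> costs the
  proportion \<open>n * q powi (- s)\<close>. Chains have at most \<open>n + 1\<close> members,
  hence \<open>amplification\<close> at \<open>Suc n\<close>.\<close>

theorem short_vector_bound:
  fixes \<mu> :: "'a::{finite,field} fls measure"
  assumes \<mu>: "haar_measure \<mu>" and N: "N \<le> n * h"
  shows "\<exists>U. open U \<and> emeasure \<mu> U \<le> ennreal (amplification (real CARD('a)) (Suc n) *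
      (real n * real CARD('a) powi (- int s)) * unit_mass \<mu> * real CARD('a) powi (int M)) \<and>
    (\<forall>y\<in>lball 0 (- int M) - U. \<forall>v. integral_vec v \<longrightarrow> (\<exists>i\<le>n. v i \<noteq> 0) \<longrightarrow>
      real CARD('a) powi (- int (n * n + n * s)) \<le> covol n N h y [v])"
proof -
  let ?q = "real CARD('a)"
  have q: "1 < ?q" by (rule card_field_gt_1)
  define \<rho> where "\<rho> = ?q powi (- int (n * n))"
  define \<epsilon> where "\<epsilon> = ?q powi (- int (n * n + n * s))"
  have \<rho>1: "\<rho> \<le> 1"
  proof -
    have "\<rho> \<le> ?q powi 0" unfolding \<rho>_def card_powi_le_iff by simp
    thus ?thesis by simp
  qed
  have \<epsilon>\<rho>: "\<epsilon> \<le> \<rho>" unfolding \<epsilon>_def \<rho>_def card_powi_le_iff by simp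
  have \<epsilon>: "0 < \<epsilon>" unfolding \<epsilon>_def using q by simp
  have \<epsilon>s: "\<epsilon> * ?q ^ (s * n) \<le> \<rho>"
  proof -
    have "\<epsilon> * ?q ^ (s * n) = ?q powi (- int (n * n + n * s) + int (s * n))"
      unfolding \<epsilon>_def card_powi_add power_int_of_nat ..
    also have "- int (n * n + n * s) + int (s * n) = - int (n * n)" by simp
    finally show ?thesis by (simp add: \<rho>_def)
  qed
  have basis: "lattice_basis n S (min_basis n S)" if "S \<in> rational_spaces n" for S :: "(nat \<Rightarrow> 'a fls) set"
    using that min_basis(1) by (auto simp: rational_spaces_def)
  interpret nondivergence \<mu> "rational_spaces n" "\<lambda>S. length (min_basis n S)"
    "\<lambda>S y. covol n N h y (min_basis n S)" "Suc n" \<rho> \<epsilon> "real n * ?q powi (- int s)"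
  proof
    show "length (min_basis n S) \<in> {1..Suc n}" if S: "S \<in> rational_spaces n" for S :: "(nat \<Rightarrow> 'a fls) set"
    proof -
      obtain bs where bs: "bs \<noteq> []" "lattice_basis n S bs" using S by (auto simp: rational_spaces_def)
      have "length bs \<le> length (min_basis n S)" using lattice_basis_length_le[OF bs(2) basis[OF S]] by simp
      moreover have "length (min_basis n S) \<le> Suc n"
        using basis[OF S] indep_length_le by (auto simp: lattice_basis_def)
      moreover have "1 \<le> length bs" using bs(1) by (cases bs) auto
      ultimately show ?thesis by simp
    qed
    show "length (min_basis n S) < length (min_basis n T)"
      if "S \<in> rational_spaces n" "T \<in> rational_spaces n" "S < T" for S T :: "(nat \<Rightarrow> 'a fls) set"
      using lattice_basis_length_less[OF basis[OF that(1)] basis[OF that(2)]] that(3) by simp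
    show "\<exists>U. open U \<and> {y \<in> lball c k. covol n N h y (min_basis n S) < \<epsilon>} \<subseteq> U \<and>
        emeasure \<mu> U \<le> ennreal (real n * ?q powi (- int s) * unit_mass \<mu> * ?q powi (- k))"
      if ex: "\<exists>y\<in>lball c k. \<rho> \<le> covol n N h y (min_basis n S)" for S :: "(nat \<Rightarrow> 'a fls) set" and c k
    proof -
      obtain y0 where "y0 \<in> lball c k" "\<rho> \<le> covol n N h y0 (min_basis n S)" using ex by (elim bexE)
      thus ?thesis by (rule covol_good[OF \<mu> \<epsilon> \<epsilon>s])
    qed
  qed (use \<mu> covol_locally_small in auto)
  have "\<exists>U. open U \<and> (\<forall>y\<in>lball 0 (- int M) - U. marked {} y) \<and>
    emeasure \<mu> U \<le> ennreal (amplification ?q (Suc n) * (real n * ?q powi (- int s)) * unit_mass \<mu> * ?q powi (- (- int M)))"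
  proof (rule unmarked_bound)
    show "is_chain {}" by (simp add: is_chain_def)
    fix S :: "(nat \<Rightarrow> 'a fls) set" assume S: "S \<in> rational_spaces n"
    have "\<exists>y\<in>lball 0 0. \<rho> \<le> covol n N h y (min_basis n S)"
      unfolding \<rho>_def using basis[OF S] N by (intro covol_large_somewhere) (auto simp: lattice_basis_def)
    thus "\<exists>y\<in>lball 0 (- int M). \<rho> \<le> covol n N h y (min_basis n S)"
      using lball_mono[of "- int M" 0 "0 :: 'a fls"] by auto
  qed simp
  then obtain U where U: "open U" "\<And>y. y \<in> lball 0 (- int M) - U \<Longrightarrow> marked {} y"
    "emeasure \<mu> U \<le> ennreal (amplification ?q (Suc n) * (real n * ?q powi (- int s)) * unit_mass \<mu> * ?q powi (int M))"
    unfolding minus_minus by (elim exE conjE) (rule that, auto)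
  have "\<epsilon> \<le> covol n N h y [v]"
    if y: "y \<in> lball 0 (- int M) - U" and v: "integral_vec v" "\<exists>i\<le>n. v i \<noteq> 0" for y v
  proof -
    obtain i where i: "i \<le> n" "v i \<noteq> 0" using v(2) by blast
    from U(2)[OF y] obtain F where F: "is_chain F"
      "\<forall>S\<in>F - {}. \<epsilon> \<le> covol n N h y (min_basis n S) \<and> covol n N h y (min_basis n S) < \<rho>"
      "\<forall>S\<in>rational_spaces n - F. comparable_to F S \<longrightarrow> \<rho> \<le> covol n N h y (min_basis n S)"
      unfolding marked_def by (elim exE conjE)
    show ?thesis
    proof (rule covol_vector_ge[OF is_chain_finite(1)[OF F(1)] _ _ _ _ v(1) i])
      show "F \<subseteq> rational_spaces n" using F(1) by (simp add: is_chain_def)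
      show "S \<subseteq> T \<or> T \<subseteq> S" if "S \<in> F" "T \<in> F" for S T
        using F(1) that by (auto simp: is_chain_def comparable_to_def)
      show "\<epsilon> \<le> covol n N h y (min_basis n S) \<and> covol n N h y (min_basis n S) \<le> 1" if "S \<in> F" for S
      proof -
        have "\<epsilon> \<le> covol n N h y (min_basis n S) \<and> covol n N h y (min_basis n S) < \<rho>"
          using F(2) that by simp
        thus ?thesis using \<rho>1 by simp
      qed
      show "\<epsilon> \<le> covol n N h y (min_basis n S)"
        if S: "S \<in> rational_spaces n" "S \<notin> F" "\<And>T. T \<in> F \<Longrightarrow> S \<subseteq> T \<or> T \<subseteq> S" for S
      proof -
        have "comparable_to F S" unfolding comparable_to_def using S(3) by (rule ballI)
        hence "\<rho> \<le> covol n N h y (min_basis n S)" using F(3) S(1,2) by simp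
        thus ?thesis using \<epsilon>\<rho> by simp
      qed
    qed
  qed
  thus ?thesis using U(1,3) unfolding \<epsilon>_def by (intro exI[of _ U] conjI ballI allI impI) simp_all
qed

section \<open>Almost all series\<close>

text \<open>A dual approximation \<open>Q\<close> with numerators \<open>P i\<close> is an integral
  vector \<open>(Q, P 1, ..., P n)\<close>. At \<open>(N', h')\<close> its length is at most
  \<open>q powi (- t)\<close>, one power of \<open>q\<close> below the bound of
  \<open>short_vector_bound\<close>.\<close>

lemma not_dual_approx_bound:
  fixes \<mu> :: "'a::{finite,field} fls measure" and n k M s :: nat
  assumes \<mu>: "haar_measure \<mu>" and n: "1 \<le> n" and k: "2 \<le> k"
  defines "g \<equiv> (n + 1) * (M + (n * n + n * s + 1))"
  shows "\<exists>U. open U \<and> emeasure \<mu> U \<le> ennreal (amplification (real CARD('a)) (Suc n) *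
      (real n * real CARD('a) powi (- int s)) * unit_mass \<mu> * real CARD('a) powi (int M)) \<and>
    (\<forall>y\<in>lball 0 (- int M) - U. \<not> dual_approx n (n * (k - 1) * g) (k * g) y)"
proof -
  let ?q = "real CARD('a)"
  have q: "1 < ?q" by (rule card_field_gt_1)
  define t where "t = n * n + n * s + 1"
  define N where "N = n * (k - 1) * g"
  \<comment> \<open>The shift \<open>n * M\<close> allows for |y| up to \<open>q ^ M\<close>, and
    \<open>t\<close> for the required shortness. The condition \<open>N' \<le> n * h'\<close> then
    amounts to \<open>(n + 1) * (n * M + t) \<le> n * g\<close>, which the choice of
    \<open>g\<close> ensures.\<close>
  define N' where "N' = N + n * M + t"
  define h' where "h' = k * g - (n * M + t)"
  have g: "g = (n + 1) * (M + t)" by (simp add: g_def t_def)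
  have kg: "k * g = (k - 1) * g + g" using k by (cases k) auto
  have gt: "n * M + t \<le> g" unfolding g by (simp add: algebra_simps)
  have h': "int h' = int (k * g) - int (n * M + t)" unfolding h'_def using gt kg by simp
  have "N' \<le> n * h'"
  proof -
    have "1 * t \<le> (n * n) * t" using n by (intro mult_right_mono) auto
    hence "n * M + t + n * (n * M + t) \<le> n * g"
      unfolding g by (simp add: algebra_simps)
    moreover have "h' = (k - 1) * g + (g - (n * M + t))" unfolding h'_def kg using gt by simp
    hence "n * h' = N + n * (g - (n * M + t))" by (simp only: N_def distrib_left mult.assoc)
    ultimately show ?thesis unfolding N'_def by (simp add: diff_mult_distrib2)
  qed
  from short_vector_bound[OF \<mu> this, of s M] obtain U where U: "open U"
    "emeasure \<mu> U \<le> ennreal (amplification ?q (Suc n) *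
      (real n * ?q powi (- int s)) * unit_mass \<mu> * ?q powi (int M))"
    "\<forall>y\<in>lball 0 (- int M) - U. \<forall>v. integral_vec v \<longrightarrow> (\<exists>i\<le>n. v i \<noteq> 0) \<longrightarrow>
      ?q powi (- int (n * n + n * s)) \<le> covol n N' h' y [v]"
    by (elim exE conjE)
  have "\<not> dual_approx n N (k * g) y" if y: "y \<in> lball 0 (- int M) - U" for y
  proof
    assume "dual_approx n N (k * g) y"
    then obtain Q where Q: "Q \<in> below N" "Q \<noteq> 0" and
      P': "\<forall>i\<in>{1..n}. \<exists>P. laurent_abs (poly_T Q * y ^ i - poly_T P) < ?q powi (- int (k * g))"
      unfolding dual_approx_def by blast
    have "\<forall>i. \<exists>P. i \<in> {1..n} \<longrightarrow> laurent_abs (poly_T Q * y ^ i - poly_T P) < ?q powi (- int (k * g))"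
      using P' by blast
    from choice[OF this] obtain P where
      P: "\<And>i. i \<in> {1..n} \<Longrightarrow> laurent_abs (poly_T Q * y ^ i - poly_T (P i)) < ?q powi (- int (k * g))" by blast
    define v where "v = (\<lambda>i. poly_T (if i = 0 then Q else P i))"
    have absy: "laurent_abs y \<le> ?q ^ M" using y by (simp add: lball_def)
    have powy: "laurent_abs (y ^ i) \<le> ?q powi int (n * M)" if "i \<le> n" for i
    proof -
      have "laurent_abs (y ^ i) \<le> (?q ^ M) ^ i" unfolding laurent_abs_power by (intro power_mono absy) simp
      also have "\<dots> = ?q ^ (M * i)" by (simp add: power_mult)
      also have "\<dots> \<le> ?q ^ (n * M)" using q that by (intro power_increasing) (auto simp: mult.commute)
      finally show ?thesis by (simp only: power_int_of_nat)
    qed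
    have diff: "laurent_abs (v i - poly_T Q * y ^ i) \<le> ?q powi (- int (k * g))" if "i \<le> n" for i
    proof (cases "i = 0")
      case False
      hence "laurent_abs (v i - poly_T Q * y ^ i) < ?q powi (- int (k * g))"
        unfolding laurent_abs_diff_commute[of "v i"] using P[of i] that by (simp add: v_def)
      thus ?thesis by (rule less_imp_le)
    qed (simp add: v_def)
    have absQ: "laurent_abs (poly_T Q) \<le> ?q powi int N"
      using Q by (subst laurent_abs_poly_T_le_iff) (auto simp: in_below_iff)
    have abs_v: "laurent_abs (v i) \<le> ?q powi int (N + n * M)" if i: "i \<le> n" for i
    proof -
      have "laurent_abs (poly_T Q * y ^ i) \<le> ?q powi int N * ?q powi int (n * M)"
        unfolding laurent_abs_mult by (intro mult_mono absQ powy i) auto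
      hence 1: "laurent_abs (poly_T Q * y ^ i) \<le> ?q powi int (N + n * M)"
        by (simp only: of_nat_add card_powi_add)
      have "?q powi (- int (k * g)) \<le> ?q powi int (N + n * M)" unfolding card_powi_le_iff by linarith
      hence 2: "laurent_abs (v i - poly_T Q * y ^ i) \<le> ?q powi int (N + n * M)"
        using diff[OF i] by linarith
      show ?thesis using laurent_abs_add_le[OF 1 2] by simp
    qed
    have "integral_vec v" by (simp add: integral_vec_def v_def)
    moreover have "v 0 \<noteq> 0" using Q(2) by (simp add: v_def)
    ultimately have le: "?q powi (- int (n * n + n * s)) \<le> covol n N' h' y [v]"
      using U(3) y by auto
    have "minor_norm (Suc n) [v] \<le> ?q powi int (N + n * M)"
    proof (subst minor_norm_le_iff, simp, safe)
      fix J assume "J \<in> idx (Suc n) (length [v])"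
      then obtain i where "J = [i]" "i \<le> n" by (auto simp: idx_def length_Suc_conv)
      thus "laurent_abs (minor [v] J) \<le> ?q powi int (N + n * M)" using abs_v by (simp add: minor_single)
    qed
    hence "?q powi (int (length [v]) * int h' - int h' - int N') * minor_norm (Suc n) [v] \<le>
        ?q powi (- int N') * ?q powi int (N + n * M)"
      by (simp add: mult_left_mono)
    also have "\<dots> = ?q powi (- int t)"
      unfolding card_powi_add[symmetric] by (rule arg_cong[of _ _ "power_int ?q"]) (simp add: N'_def)
    finally have 1: "?q powi (int (length [v]) * int h' - int h' - int N') * minor_norm (Suc n) [v] \<le> ?q powi (- int t)" .
    have "minor_norm (Suc n) [powers y, v] \<le> ?q powi int (n * M) * ?q powi (- int (k * g))"
    proof (subst minor_norm_le_iff, simp, safe)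
      fix J assume "J \<in> idx (Suc n) (length [powers y, v])"
      then obtain i j where ij: "J = [i, j]" "i \<le> n" "j \<le> n"
        by (auto simp: idx_def length_Suc_conv numeral_2_eq_2)
      have eq: "minor [powers y, v] J = y ^ i * (v j - poly_T Q * y ^ j) - y ^ j * (v i - poly_T Q * y ^ i)"
        unfolding ij(1) minor_powers_single by (simp add: algebra_simps)
      have "laurent_abs (y ^ a * (v b - poly_T Q * y ^ b)) \<le> ?q powi int (n * M) * ?q powi (- int (k * g))"
        if "a \<le> n" "b \<le> n" for a b
        unfolding laurent_abs_mult by (intro mult_mono powy diff that) auto
      thus "laurent_abs (minor [powers y, v] J) \<le> ?q powi int (n * M) * ?q powi (- int (k * g))"
        unfolding eq using ij by (intro laurent_abs_diff_le) auto
    qed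
    hence "?q powi (int (length [v]) * int h') * minor_norm (Suc n) [powers y, v] \<le>
        ?q powi int h' * (?q powi int (n * M) * ?q powi (- int (k * g)))"
      by (simp add: mult_left_mono)
    also have "\<dots> = ?q powi (- int t)"
      unfolding card_powi_add[symmetric] by (rule arg_cong[of _ _ "power_int ?q"]) (simp add: h')
    finally have 2: "?q powi (int (length [v]) * int h') * minor_norm (Suc n) [powers y, v] \<le> ?q powi (- int t)" .
    have "covol n N' h' y [v] \<le> ?q powi (- int t)" unfolding covol_def using 1 2 by simp
    hence "?q powi (- int (n * n + n * s)) \<le> ?q powi (- int t)" using le by linarith
    thus False unfolding card_powi_le_iff t_def by simp
  qed
  thus ?thesis using U(1,2) unfolding N_def by (intro exI[of _ U] conjI ballI) simp_all
qed

lemma AE_eventually_not_in: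
  fixes \<mu> :: "'a::{finite,field} fls measure"
  assumes \<mu>: "haar_measure \<mu>" and U: "\<And>s::nat. open (U s)" and x: "0 \<le> x" "x < 1" and C: "0 \<le> C"
    and le: "\<And>s. emeasure \<mu> (U s) \<le> ennreal (C * x ^ s)"
  shows "AE y in \<mu>. eventually (\<lambda>s. y \<notin> U s) sequentially"
proof -
  have meas: "U s \<in> sets \<mu>" for s by (rule haar_open[OF \<mu> U])
  have fin: "emeasure \<mu> (U s) < \<infinity>" for s using le[of s] by (rule order.strict_trans1) simp
  have "AE y in \<mu>. eventually (\<lambda>s. y \<in> space \<mu> - U s) sequentially"
  proof (rule borel_cantelli_AE1[OF meas fin])
    show "summable (\<lambda>s. measure \<mu> (U s))"
    proof (rule summable_comparison_test')
      show "summable (\<lambda>s. C * x ^ s)" using x by (intro summable_mult summable_geometric) simp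
      show "norm (measure \<mu> (U s)) \<le> C * x ^ s" if "0 \<le> s" for s
      proof -
        have "enn2real (emeasure \<mu> (U s)) \<le> C * x ^ s"
          using le[of s] C x by (intro enn2real_leI) auto
        thus ?thesis by (simp add: measure_def)
      qed
    qed
  qed
  thus ?thesis by (rule AE_mp) (auto intro!: AE_I2 elim: eventually_mono)
qed

text \<open>For fixed \<open>k\<close> and \<open>M\<close> the exceptional sets have measures
  summable in \<open>s\<close>, so almost every \<open>y\<close> avoids all but finitely many of
  them, and the values \<open>g s\<close> are unbounded. Only countably many \<open>k\<close> and
  \<open>M\<close> are then combined.\<close>

lemma AE_not_dual_approx:
  fixes \<mu> :: "'a::{finite,field} fls measure"
  assumes \<mu>: "haar_measure \<mu>" and n: "1 \<le> n"
  shows "AE y in \<mu>. \<forall>k\<ge>2. \<exists>\<^sub>\<infinity>g. \<not> dual_approx n (n * (k - 1) * g) (k * g) y"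
proof -
  let ?q = "real CARD('a)"
  have q: "1 < ?q" by (rule card_field_gt_1)
  have in_ball: "AE y in \<mu>. y \<in> lball 0 (- int M) \<longrightarrow> (\<exists>\<^sub>\<infinity>g. \<not> dual_approx n (n * (k - 1) * g) (k * g) y)"
    if k: "2 \<le> k" for k M
  proof -
    define g where "g s = (n + 1) * (M + (n * n + n * s + 1))" for s
    define C where "C = amplification ?q (Suc n) * real n * unit_mass \<mu> * ?q powi (int M)"
    have C: "0 \<le> C" unfolding C_def using q by (intro mult_nonneg_nonneg amplification_nonneg) auto
    have "\<forall>s. \<exists>U. open U \<and> emeasure \<mu> U \<le> ennreal (C * (1 / ?q) ^ s) \<and>
      (\<forall>y\<in>lball 0 (- int M) - U. \<not> dual_approx n (n * (k - 1) * g s) (k * g s) y)"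
    proof
      fix s
      have "amplification ?q (Suc n) * (real n * ?q powi (- int s)) * unit_mass \<mu> * ?q powi (int M) = C * (1 / ?q) ^ s"
        by (simp add: C_def power_int_minus power_one_over field_simps)
      thus "\<exists>U. open U \<and> emeasure \<mu> U \<le> ennreal (C * (1 / ?q) ^ s) \<and>
        (\<forall>y\<in>lball 0 (- int M) - U. \<not> dual_approx n (n * (k - 1) * g s) (k * g s) y)"
        using not_dual_approx_bound[OF \<mu> n k, of s M] unfolding g_def by simp
    qed
    from choice[OF this] obtain U where U0: "\<forall>s. open (U s) \<and> emeasure \<mu> (U s) \<le> ennreal (C * (1 / ?q) ^ s) \<and>
      (\<forall>y\<in>lball 0 (- int M) - U s. \<not> dual_approx n (n * (k - 1) * g s) (k * g s) y)" by (elim exE)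
    have U: "open (U s)" "emeasure \<mu> (U s) \<le> ennreal (C * (1 / ?q) ^ s)"
      "y \<in> lball 0 (- int M) - U s \<Longrightarrow> \<not> dual_approx n (n * (k - 1) * g s) (k * g s) y" for s y
      using spec[OF U0, of s] by (elim conjE, simp)+
    have "AE y in \<mu>. eventually (\<lambda>s. y \<notin> U s) sequentially"
      by (rule AE_eventually_not_in[OF \<mu> U(1) _ _ C U(2)]) (use q in auto)
    thus ?thesis
    proof (rule AE_mp, intro AE_I2 impI)
      fix y assume ev: "eventually (\<lambda>s. y \<notin> U s) sequentially" and y: "y \<in> lball 0 (- int M)"
      then obtain s0 where s0: "\<And>s. s \<ge> s0 \<Longrightarrow> y \<notin> U s" unfolding eventually_sequentially by blast
      show "\<exists>\<^sub>\<infinity>g. \<not> dual_approx n (n * (k - 1) * g) (k * g) y"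
        unfolding INFM_nat
      proof
        fix G
        define s where "s = s0 + G"
        have "1 * s \<le> n * s" using n by (intro mult_right_mono) auto
        moreover have "G \<le> s" by (simp add: s_def)
        ultimately have "G < M + (n * n + n * s + 1)" by linarith
        also have "\<dots> \<le> g s" unfolding g_def by simp
        finally have "g s > G" .
        moreover have "\<not> dual_approx n (n * (k - 1) * g s) (k * g s) y"
          using U(3)[of y s] y s0[of s] by (simp add: s_def)
        ultimately show "\<exists>g>G. \<not> dual_approx n (n * (k - 1) * g) (k * g) y" by blast
      qed
    qed
  qed
  have "AE y in \<mu>. \<forall>k\<in>{2..}. \<forall>M. y \<in> lball 0 (- int M) \<longrightarrow> (\<exists>\<^sub>\<infinity>g. \<not> dual_approx n (n * (k - 1) * g) (k * g) y)"
  proof (subst AE_ball_countable, simp, intro ballI)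
    fix k :: nat assume "k \<in> {2..}"
    thus "AE y in \<mu>. \<forall>M. y \<in> lball 0 (- int M) \<longrightarrow> (\<exists>\<^sub>\<infinity>g. \<not> dual_approx n (n * (k - 1) * g) (k * g) y)"
      unfolding AE_all_countable by (intro allI in_ball) simp
  qed
  thus ?thesis
  proof (rule AE_mp, intro AE_I2 impI allI)
    fix y :: "'a fls" and k assume *: "\<forall>k\<in>{2..}. \<forall>M. y \<in> lball 0 (- int M) \<longrightarrow> (\<exists>\<^sub>\<infinity>g. \<not> dual_approx n (n * (k - 1) * g) (k * g) y)"
      and k: "(2::nat) \<le> k"
    obtain M :: nat where "laurent_abs y \<le> ?q ^ M" using ex_laurent_abs_le_power[of y] .
    hence "y \<in> lball 0 (- int M)" by (simp add: lball_def)
    thus "\<exists>\<^sub>\<infinity>g. \<not> dual_approx n (n * (k - 1) * g) (k * g) y" using * k by auto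
  qed
qed

text \<open>Algebraic series are countable, and each point lies in balls of arbitrarily small
  measure.\<close>

lemma AE_not_algebraic:
  fixes \<mu> :: "'a::{finite,field} fls measure"
  assumes \<mu>: "haar_measure \<mu>"
  shows "AE y in \<mu>. \<not> alg_series y"
proof -
  have point: "AE y in \<mu>. y \<noteq> x" for x
  proof -
    have "emeasure \<mu> {x} \<le> ennreal (unit_mass \<mu> * real CARD('a) powi (- int k))" for k
      unfolding emeasure_lball[OF \<mu>, of x k, symmetric]
      by (intro emeasure_mono haar_open[OF \<mu> open_lball]) auto
    moreover have "(\<lambda>k. ennreal (unit_mass \<mu> * real CARD('a) powi (- int k))) \<longlonglongrightarrow> ennreal 0"
    proof (intro tendsto_ennrealI)
      have "(\<lambda>k. unit_mass \<mu> * (1 / real CARD('a)) ^ k) \<longlonglongrightarrow> unit_mass \<mu> * 0"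
        using card_field_gt_1[where 'a='a] by (intro tendsto_mult tendsto_const LIMSEQ_power_zero) simp
      thus "(\<lambda>k. unit_mass \<mu> * real CARD('a) powi (- int k)) \<longlonglongrightarrow> 0"
        by (simp add: power_int_minus power_one_over inverse_eq_divide)
    qed
    ultimately have "emeasure \<mu> {x} \<le> ennreal 0" by (intro LIMSEQ_le_const) auto
    moreover have "{x} \<in> sets \<mu>" by (simp add: haar_sets[OF \<mu>])
    ultimately have "{x} \<in> null_sets \<mu>" by (intro null_setsI) auto
    thus ?thesis by (rule AE_I') auto
  qed
  have "countable {x :: 'a fls. alg_series x}"
  proof (rule countable_subset)
    show "{x :: 'a fls. alg_series x} \<subseteq> (\<Union>k. \<Union>P\<in>bounded_polys k k - {0}. {x. eval_X P x = 0})"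
    proof
      fix x :: "'a fls" assume "x \<in> {x. alg_series x}"
      then obtain P where P: "P \<noteq> 0" "eval_X P x = 0" by (auto simp: alg_series_def)
      define k where "k = max (degree P) (degree_T P)"
      have "height P \<le> real CARD('a) ^ k"
        using card_field_gt_1[where 'a='a] by (simp add: height_eq_degree_T[OF P(1)] k_def)
      hence "P \<in> bounded_polys k k - {0}" using P(1) by (simp add: bounded_polys_iff k_def)
      thus "x \<in> (\<Union>k. \<Union>P\<in>bounded_polys k k - {0}. {x. eval_X P x = 0})" using P(2) by blast
    qed
    show "countable (\<Union>k. \<Union>P\<in>bounded_polys k k - {0}. {x :: 'a fls. eval_X P x = 0})"
    proof (rule countable_UN)
      fix k :: nat
      show "countable (\<Union>P\<in>bounded_polys k k - {0}. {x :: 'a fls. eval_X P x = 0})"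
        by (intro countable_finite finite_UN_I finite_Diff finite_bounded_polys finite_roots_eval_X) auto
    qed simp
  qed
  hence "AE y in \<mu>. \<forall>x\<in>{x. alg_series x}. y \<noteq> x"
    using point by (subst AE_ball_countable) auto
  thus ?thesis by (rule AE_mp) auto
qed

text \<open>There are at most \<open>n * q ^ ((h + 1) * (n + 1))\<close> roots of polynomials of
  height at most \<open>q ^ h\<close>. Balls of radius about \<open>q powr (- h * (r + 1))\<close>
  around them have total measure of order \<open>q powr (h * (n - r))\<close>, summable since
  \<open>r > n\<close>.\<close>

lemma AE_w_star_le:
  fixes \<mu> :: "'a::{finite,field} fls measure"
  assumes \<mu>: "haar_measure \<mu>" and r: "real n < r"
  shows "AE y in \<mu>. w_star n y \<le> ereal r"
proof -
  let ?q = "real CARD('a)"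
  have q: "1 < ?q" by (rule card_field_gt_1)
  define R where "R h = (\<Union>P\<in>bounded_polys n h - {0}. {x :: 'a fls. eval_X P x = 0})" for h
  have finR: "finite (R h)" for h
    unfolding R_def by (intro finite_UN_I finite_Diff finite_bounded_polys finite_roots_eval_X) auto
  have cardR: "card (R h) \<le> n * CARD('a) ^ (Suc h * Suc n)" for h
  proof -
    have "card (R h) \<le> (\<Sum>P\<in>bounded_polys n h - {0}. card {x :: 'a fls. eval_X P x = 0})"
      unfolding R_def by (rule card_UN_le) simp
    also have "\<dots> \<le> (\<Sum>P\<in>bounded_polys n h - {0 :: 'a poly poly}. n)"
      by (intro sum_mono order_trans[OF finite_roots_eval_X(2)]) (auto simp: bounded_polys_iff)
    also have "\<dots> \<le> n * card (bounded_polys n h :: 'a poly poly set)"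
      by (simp add: card_mono mult.commute)
    finally show ?thesis unfolding card_bounded_polys .
  qed
  \<comment> \<open>Rounding costs less than a factor \<open>q\<close>; with the
    \<open>n + 1\<close> from counting polynomials this gives the \<open>q ^ (n + 2)\<close> in
    \<open>C\<close>.\<close>
  define L where "L h = \<lfloor>real h * (r + 1)\<rfloor>" for h :: nat
  define G where "G h = (\<Union>x\<in>R h. lball x (L h))" for h
  define C where "C = real n * ?q ^ (n + 2) * unit_mass \<mu>"
  define x where "x = ?q powr (real n - r)"
  have "emeasure \<mu> (G h) \<le> ennreal (C * x ^ h)" for h
  proof -
    have "emeasure \<mu> (G h) \<le> ennreal (real (n * CARD('a) ^ (Suc h * Suc n)) * unit_mass \<mu> * ?q powi (- L h))"
      unfolding G_def by (rule emeasure_UN_lball_le[OF \<mu> finR cardR])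
    also have "\<dots> \<le> ennreal (C * x ^ h)"
    proof (rule ennreal_leI)
      have "?q powi (- L h) = ?q powr (real_of_int (- L h))" by (rule card_powr_conv_powi[symmetric])
      also have "\<dots> \<le> ?q powr (1 - real h * (r + 1))"
        using q unfolding L_def by (intro powr_mono) linarith+
      finally have "?q ^ (Suc h * Suc n) * ?q powi (- L h) \<le> ?q powr real (Suc h * Suc n) * ?q powr (1 - real h * (r + 1))"
        using q by (simp add: powr_realpow mult_left_mono del: of_nat_mult of_nat_Suc mult_Suc mult_Suc_right)
      also have "\<dots> = ?q powr (real (n + 2) + real h * (real n - r))"
        unfolding powr_add[symmetric] by (rule arg_cong[of _ _ "(powr) ?q"]) (simp add: algebra_simps)
      also have "\<dots> = ?q ^ (n + 2) * x ^ h"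
      proof -
        have "x ^ h = ?q powr (real h * (real n - r))"
          using q by (simp add: x_def powr_realpow[symmetric] powr_powr mult.commute)
        thus ?thesis using q by (simp only: powr_add powr_realpow)
      qed
      finally have "?q ^ (Suc h * Suc n) * ?q powi (- L h) \<le> ?q ^ (n + 2) * x ^ h" .
      hence "(real n * unit_mass \<mu>) * (?q ^ (Suc h * Suc n) * ?q powi (- L h)) \<le>
          (real n * unit_mass \<mu>) * (?q ^ (n + 2) * x ^ h)" by (rule mult_left_mono) simp
      thus "real (n * CARD('a) ^ (Suc h * Suc n)) * unit_mass \<mu> * ?q powi (- L h) \<le> C * x ^ h"
        by (simp add: C_def mult_ac del: power_Suc mult_Suc mult_Suc_right)
    qed
    finally show ?thesis .
  qed
  moreover have "x < 1" "0 \<le> x" unfolding x_def using q r powr_less_mono[of "real n - r" 0 ?q] by auto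
  ultimately have "AE y in \<mu>. eventually (\<lambda>h. y \<notin> G h) sequentially"
    by (intro AE_eventually_not_in[OF \<mu>, of G x C]) (auto simp: G_def C_def open_lball)
  thus ?thesis
  proof (rule AE_mp, intro AE_I2 impI)
    fix y assume "eventually (\<lambda>h. y \<notin> G h) sequentially"
    then obtain h0 where h0: "\<And>h. h \<ge> h0 \<Longrightarrow> y \<notin> G h" unfolding eventually_sequentially by blast
    show "w_star n y \<le> ereal r"
      unfolding w_star_def
    proof (rule SUP_least, rule ccontr)
      fix r' :: real
      define A where "A = {\<alpha> :: 'a fls. alg_series \<alpha> \<and> alg_degree \<alpha> \<le> n \<and>
        0 < laurent_abs (y - \<alpha>) \<and> laurent_abs (y - \<alpha>) < alg_height \<alpha> powr (- r' - 1)}"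
      assume "r' \<in> {r. infinite {\<alpha> :: 'a fls. alg_series \<alpha> \<and> alg_degree \<alpha> \<le> n \<and>
        0 < laurent_abs (y - \<alpha>) \<and> laurent_abs (y - \<alpha>) < alg_height \<alpha> powr (- r - 1)}}"
      hence inf: "infinite A" by (simp add: A_def)
      assume "\<not> ereal r' \<le> ereal r"
      hence r': "r < r'" by simp
      \<comment> \<open>An \<alpha> in \<open>A\<close> of height \<open>q ^ h\<close> puts
        \<open>y\<close> into \<open>G h\<close>, so \<open>h < h0\<close>, and only finitely many
        \<alpha> remain.\<close>
      have "A \<subseteq> R h0"
      proof
        fix \<alpha> assume \<alpha>: "\<alpha> \<in> A"
        define P where "P = min_def_poly \<alpha>"
        have alg: "alg_series \<alpha>" using \<alpha> by (simp add: A_def)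
        have root: "eval_X P \<alpha> = 0" and P0: "P \<noteq> 0" using min_def_poly[OF alg] by (auto simp: P_def)
        have deg: "degree P \<le> n" using \<alpha> by (simp add: A_def P_def alg_degree_def)
        define h where "h = degree_T P"
        have ht: "height P = ?q ^ h" unfolding h_def by (rule height_eq_degree_T[OF P0])
        have "laurent_abs (y - \<alpha>) < height P powr (- r' - 1)" using \<alpha> by (simp add: A_def P_def alg_height_def)
        also have "\<dots> \<le> height P powr (- r - 1)" using height_ge_1[OF P0] r' by (intro powr_mono) auto
        also have "\<dots> = ?q powr (- (real h * (r + 1)))"
        proof -
          have "- (real h * (r + 1)) = real h * (- r - 1)" by (simp add: algebra_simps)
          thus ?thesis unfolding ht using q by (simp only: powr_powr powr_realpow[symmetric])
        qed
        also have "\<dots> \<le> ?q powr real_of_int (- L h)" unfolding L_def using q by (intro powr_mono) linarith+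
        also have "\<dots> = ?q powi (- L h)" by (rule card_powr_conv_powi)
        finally have "y \<in> lball \<alpha> (L h)" by (simp add: lball_def)
        moreover have "\<alpha> \<in> R h" unfolding R_def using root P0 deg ht by (auto simp: bounded_polys_iff intro!: bexI[of _ P])
        ultimately have "y \<in> G h" by (auto simp: G_def)
        hence "h < h0" using h0[of h] by (meson not_le)
        hence "height P \<le> ?q ^ h0" unfolding ht using q by (intro power_increasing) auto
        thus "\<alpha> \<in> R h0" unfolding R_def using root P0 deg by (auto simp: bounded_polys_iff intro!: bexI[of _ P])
      qed
      thus False using inf finR finite_subset by blast
    qed
  qed
qed

text \<open>The upper bound is the limit of the countably many bounds
  \<open>n + 1 / (j + 1)\<close>; the lower bound is \<open>w_star_ge\<close> at a transcendental
  point.\<close>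

lemma AE_w_star_eq:
  fixes \<mu> :: "'a::{finite,field} fls measure"
  assumes \<mu>: "haar_measure \<mu>"
  shows "AE y in \<mu>. \<forall>n\<ge>1. w_star n y = ereal (real n)"
proof -
  have "AE y in \<mu>. w_star n y = ereal (real n)" if n: "1 \<le> n" for n
  proof -
    have "AE y in \<mu>. \<forall>j::nat. w_star n y \<le> ereal (real n + 1 / real (Suc j))"
      unfolding AE_all_countable by (intro allI AE_w_star_le[OF \<mu>]) simp
    thus ?thesis using AE_not_algebraic[OF \<mu>] AE_not_dual_approx[OF \<mu> n]
    proof eventually_elim
      case (elim y)
      have "w_star n y \<le> ereal (real n)"
      proof (rule LIMSEQ_le_const)
        have "(\<lambda>j. real n + 1 / real (Suc j)) \<longlonglongrightarrow> real n + 0"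
          by (intro tendsto_add tendsto_const LIMSEQ_inverse_real_of_nat[unfolded inverse_eq_divide])
        thus "(\<lambda>j. ereal (real n + 1 / real (Suc j))) \<longlonglongrightarrow> ereal (real n)" by simp
      qed (use elim(1) in blast)
      moreover have "ereal (real n) \<le> w_star n y" by (rule w_star_ge[OF n]) (use elim in auto)
      ultimately show ?case by (rule antisym)
    qed
  qed
  hence "AE y in \<mu>. \<forall>n\<in>{1..}. w_star n y = ereal (real n)"
    by (subst AE_ball_countable) auto
  thus ?thesis by (simp only: Ball_def atLeast_iff)
qed

theorem theorem1p6:
  fixes p q :: nat
  assumes "prime p" and "\<exists>e \<ge> 1. q = p ^ e" and "CARD('a::{finite,field}) = q"
  shows "(\<forall>n \<ge> 1. \<forall>\<xi> :: 'a fls. \<not> (alg_series \<xi> \<and> alg_degree \<xi> \<le> n) \<longrightarrow>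
            w n \<xi> = ereal (real n) \<longrightarrow> w_star n \<xi> = ereal (real n)) \<and>
         (\<forall>\<mu> :: 'a fls measure. haar_measure \<mu> \<longrightarrow>
            (AE \<xi> in \<mu>. \<forall>n \<ge> 1. w_star n \<xi> = ereal (real n)))"
  using w_star_eq_of_w_eq AE_w_star_eq by blast

end
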